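(* Let $(X,x)$ be a pointed Kan complex. For $n\ge 0$: (1) the natural map $\pi_n(X,x)\to[(\partial\square^{n+1},0),(X,x)]_*$ (precomposition with the map $\partial\square^{n+1}\to\square^n/\partial\square^n$ described in the context) to the set of pointed homotopy classes of pointed maps is a bijection; (2) for any pointed map $f\colon(\partial\square^{n+1},0)\to(X,x)$, writing $[\tilde f]\in\pi_n(X,x)$ for the preimage of $f$ under this bijection, we have $[\tilde f]=[x\sigma_1\cdots\sigma_n]$ (the class of the degenerate $n$-cube at $x$) if and only if $f$ has a filler, i.e. extends along $\partial\square^{n+1}\hookrightarrow\square^{n+1}$ to a map $\square^{n+1}\to X$.
   Context: Cubes: $\square$ is the category whose objects are the posets $[1]^n=\{0\le 1\}^n$, $n\ge 0$, with morphisms generated under composition (inside posets) by the faces $\partial_{i,\varepsilon}\colon [1]^{n-1}\to[1]^n$ inserting $\varepsilon\in\{0,1\}$ as $i$-th coordinate, the degeneracies $\sigma_i\colon[1]^n\to[1]^{n-1}$ deleting the $i$-th coordinate, and the connections $\gamma_{i,0},\gamma_{i,1}\colon[1]^n\to[1]^{n-1}$ ($1\le i\le n-1$) replacing $x_i,x_{i+1}$ by their maximum, resp. minimum. A cubical set is a functor $X\colon\square^{op}\to\mathsf{Set}$; operators act on the right. $\square^n$ is the representable at $[1]^n$; $\partial\square^n\subseteq\square^n$ is the union of the images of all faces; the open box $\sqcap^n_{i,\varepsilon}$ is the union of the images of all faces $\partial_{j,\eta}$ with $(j,\eta)\ne(i,\varepsilon)$. The geometric product $\otimes$ is the left Kan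 extension of $[1]^m\otimes[1]^n=[1]^{m+n}$, and $\hom_R(X,-)$ is the right adjoint of $X\otimes -$. A Kan complex is a cubical set $X$ such that every map $\sqcap^n_{i,\varepsilon}\to X$ extends to $\square^n\to X$. Loop spaces: for a pointed cubical set $(X,x)$, $\Omega(X,x)$ is the pullback of $(x,x)\colon\square^0\to X\times X$ along $(\partial_{1,0}^*,\partial_{1,1}^* )\colon\hom_R(\square^1,X)\to X\times X$, pointed at $x\sigma_1$; $\Omega^0(X,x)=(X,x)$ and $\Omega^n(X,x)=\Omega(\Omega^{n-1}(X,x))$. $\pi_0(X)$ is the colimit of $X\colon\square^{op}\to\mathsf{Set}$ (for Kan $X$: homotopy classes of $0$-cubes), and $\pi_n(X,x)=\pi_0(\Omega^n(X,x))$. The quotient $\square^n/\partial\square^n$ is the pushout of $\square^n\hookleftarrow\partial\square^n\to\square^0$, with base point $[0]$ coming from $\square^0$; write $[\mathrm{id}]\colon\square^n\to\square^n/\partial\square^n$ for the quotient map. A $0$-cube of $\Omega^n(X,x)$ is identified with an $n$-cube $\square^n\to X$ sending $\partial\square^n$ to $x$, i.e. with a pointed map $(\square^n/\partial\square^n,[0])\to(X,x)$, and this identifies $\pi_n(X,x)$ with the set $[(\square^n/\partial\square^n,[0]),(X,x)]$ of pointed homotopy classes of pointed maps. A pointed homotopy between pointed maps $f,g\colon(Z,z)\to(X,x)$ is a map $H\colon Z\otimes\square^1\to X$ restricting to $f$ and $g$ at the $\partial_{1,0}$- and $\partial_{1,1}$-ends of $\square^1$ and constant at $x$ on $\{z\}\otimes\square^1$.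 The natural map: $0$ denotes the vertex $(0,\dots,0)$ of $\partial\square^{n+1}$. Write $\partial\square^{n+1}$ as the pushout of $\square^n\otimes\partial\square^1\leftarrow\partial\square^n\otimes\partial\square^1\to\partial\square^n\otimes\square^1$. Define the map $\partial\square^{n+1}\to\square^n/\partial\square^n$ to be $[\mathrm{id}]$ on $\square^n\otimes\{0\}$ (the face $\partial_{n+1,0}$) and constant at $[0]$ on $\square^n\otimes\{1\}$ and on $\partial\square^n\otimes\square^1$. The natural map $\pi_n(X,x)\to[(\partial\square^{n+1},0),(X,x)]_*$ is precomposition with this map, using the identification of $\pi_n(X,x)$ with pointed homotopy classes of pointed maps $(\square^n/\partial\square^n,[0])\to(X,x)$.
   Formalization: For n = 0 the described map sends the base vertex 0 to [id] rather than to the base point [0], so it is not pointed; for n = 0 only, the two ends are exchanged ([id] at the end 1, constant at [0] at the end 0). For n ≥ 1 the map is as described. *)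

theory Defs
  imports "HOL-Library.FuncSet"
begin

section \<open>The cube category\<close>

text \<open>
  The poset \<open>[1]^n\<close> is the set of boolean lists of length \<open>n\<close>, with \<open>False\<close> for \<open>0\<close> and \<open>True\<close>
  for \<open>1\<close>.  Coordinates are numbered from 1 in the generators, so \<open>x_i\<close> is \<open>v ! (i - 1)\<close>.
  Cube maps are extensional functions (\<open>undefined\<close> outside the domain cube), so that equality of
  functions is equality of morphisms; composition is \<open>compose\<close> from \<open>FuncSet\<close>.
\<close>

definition verts :: "nat \<Rightarrow> bool list set" where
  "verts n = {v. length v = n}"

type_synonym cube_map = "bool list \<Rightarrow> bool list"

definition id_map :: "nat \<Rightarrow> cube_map" where
  "id_map n = (\<lambda>v\<in>verts n. v)"

text \<open>\<open>face n i \<epsilon> : [1]^n \<rightarrow> [1]^(n+1)\<close>, while \<open>degeneracy n i\<close> and \<open>connection n i \<epsilon>\<close> are maps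
  \<open>[1]^(n+1) \<rightarrow> [1]^n\<close>.\<close>

definition face :: "nat \<Rightarrow> nat \<Rightarrow> bool \<Rightarrow> cube_map" where
  "face n i \<epsilon> = (\<lambda>v\<in>verts n. take (i - 1) v @ [\<epsilon>] @ drop (i - 1) v)"

definition degeneracy :: "nat \<Rightarrow> nat \<Rightarrow> cube_map" where
  "degeneracy n i = (\<lambda>v\<in>verts (n + 1). take (i - 1) v @ drop i v)"

definition connection :: "nat \<Rightarrow> nat \<Rightarrow> bool \<Rightarrow> cube_map" where
  "connection n i \<epsilon> = (\<lambda>v\<in>verts (n + 1).
     take (i - 1) v @ [if \<epsilon> then v ! (i - 1) \<and> v ! i else v ! (i - 1) \<or> v ! i] @ drop (i + 1) v)"

inductive cube_mor :: "nat \<Rightarrow> nat \<Rightarrow> cube_map \<Rightarrow> bool" where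
  mor_id: "cube_mor n n (id_map n)"
| mor_face: "1 \<le> i \<Longrightarrow> i \<le> n + 1 \<Longrightarrow> cube_mor n (n + 1) (face n i \<epsilon>)"
| mor_degeneracy: "1 \<le> i \<Longrightarrow> i \<le> n + 1 \<Longrightarrow> cube_mor (n + 1) n (degeneracy n i)"
| mor_connection: "1 \<le> i \<Longrightarrow> i \<le> n \<Longrightarrow> cube_mor (n + 1) n (connection n i \<epsilon>)"
| mor_comp: "cube_mor k m f \<Longrightarrow> cube_mor m n g \<Longrightarrow> cube_mor k n (compose (verts k) g f)"

definition cube_hom :: "nat \<Rightarrow> nat \<Rightarrow> cube_map set" where
  "cube_hom m n = {f. cube_mor m n f}"

definition cube_tensor :: "nat \<Rightarrow> nat \<Rightarrow> cube_map \<Rightarrow> cube_map \<Rightarrow> cube_map" where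
  "cube_tensor m m' f g = (\<lambda>v\<in>verts (m + m'). f (take m v) @ g (drop m v))"

lemma cube_homD: "f \<in> cube_hom m n \<Longrightarrow> f \<in> verts m \<rightarrow>\<^sub>E verts n"
proof -
  have "cube_mor m n f \<Longrightarrow> f \<in> verts m \<rightarrow>\<^sub>E verts n"
  proof (induction rule: cube_mor.induct)
    case (mor_comp k m f n g)
    then show ?case by (auto simp: PiE_iff compose_eq)
  qed (auto simp: id_map_def face_def degeneracy_def connection_def verts_def split: if_splits)
  then show "f \<in> cube_hom m n \<Longrightarrow> f \<in> verts m \<rightarrow>\<^sub>E verts n" by (simp add: cube_hom_def)
qed

lemma cube_hom_id: "id_map n \<in> cube_hom n n"
  by (simp add: cube_hom_def mor_id)

lemma cube_hom_comp: "f \<in> cube_hom k m \<Longrightarrow> g \<in> cube_hom m n \<Longrightarrow> compose (verts k) g f \<in> cube_hom k n"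
  by (auto simp: cube_hom_def intro: mor_comp)

lemma comp_id_left: "f \<in> cube_hom m n \<Longrightarrow> compose (verts m) (id_map n) f = f"
  unfolding id_map_def by (rule Id_compose) (auto dest!: cube_homD simp: PiE_iff)

lemma comp_id_right: "f \<in> cube_hom m n \<Longrightarrow> compose (verts m) f (id_map m) = f"
  unfolding id_map_def by (rule compose_Id) (auto dest!: cube_homD simp: PiE_iff)

lemma comp_assoc: "f \<in> cube_hom k m \<Longrightarrow> g \<in> cube_hom m n \<Longrightarrow>
    compose (verts k) h (compose (verts k) g f) = compose (verts k) (compose (verts m) h g) f"
  by (rule compose_assoc) (auto dest!: cube_homD)

lemma tensor_hom_right: "cube_mor m n f \<Longrightarrow> cube_mor (k + m) (k + n) (cube_tensor k m (id_map k) f)"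
proof (induction rule: cube_mor.induct)
  case (mor_id n)
  have "cube_tensor k n (id_map k) (id_map n) = id_map (k + n)"
    by (auto simp: cube_tensor_def id_map_def verts_def fun_eq_iff)
  then show ?case by (simp add: cube_mor.mor_id)
next
  case (mor_face i n \<epsilon>)
  obtain j where j: "i = Suc j" using mor_face by (cases i) auto
  have "cube_tensor k n (id_map k) (face n i \<epsilon>) = face (k + n) (k + i) \<epsilon>"
    by (auto simp: cube_tensor_def id_map_def face_def verts_def fun_eq_iff restrict_def j take_add add.commute[of j k])
  then show ?case using mor_face cube_mor.mor_face[of "k + i" "k + n" \<epsilon>] by (simp add: add.assoc)
next
  case (mor_degeneracy i n)
  obtain j where j: "i = Suc j" using mor_degeneracy by (cases i) auto
  have "cube_tensor k (n + 1) (id_map k) (degeneracy n i) = degeneracy (k + n) (k + i)"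
    by (auto simp: cube_tensor_def id_map_def degeneracy_def verts_def fun_eq_iff restrict_def j take_add add.commute[of j k])
  then show ?case using mor_degeneracy cube_mor.mor_degeneracy[of "k + i" "k + n"]
    by (simp add: add.assoc)
next
  case (mor_connection i n \<epsilon>)
  obtain j where j: "i = Suc j" using mor_connection by (cases i) auto
  have "cube_tensor k (n + 1) (id_map k) (connection n i \<epsilon>) = connection (k + n) (k + i) \<epsilon>"
    by (auto simp: cube_tensor_def id_map_def connection_def verts_def fun_eq_iff restrict_def j take_add add.commute[of j k])
  then show ?case using mor_connection cube_mor.mor_connection[of "k + i" "k + n" \<epsilon>]
    by (simp add: add.assoc)
next
  case (mor_comp j m f n g)
  have "f \<in> verts j \<rightarrow>\<^sub>E verts m" using mor_comp by (simp add: cube_homD cube_hom_def)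
  then have "cube_tensor k j (id_map k) (compose (verts j) g f) =
      compose (verts (k + j)) (cube_tensor k m (id_map k) g) (cube_tensor k j (id_map k) f)"
    by (auto simp: cube_tensor_def id_map_def compose_def verts_def fun_eq_iff PiE_iff)
  then show ?case using mor_comp.IH by (simp add: cube_mor.mor_comp)
qed

lemma drop_take_append_drop: "j \<le> n \<Longrightarrow> n \<le> length x \<Longrightarrow> drop j (take n x) @ drop n x = drop j x"
  using drop_append[of j "take n x" "drop n x"] by simp

lemma tensor_hom_left: "cube_mor m n f \<Longrightarrow> cube_mor (m + k) (n + k) (cube_tensor m k f (id_map k))"
proof (induction rule: cube_mor.induct)
  case (mor_id n)
  have "cube_tensor n k (id_map n) (id_map k) = id_map (n + k)"
    by (auto simp: cube_tensor_def id_map_def verts_def fun_eq_iff)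
  then show ?case by (simp add: cube_mor.mor_id)
next
  case (mor_face i n \<epsilon>)
  obtain j where j: "i = Suc j" and jn: "j \<le> n" using mor_face by (cases i) auto
  have "cube_tensor n k (face n i \<epsilon>) (id_map k) = face (n + k) i \<epsilon>"
    by (auto simp: cube_tensor_def id_map_def face_def verts_def fun_eq_iff restrict_def j jn min_def
        drop_take_append_drop )
  then show ?case using mor_face cube_mor.mor_face[of i "n + k" \<epsilon>] by simp
next
  case (mor_degeneracy i n)
  obtain j where j: "i = Suc j" and jn: "j \<le> n" "j \<le> Suc n" using mor_degeneracy by (cases i) auto
  have "cube_tensor (n + 1) k (degeneracy n i) (id_map k) = degeneracy (n + k) i"
    by (auto simp: cube_tensor_def id_map_def degeneracy_def verts_def fun_eq_iff restrict_def j jn min_def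
        drop_take_append_drop)
  then show ?case using mor_degeneracy cube_mor.mor_degeneracy[of i "n + k"] by simp
next
  case (mor_connection i n \<epsilon>)
  obtain j where j: "i = Suc j" and jn: "Suc j \<le> n" "j \<le> n" "j < n" "j < Suc n" "j \<le> Suc n"
    using mor_connection by (cases i) auto
  have "cube_tensor (n + 1) k (connection n i \<epsilon>) (id_map k) = connection (n + k) i \<epsilon>"
    by (auto simp: cube_tensor_def id_map_def connection_def verts_def fun_eq_iff restrict_def j jn min_def
        drop_take_append_drop)
  then show ?case using mor_connection cube_mor.mor_connection[of i "n + k" \<epsilon>] by simp
next
  case (mor_comp j m f n g)
  have "f \<in> verts j \<rightarrow>\<^sub>E verts m" using mor_comp by (simp add: cube_homD cube_hom_def)
  then have "cube_tensor j k (compose (verts j) g f) (id_map k) =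
      compose (verts (j + k)) (cube_tensor m k g (id_map k)) (cube_tensor j k f (id_map k))"
    by (auto simp: cube_tensor_def id_map_def compose_def verts_def fun_eq_iff PiE_iff)
  then show ?case using mor_comp.IH by (simp add: cube_mor.mor_comp)
qed

lemma cube_tensor_comp:
  assumes "f \<in> cube_hom k m" "f' \<in> cube_hom k' m'"
  shows "compose (verts (k + k')) (cube_tensor m m' g g') (cube_tensor k k' f f') =
    cube_tensor k k' (compose (verts k) g f) (compose (verts k') g' f')"
  using assms[THEN cube_homD]
  by (auto simp: cube_tensor_def compose_def verts_def fun_eq_iff PiE_iff)

lemma cube_tensor_hom:
  assumes "f \<in> cube_hom m n" "g \<in> cube_hom m' n'"
  shows "cube_tensor m m' f g \<in> cube_hom (m + m') (n + n')"
proof -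
  have "compose (verts (m + m')) (cube_tensor n m' (id_map n) g) (cube_tensor m m' f (id_map m')) =
      cube_tensor m m' f g"
    using assms by (simp add: cube_tensor_comp cube_hom_id comp_id_left comp_id_right)
  then show ?thesis
    using assms tensor_hom_left[of m n f m'] tensor_hom_right[of m' n' g n]
    by (metis cube_hom_def mem_Collect_eq mor_comp)
qed

definition terminal_map :: "nat \<Rightarrow> cube_map" where
  "terminal_map n = (\<lambda>v\<in>verts n. [])"


section \<open>Cubical sets\<close>

text \<open>For \<open>f : [1]^m \<rightarrow> [1]^n\<close> the right action \<open>u \<mapsto> u f\<close> is \<open>act X m n f : X_n \<rightarrow> X_m\<close>.\<close>

record 'a cubical =
  cells :: "nat \<Rightarrow> 'a set"
  act :: "nat \<Rightarrow> nat \<Rightarrow> cube_map \<Rightarrow> 'a \<Rightarrow> 'a"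

definition cubical_set :: "'a cubical \<Rightarrow> bool" where
  "cubical_set X \<longleftrightarrow>
     (\<forall>m n. \<forall>f\<in>cube_hom m n. \<forall>u\<in>cells X n. act X m n f u \<in> cells X m) \<and>
     (\<forall>n. \<forall>u\<in>cells X n. act X n n (id_map n) u = u) \<and>
     (\<forall>k m n. \<forall>f\<in>cube_hom k m. \<forall>g\<in>cube_hom m n. \<forall>u\<in>cells X n.
        act X k n (compose (verts k) g f) u = act X k m f (act X m n g u))"

lemma cubical_set_act: "cubical_set X \<Longrightarrow> f \<in> cube_hom m n \<Longrightarrow> u \<in> cells X n \<Longrightarrow> act X m n f u \<in> cells X m"
  by (simp add: cubical_set_def)

lemma cubical_set_id: "cubical_set X \<Longrightarrow> u \<in> cells X n \<Longrightarrow> act X n n (id_map n) u = u"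
  by (simp add: cubical_set_def)

lemma cubical_set_comp:
  "cubical_set X \<Longrightarrow> f \<in> cube_hom k m \<Longrightarrow> g \<in> cube_hom m n \<Longrightarrow> u \<in> cells X n \<Longrightarrow>
    act X k m f (act X m n g u) = act X k n (compose (verts k) g f) u"
  by (simp add: cubical_set_def)

definition cubical_maps :: "'a cubical \<Rightarrow> 'b cubical \<Rightarrow> (nat \<Rightarrow> 'a \<Rightarrow> 'b) set" where
  "cubical_maps X Y = {F. (\<forall>n. F n \<in> cells X n \<rightarrow>\<^sub>E cells Y n) \<and>
     (\<forall>m n. \<forall>f\<in>cube_hom m n. \<forall>u\<in>cells X n. F m (act X m n f u) = act Y m n f (F n u))}"

definition map_comp :: "'a cubical \<Rightarrow> (nat \<Rightarrow> 'b \<Rightarrow> 'c) \<Rightarrow> (nat \<Rightarrow> 'a \<Rightarrow> 'b) \<Rightarrow> nat \<Rightarrow> 'a \<Rightarrow> 'c" where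
  "map_comp X G F = (\<lambda>n. compose (cells X n) (G n) (F n))"

text \<open>The cell of dimension \<open>n\<close> degenerate at the vertex \<open>x\<close>, i.e. the value of the constant map at \<open>x\<close>.\<close>

definition const_cell :: "'a cubical \<Rightarrow> 'a \<Rightarrow> nat \<Rightarrow> 'a" where
  "const_cell X x n = act X n 0 (terminal_map n) x"

text \<open>\<open>x \<sigma>\<^sub>1 \<cdots> \<sigma>\<^sub>n\<close>, operators acting on the right.\<close>

primrec degenerate_point :: "'a cubical \<Rightarrow> 'a \<Rightarrow> nat \<Rightarrow> 'a" where
  "degenerate_point X x 0 = x"
| "degenerate_point X x (Suc n) = act X (n + 1) n (degeneracy n (n + 1)) (degenerate_point X x n)"

definition std_cube :: "nat \<Rightarrow> cube_map cubical" where
  "std_cube n = \<lparr>cells = (\<lambda>m. cube_hom m n), act = (\<lambda>k m f g. compose (verts k) g f)\<rparr>"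

lemma cubical_set_std_cube: "cubical_set (std_cube n)"
  unfolding cubical_set_def std_cube_def by (auto simp: cube_hom_comp comp_id_right comp_assoc)

text \<open>The subobject of the standard \<open>n\<close>-cube given by the union of the images of the faces
  \<open>\<partial>\<^sub>i\<^sub>,\<^sub>\<epsilon> : [1]^(n-1) \<rightarrow> [1]^n\<close> with \<open>(i, \<epsilon>) \<in> S\<close>.\<close>

definition face_union :: "nat \<Rightarrow> (nat \<times> bool) set \<Rightarrow> cube_map cubical" where
  "face_union n S = \<lparr>cells = (\<lambda>m. {compose (verts m) (face (n - 1) i \<epsilon>) g | i \<epsilon> g.
       (i, \<epsilon>) \<in> S \<and> 1 \<le> i \<and> i \<le> n \<and> g \<in> cube_hom m (n - 1)}), act = act (std_cube n)\<rparr>"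

definition bdry_cube :: "nat \<Rightarrow> cube_map cubical" where
  "bdry_cube n = face_union n UNIV"

definition open_box :: "nat \<Rightarrow> nat \<Rightarrow> bool \<Rightarrow> cube_map cubical" where
  "open_box n i \<epsilon> = face_union n (UNIV - {(i, \<epsilon>)})"

definition kan_complex :: "'a cubical \<Rightarrow> bool" where
  "kan_complex X \<longleftrightarrow> cubical_set X \<and>
     (\<forall>n i \<epsilon>. 1 \<le> i \<and> i \<le> n \<longrightarrow>
       (\<forall>F\<in>cubical_maps (open_box n i \<epsilon>) X. \<exists>G\<in>cubical_maps (std_cube n) X.
          \<forall>m. \<forall>u\<in>cells (open_box n i \<epsilon>) m. G m u = F m u))"


section \<open>Colimit constructions\<close>

definition gen_equiv :: "'a set \<Rightarrow> ('a \<times> 'a) set \<Rightarrow> ('a \<times> 'a) set" where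
  "gen_equiv A r = (r \<union> r\<inverse>)\<^sup>* \<inter> A \<times> A"

lemma equiv_gen_equiv: "equiv A (gen_equiv A r)"
proof (rule equivI)
  show "sym (gen_equiv A r)"
  proof (rule symI)
    fix a b assume "(a, b) \<in> gen_equiv A r"
    moreover have "sym ((r \<union> r\<inverse>)\<^sup>*)"
      by (rule sym_rtrancl) (auto simp: sym_def)
    ultimately show "(b, a) \<in> gen_equiv A r"
      by (auto simp: gen_equiv_def dest: symD)
  qed
  show "trans (gen_equiv A r)"
    by (rule transI) (auto simp: gen_equiv_def intro: rtrancl_trans)
qed (auto simp: gen_equiv_def refl_on_def)

lemma gen_equiv_invariant:
  assumes "(a, b) \<in> gen_equiv A r" and "\<And>a b. (a, b) \<in> r \<Longrightarrow> h a = h b"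
  shows "h a = h b"
proof -
  have "(a, b) \<in> (r \<union> r\<inverse>)\<^sup>*" using assms(1) by (simp add: gen_equiv_def)
  then show ?thesis by (induction rule: rtrancl_induct) (use assms(2) in force)+
qed

lemma gen_equiv_generator:
  "(a, b) \<in> r \<Longrightarrow> a \<in> A \<Longrightarrow> b \<in> A \<Longrightarrow> gen_equiv A r `` {a} = gen_equiv A r `` {b}"
  by (rule equiv_class_eq[OF equiv_gen_equiv]) (auto simp: gen_equiv_def)

text \<open>
  Geometric product: the pointwise formula for the left Kan extension of
  \<open>([1]^m, [1]^n) \<mapsto> \<box>^(m+n)\<close>.  A \<open>k\<close>-cell of the colimit over the cells \<open>u \<in> X_m\<close>, \<open>w \<in> Y_n\<close> of the
  standard cubes \<open>\<box>^(m+n)\<close> is represented by \<open>(m, n, f, u, w)\<close> with \<open>f : [1]^k \<rightarrow> [1]^(m+n)\<close>, and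
  \<open>((a \<otimes> b) f, u, w)\<close> is identified with \<open>(f, u a, w b)\<close>.
\<close>

type_synonym ('a, 'b) tensor_rep = "nat \<times> nat \<times> cube_map \<times> 'a \<times> 'b"

definition tensor_reps :: "'a cubical \<Rightarrow> 'b cubical \<Rightarrow> nat \<Rightarrow> ('a, 'b) tensor_rep set" where
  "tensor_reps X Y k = {(m, n, f, u, w). f \<in> cube_hom k (m + n) \<and> u \<in> cells X m \<and> w \<in> cells Y n}"

definition tensor_gen ::
  "'a cubical \<Rightarrow> 'b cubical \<Rightarrow> nat \<Rightarrow> (('a, 'b) tensor_rep \<times> ('a, 'b) tensor_rep) set" where
  "tensor_gen X Y k =
     {((m', n', compose (verts k) (cube_tensor m n a b) f, u, w),
       (m, n, f, act X m m' a u, act Y n n' b w)) | m n m' n' a b f u w.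
      a \<in> cube_hom m m' \<and> b \<in> cube_hom n n' \<and> f \<in> cube_hom k (m + n) \<and>
      u \<in> cells X m' \<and> w \<in> cells Y n'}"

definition tensor_equiv ::
  "'a cubical \<Rightarrow> 'b cubical \<Rightarrow> nat \<Rightarrow> (('a, 'b) tensor_rep \<times> ('a, 'b) tensor_rep) set" where
  "tensor_equiv X Y k = gen_equiv (tensor_reps X Y k) (tensor_gen X Y k)"

definition tensor :: "'a cubical \<Rightarrow> 'b cubical \<Rightarrow> ('a, 'b) tensor_rep set cubical" where
  "tensor X Y = \<lparr>cells = (\<lambda>k. tensor_reps X Y k // tensor_equiv X Y k),
     act = (\<lambda>k' k g C. \<Union>(m, n, f, u, w)\<in>C.
       tensor_equiv X Y k' `` {(m, n, compose (verts k') f g, u, w)})\<rparr>"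

text \<open>The cell \<open>u \<otimes> w\<close> of dimension \<open>m + n\<close>, for \<open>u \<in> X_m\<close> and \<open>w \<in> Y_n\<close>.\<close>

definition tensor_cell ::
  "'a cubical \<Rightarrow> 'b cubical \<Rightarrow> nat \<Rightarrow> nat \<Rightarrow> 'a \<Rightarrow> 'b \<Rightarrow> ('a, 'b) tensor_rep set" where
  "tensor_cell X Y m n u w = tensor_equiv X Y (m + n) `` {(m, n, id_map (m + n), u, w)}"

lemma tensor_gen_reps:
  assumes "cubical_set X" "cubical_set Y" "(r, s) \<in> tensor_gen X Y k"
  shows "r \<in> tensor_reps X Y k" "s \<in> tensor_reps X Y k"
  using assms by (auto simp: tensor_gen_def tensor_reps_def
      intro!: cube_hom_comp[where m = "_ + _"] cube_tensor_hom cubical_set_act)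

lemma tensor_class_eq:
  assumes "cubical_set X" "cubical_set Y"
    and "a \<in> cube_hom m m'" "b \<in> cube_hom n n'" "f \<in> cube_hom k (m + n)"
    and "u \<in> cells X m'" "w \<in> cells Y n'"
  shows "tensor_equiv X Y k `` {(m', n', compose (verts k) (cube_tensor m n a b) f, u, w)} =
    tensor_equiv X Y k `` {(m, n, f, act X m m' a u, act Y n n' b w)}"
proof -
  have g: "((m', n', compose (verts k) (cube_tensor m n a b) f, u, w),
      (m, n, f, act X m m' a u, act Y n n' b w)) \<in> tensor_gen X Y k"
    using assms unfolding tensor_gen_def by blast
  show ?thesis unfolding tensor_equiv_def
    by (rule gen_equiv_generator[OF g tensor_gen_reps[OF assms(1,2) g]])
qed

lemma tensor_act_class:
  assumes X: "cubical_set X" and Y: "cubical_set Y" and g: "g \<in> cube_hom k' k"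
    and r: "(m, n, f, u, w) \<in> tensor_reps X Y k"
  shows "act (tensor X Y) k' k g (tensor_equiv X Y k `` {(m, n, f, u, w)}) =
    tensor_equiv X Y k' `` {(m, n, compose (verts k') f g, u, w)}"
proof -
  define h where "h = (\<lambda>(m, n, f, u, w). tensor_equiv X Y k' `` {(m, n, compose (verts k') f g, u, w)})"
  have inv: "h r = h s" if "(r, s) \<in> tensor_gen X Y k" for r s
  proof -
    from that obtain m n m' n' a b f u w where
      r: "r = (m', n', compose (verts k) (cube_tensor m n a b) f, u, w)" and
      s: "s = (m, n, f, act X m m' a u, act Y n n' b w)" and
      i: "a \<in> cube_hom m m'" "b \<in> cube_hom n n'" "f \<in> cube_hom k (m + n)"
        "u \<in> cells X m'" "w \<in> cells Y n'"
      unfolding tensor_gen_def by blast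
    show ?thesis
      using tensor_class_eq[OF X Y i(1,2) cube_hom_comp[OF g i(3)] i(4,5)]
      by (simp add: h_def r s comp_assoc[OF g i(3)])
  qed
  have const: "h r = h (m, n, f, u, w)" if "r \<in> tensor_equiv X Y k `` {(m, n, f, u, w)}" for r
  proof -
    have "((m, n, f, u, w), r) \<in> gen_equiv (tensor_reps X Y k) (tensor_gen X Y k)"
      using that by (simp add: tensor_equiv_def)
    from gen_equiv_invariant[where h = h, OF this inv] show ?thesis by simp
  qed
  have self: "(m, n, f, u, w) \<in> tensor_equiv X Y k `` {(m, n, f, u, w)}"
    unfolding tensor_equiv_def by (rule equiv_class_self[OF equiv_gen_equiv r])
  have "act (tensor X Y) k' k g (tensor_equiv X Y k `` {(m, n, f, u, w)}) =
      (\<Union>r\<in>tensor_equiv X Y k `` {(m, n, f, u, w)}. h r)"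
    by (simp add: tensor_def h_def)
  also have "\<dots> = h (m, n, f, u, w)" using const self by blast
  finally show ?thesis by (simp add: h_def)
qed

definition pushout_equiv ::
  "'c cubical \<Rightarrow> 'a cubical \<Rightarrow> 'b cubical \<Rightarrow> (nat \<Rightarrow> 'c \<Rightarrow> 'a) \<Rightarrow> (nat \<Rightarrow> 'c \<Rightarrow> 'b) \<Rightarrow>
    nat \<Rightarrow> (('a + 'b) \<times> ('a + 'b)) set" where
  "pushout_equiv A X Y F G m =
     gen_equiv (cells X m <+> cells Y m) {(Inl (F m a), Inr (G m a)) | a. a \<in> cells A m}"

definition pushout ::
  "'c cubical \<Rightarrow> 'a cubical \<Rightarrow> 'b cubical \<Rightarrow> (nat \<Rightarrow> 'c \<Rightarrow> 'a) \<Rightarrow> (nat \<Rightarrow> 'c \<Rightarrow> 'b) \<Rightarrow>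
    ('a + 'b) set cubical" where
  "pushout A X Y F G =
     \<lparr>cells = (\<lambda>m. (cells X m <+> cells Y m) // pushout_equiv A X Y F G m),
      act = (\<lambda>k m f C. \<Union>s\<in>C. pushout_equiv A X Y F G k `` {map_sum (act X k m f) (act Y k m f) s})\<rparr>"

text \<open>\<open>\<pi>\<^sub>0\<close>: the colimit of the functor; elements are classes of pairs of a dimension and a cell.\<close>

definition pi0_equiv :: "'a cubical \<Rightarrow> ((nat \<times> 'a) \<times> (nat \<times> 'a)) set" where
  "pi0_equiv X = gen_equiv (Sigma UNIV (cells X))
     {((n, u), (m, act X m n f u)) | m n f u. f \<in> cube_hom m n \<and> u \<in> cells X n}"

definition pi0 :: "'a cubical \<Rightarrow> (nat \<times> 'a) set set" where
  "pi0 X = Sigma UNIV (cells X) // pi0_equiv X"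


section \<open>Loop spaces and homotopy groups\<close>

text \<open>
  The cubical set of paths \<open>hom\<^sub>R(\<box>\<^sup>1, X)\<close>.  Its \<open>n\<close>-cells are the maps
  \<open>\<box>\<^sup>1 \<otimes> \<box>^n = \<box>^(1+n) \<rightarrow> X\<close>, i.e. the \<open>(1+n)\<close>-cells of \<open>X\<close>, and \<open>f\<close> acts as \<open>id \<otimes> f\<close>.  Keeping the
  type of cells unchanged makes the construction iterable.  That this is the right adjoint of
  \<open>\<box>\<^sup>1 \<otimes> -\<close> is \<open>path_obj_adjunction\<close> below.  Under this description \<open>\<partial>\<^sub>1\<^sub>,\<^sub>\<epsilon>\<^sup>*\<close> is \<open>u \<mapsto> u \<partial>\<^sub>1\<^sub>,\<^sub>\<epsilon>\<close>.
\<close>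

definition path_obj :: "'a cubical \<Rightarrow> 'a cubical" where
  "path_obj X = \<lparr>cells = (\<lambda>n. cells X (1 + n)),
     act = (\<lambda>m n f. act X (1 + m) (1 + n) (cube_tensor 1 m (id_map 1) f))\<rparr>"

lemma path_obj_adjunction:
  fixes Z :: "'b cubical" and X :: "'a cubical"
  assumes Z: "cubical_set Z" and X: "cubical_set X"
  shows "bij_betw (\<lambda>F n. \<lambda>z\<in>cells Z n. F (1 + n) (tensor_cell (std_cube 1) Z 1 n (id_map 1) z))
    (cubical_maps (tensor (std_cube 1) Z) X) (cubical_maps Z (path_obj X))"
proof -
  let ?I = "std_cube 1" and ?T = "tensor (std_cube 1) Z"
  note I = cubical_set_std_cube[of 1]
  note One_nat_def [simp del] plus_1_eq_Suc [simp del]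
  define cl where "cl k r = tensor_equiv ?I Z k `` {r}" for k r
  define \<Phi> where
    "\<Phi> F n = (\<lambda>z\<in>cells Z n. F (1 + n) (tensor_cell ?I Z 1 n (id_map 1) z))"
    for F :: "nat \<Rightarrow> (cube_map, 'b) tensor_rep set \<Rightarrow> 'a" and n
  define val where "val G k = (\<lambda>(m, n, f, e, z).
      act X k (1 + n) (compose (verts k) (cube_tensor m n e (id_map n)) f) (G n z))"
    for G :: "nat \<Rightarrow> 'b \<Rightarrow> 'a" and k
  define \<Psi> where "\<Psi> G k = (\<lambda>C\<in>cells ?T k. the_elem (val G k ` C))" for G k
  have cellI: "cells ?I m = cube_hom m 1" "act ?I m n a e = compose (verts m) e a" for m n a e
    by (simp_all add: std_cube_def)
  have reps: "(m, n, f, e, z) \<in> tensor_reps ?I Z k \<longleftrightarrow>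
      f \<in> cube_hom k (m + n) \<and> e \<in> cube_hom m 1 \<and> z \<in> cells Z n" for m n f e z k
    by (simp add: tensor_reps_def cellI)
  have cellT: "C \<in> cells ?T k \<longleftrightarrow> (\<exists>r\<in>tensor_reps ?I Z k. C = cl k r)" for C k
    by (auto simp: tensor_def cl_def quotient_def)
  have tc: "tensor_cell ?I Z 1 n (id_map 1) z = cl (1 + n) (1, n, id_map (1 + n), id_map 1, z)" for n z
    by (simp add: tensor_cell_def cl_def)
  have clI: "cl k r \<in> cells ?T k" if "r \<in> tensor_reps ?I Z k" for k r
    using that cellT by blast
  have id_rep: "(1, n, id_map (1 + n), id_map 1, z) \<in> tensor_reps ?I Z (1 + n)"
    if "z \<in> cells Z n" for n z
    unfolding reps using that cube_hom_id by blast
  have act_cl: "act ?T k' k g (cl k (m, n, f, e, z)) = cl k' (m, n, compose (verts k') f g, e, z)"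
    if "g \<in> cube_hom k' k" "(m, n, f, e, z) \<in> tensor_reps ?I Z k" for k' k g m n f e z
    using tensor_act_class[OF I Z that] by (simp add: cl_def)
  have cl_eq: "cl k (m', n', compose (verts k) (cube_tensor m n a b) f, e, z) =
      cl k (m, n, f, compose (verts m) e a, act Z n n' b z)"
    if "a \<in> cube_hom m m'" "b \<in> cube_hom n n'" "f \<in> cube_hom k (m + n)"
      "e \<in> cube_hom m' 1" "z \<in> cells Z n'" for k m' n' m n a b f e z
    using tensor_class_eq[OF I Z that(1-3), of e z] that by (simp add: cl_def cellI)
  have P: "cells (path_obj X) n = cells X (1 + n)"
    "act (path_obj X) m n b v = act X (1 + m) (1 + n) (cube_tensor 1 m (id_map 1) b) v" for m n b v
    by (simp_all add: path_obj_def)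

  have \<Psi>_cl: "\<Psi> G k (cl k r) = val G k r"
    if G: "G \<in> cubical_maps Z (path_obj X)" and r: "r \<in> tensor_reps ?I Z k" for G k r
  proof -
    have inv: "val G k r = val G k s" if "(r, s) \<in> tensor_gen ?I Z k" for r s
    proof -
      from that obtain m n m' n' a b f e z where
        r: "r = (m', n', compose (verts k) (cube_tensor m n a b) f, e, z)" and
        s: "s = (m, n, f, compose (verts m) e a, act Z n n' b z)" and
        i: "a \<in> cube_hom m m'" "b \<in> cube_hom n n'" "f \<in> cube_hom k (m + n)"
          "e \<in> cube_hom m' 1" "z \<in> cells Z n'"
        unfolding tensor_gen_def cellI by blast
      have ab: "cube_tensor m n a b \<in> cube_hom (m + n) (m' + n')"
        using i by (simp add: cube_tensor_hom)
      have ea: "compose (verts m) e a \<in> cube_hom m 1" using i cube_hom_comp by blast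
      have Gz: "G n' z \<in> cells X (1 + n')"
        using G i by (auto simp: cubical_maps_def P PiE_iff)
      have nat: "G n (act Z n n' b z) = act X (1 + n) (1 + n') (cube_tensor 1 n (id_map 1) b) (G n' z)"
        using G i by (simp add: cubical_maps_def P)
      have h1: "cube_tensor m n (compose (verts m) e a) (id_map n) \<in> cube_hom (m + n) (1 + n)"
        using ea by (simp add: cube_tensor_hom cube_hom_id)
      have h2: "cube_tensor 1 n (id_map 1) b \<in> cube_hom (1 + n) (1 + n')"
        using i by (simp add: cube_tensor_hom cube_hom_id)
      have "val G k s = act X k (1 + n') (compose (verts k) (cube_tensor 1 n (id_map 1) b)
          (compose (verts k) (cube_tensor m n (compose (verts m) e a) (id_map n)) f)) (G n' z)"
        unfolding s val_def prod.case nat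
        by (rule cubical_set_comp[OF X cube_hom_comp[OF i(3) h1] h2 Gz])
      also have "compose (verts k) (cube_tensor 1 n (id_map 1) b)
          (compose (verts k) (cube_tensor m n (compose (verts m) e a) (id_map n)) f) =
          compose (verts k) (cube_tensor m n (compose (verts m) e a) b) f"
        using i ea by (simp add: comp_assoc[OF i(3) h1] cube_tensor_comp[OF ea cube_hom_id]
            comp_id_left[OF ea] comp_id_right[OF i(2)])
      also have "\<dots> = compose (verts k) (cube_tensor m' n' e (id_map n'))
          (compose (verts k) (cube_tensor m n a b) f)"
        using i by (simp add: comp_assoc[OF i(3) ab] cube_tensor_comp comp_id_left)
      finally show ?thesis by (simp add: r val_def)
    qed
    have "val G k s = val G k r" if "s \<in> cl k r" for s
    proof -
      have "(r, s) \<in> gen_equiv (tensor_reps ?I Z k) (tensor_gen ?I Z k)"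
        using that by (simp add: cl_def tensor_equiv_def)
      from gen_equiv_invariant[where h = "val G k", OF this inv] show ?thesis by simp
    qed
    moreover have "r \<in> cl k r"
      unfolding cl_def tensor_equiv_def by (rule equiv_class_self[OF equiv_gen_equiv r])
    ultimately have "val G k ` cl k r = {val G k r}" by blast
    then show ?thesis by (simp add: \<Psi>_def clI[OF r])
  qed

  have val_cell: "val G k (m, n, f, e, z) \<in> cells X k \<and>
      compose (verts k) (cube_tensor m n e (id_map n)) f \<in> cube_hom k (1 + n) \<and>
      G n z \<in> cells X (1 + n)"
    if G: "G \<in> cubical_maps Z (path_obj X)" and r: "(m, n, f, e, z) \<in> tensor_reps ?I Z k"
    for G k m n f e z
  proof -
    have i: "f \<in> cube_hom k (m + n)" "e \<in> cube_hom m 1" "z \<in> cells Z n" using r reps by auto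
    have c: "compose (verts k) (cube_tensor m n e (id_map n)) f \<in> cube_hom k (1 + n)"
      by (rule cube_hom_comp[OF i(1) cube_tensor_hom[OF i(2) cube_hom_id]])
    have Gz: "G n z \<in> cells X (1 + n)" using G i by (auto simp: cubical_maps_def P PiE_iff)
    show ?thesis using c Gz cubical_set_act[OF X c Gz] by (simp add: val_def)
  qed

  have FD: "F k C \<in> cells X k" "F k' (act ?T k' k g C) = act X k' k g (F k C)"
    if "F \<in> cubical_maps ?T X" "C \<in> cells ?T k" "g \<in> cube_hom k' k" for F k k' C g
    using that by (auto simp: cubical_maps_def PiE_iff)
  have \<Phi>_z: "\<Phi> F n z = F (1 + n) (cl (1 + n) (1, n, id_map (1 + n), id_map 1, z))"
    if "z \<in> cells Z n" for F n z
    using that by (simp add: \<Phi>_def tc)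
  have \<Phi>_maps: "\<Phi> F \<in> cubical_maps Z (path_obj X)" if F: "F \<in> cubical_maps ?T X" for F
  proof -
    have "\<Phi> F n \<in> cells Z n \<rightarrow>\<^sub>E cells (path_obj X) n" for n
    proof (rule PiE_I)
      fix z assume z: "z \<in> cells Z n"
      show "\<Phi> F n z \<in> cells (path_obj X) n"
        unfolding \<Phi>_z[OF z] P by (rule FD(1)[OF F clI[OF id_rep[OF z]] cube_hom_id])
    qed (simp add: \<Phi>_def)
    moreover have "\<Phi> F m (act Z m n b z) = act (path_obj X) m n b (\<Phi> F n z)"
      if b: "b \<in> cube_hom m n" and z: "z \<in> cells Z n" for m n b z
    proof -
      have ib: "cube_tensor 1 m (id_map 1) b \<in> cube_hom (1 + m) (1 + n)"
        by (rule cube_tensor_hom[OF cube_hom_id b])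
      have "act (path_obj X) m n b (\<Phi> F n z) =
          F (1 + m) (act ?T (1 + m) (1 + n) (cube_tensor 1 m (id_map 1) b)
            (cl (1 + n) (1, n, id_map (1 + n), id_map 1, z)))"
        unfolding \<Phi>_z[OF z] P by (rule FD(2)[OF F clI[OF id_rep[OF z]] ib, symmetric])
      also have "\<dots> = F (1 + m) (cl (1 + m) (1, n, cube_tensor 1 m (id_map 1) b, id_map 1, z))"
        unfolding act_cl[OF ib id_rep[OF z]] comp_id_left[OF ib] ..
      also have "cl (1 + m) (1, n, cube_tensor 1 m (id_map 1) b, id_map 1, z) =
          cl (1 + m) (1, m, id_map (1 + m), id_map 1, act Z m n b z)"
        using cl_eq[OF cube_hom_id b cube_hom_id cube_hom_id z]
        unfolding comp_id_right[OF ib] comp_id_right[OF cube_hom_id] .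
      finally show ?thesis unfolding \<Phi>_z[OF cubical_set_act[OF Z b z]] ..
    qed
    ultimately show ?thesis by (simp add: cubical_maps_def)
  qed
  have \<Psi>_maps: "\<Psi> G \<in> cubical_maps ?T X" if G: "G \<in> cubical_maps Z (path_obj X)" for G
  proof -
    have "\<Psi> G k \<in> cells ?T k \<rightarrow>\<^sub>E cells X k" for k
    proof (rule PiE_I)
      fix C assume "C \<in> cells ?T k"
      then obtain r where r: "r \<in> tensor_reps ?I Z k" and C: "C = cl k r" using cellT by blast
      obtain m n f e z where "r = (m, n, f, e, z)" by (cases r) auto
      then show "\<Psi> G k C \<in> cells X k" using \<Psi>_cl[OF G r] val_cell[OF G] r C by metis
    qed (simp add: \<Psi>_def)
    moreover have "\<Psi> G k' (act ?T k' k g C) = act X k' k g (\<Psi> G k C)"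
      if g: "g \<in> cube_hom k' k" and C: "C \<in> cells ?T k" for k' k g C
    proof -
      obtain m n f e z where r: "(m, n, f, e, z) \<in> tensor_reps ?I Z k" and C: "C = cl k (m, n, f, e, z)"
        using C cellT by (metis prod_cases5)
      have i: "f \<in> cube_hom k (m + n)" "e \<in> cube_hom m 1" "z \<in> cells Z n" using r reps by auto
      have r': "(m, n, compose (verts k') f g, e, z) \<in> tensor_reps ?I Z k'"
        unfolding reps using i cube_hom_comp[OF g i(1)] by blast
      have vc: "compose (verts k) (cube_tensor m n e (id_map n)) f \<in> cube_hom k (1 + n)"
        "G n z \<in> cells X (1 + n)"
        using val_cell[OF G r] by auto
      show ?thesis
        unfolding C act_cl[OF g r] \<Psi>_cl[OF G r] \<Psi>_cl[OF G r'] val_def prod.case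
          cubical_set_comp[OF X g vc] comp_assoc[OF g i(1)] ..
    qed
    ultimately show ?thesis by (simp add: cubical_maps_def)
  qed
  have "bij_betw \<Phi> (cubical_maps ?T X) (cubical_maps Z (path_obj X))"
  proof (rule bij_betw_byWitness[where f' = \<Psi>])
    show "\<forall>F\<in>cubical_maps ?T X. \<Psi> (\<Phi> F) = F"
    proof (intro ballI ext)
      fix F k C assume F: "F \<in> cubical_maps ?T X"
      show "\<Psi> (\<Phi> F) k C = F k C"
      proof (cases "C \<in> cells ?T k")
        case False
        then show ?thesis using F by (auto simp: \<Psi>_def cubical_maps_def PiE_iff extensional_def)
      next
        case True
        then obtain m n f e z where r: "(m, n, f, e, z) \<in> tensor_reps ?I Z k"
          and C: "C = cl k (m, n, f, e, z)"
          using cellT by (metis prod_cases5)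
        have i: "f \<in> cube_hom k (m + n)" "e \<in> cube_hom m 1" "z \<in> cells Z n" using r reps by auto
        define g where "g = compose (verts k) (cube_tensor m n e (id_map n)) f"
        have g: "g \<in> cube_hom k (1 + n)" using val_cell[OF \<Phi>_maps[OF F] r] by (simp add: g_def)
        have "\<Psi> (\<Phi> F) k C = act X k (1 + n) g (\<Phi> F n z)"
          unfolding C \<Psi>_cl[OF \<Phi>_maps[OF F] r] val_def prod.case g_def ..
        also have "\<dots> = F k (act ?T k (1 + n) g (cl (1 + n) (1, n, id_map (1 + n), id_map 1, z)))"
          unfolding \<Phi>_z[OF i(3)] by (rule FD(2)[OF F clI[OF id_rep[OF i(3)]] g, symmetric])
        also have "\<dots> = F k (cl k (1, n, g, id_map 1, z))"
          unfolding act_cl[OF g id_rep[OF i(3)]] comp_id_left[OF g] ..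
        also have "cl k (1, n, g, id_map 1, z) = C"
          unfolding g_def C cl_eq[OF i(2) cube_hom_id i(1) cube_hom_id i(3)]
            comp_id_left[OF i(2)] cubical_set_id[OF Z i(3)] ..
        finally show ?thesis .
      qed
    qed
    show "\<forall>G\<in>cubical_maps Z (path_obj X). \<Phi> (\<Psi> G) = G"
    proof (intro ballI ext)
      fix G n z assume G: "G \<in> cubical_maps Z (path_obj X)"
      show "\<Phi> (\<Psi> G) n z = G n z"
      proof (cases "z \<in> cells Z n")
        case False
        then show ?thesis using G by (auto simp: \<Phi>_def cubical_maps_def PiE_iff extensional_def)
      next
        case True
        have "cube_tensor 1 n (id_map 1) (id_map n) = id_map (1 + n)"
          by (auto simp: cube_tensor_def id_map_def verts_def fun_eq_iff)
        moreover have "G n z \<in> cells X (1 + n)" using val_cell[OF G id_rep[OF True]] by blast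
        ultimately show ?thesis
          unfolding \<Phi>_z[OF True] \<Psi>_cl[OF G id_rep[OF True]] val_def prod.case
          by (metis comp_id_right cube_hom_id cubical_set_id[OF X])
      qed
    qed
    show "\<Phi> ` cubical_maps ?T X \<subseteq> cubical_maps Z (path_obj X)" using \<Phi>_maps by blast
    show "\<Psi> ` cubical_maps Z (path_obj X) \<subseteq> cubical_maps ?T X" using \<Psi>_maps by blast
  qed
  then show ?thesis by (simp add: \<Phi>_def[abs_def])
qed

definition loop_obj :: "'a cubical \<Rightarrow> 'a \<Rightarrow> 'a cubical" where
  "loop_obj X x = \<lparr>cells = (\<lambda>n. {u \<in> cells (path_obj X) n.
       \<forall>\<epsilon>. act X n (1 + n) (face n 1 \<epsilon>) u = const_cell X x n}),
     act = act (path_obj X)\<rparr>"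

definition loop_point :: "'a cubical \<Rightarrow> 'a \<Rightarrow> 'a" where
  "loop_point X x = act X 1 0 (degeneracy 0 1) x"

primrec iter_loop :: "nat \<Rightarrow> 'a cubical \<Rightarrow> 'a \<Rightarrow> 'a cubical \<times> 'a" where
  "iter_loop 0 X x = (X, x)"
| "iter_loop (Suc n) X x = (case iter_loop n X x of (Y, y) \<Rightarrow> (loop_obj Y y, loop_point Y y))"

definition homotopy_group :: "nat \<Rightarrow> 'a cubical \<Rightarrow> 'a \<Rightarrow> (nat \<times> 'a) set set" where
  "homotopy_group n X x = pi0 (fst (iter_loop n X x))"

text \<open>The class in \<open>\<pi>_n(X, x)\<close> of a 0-cube of the \<open>n\<close>-fold loop space, which is an \<open>n\<close>-cube \<open>u\<close> of \<open>X\<close>.\<close>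

definition homotopy_class :: "nat \<Rightarrow> 'a cubical \<Rightarrow> 'a \<Rightarrow> 'a \<Rightarrow> (nat \<times> 'a) set" where
  "homotopy_class n X x u = pi0_equiv (fst (iter_loop n X x)) `` {(0, u)}"


section \<open>Pointed maps and pointed homotopies\<close>

definition pointed_maps :: "'a cubical \<Rightarrow> 'a \<Rightarrow> 'b cubical \<Rightarrow> 'b \<Rightarrow> (nat \<Rightarrow> 'a \<Rightarrow> 'b) set" where
  "pointed_maps Z z X x = {F \<in> cubical_maps Z X. F 0 z = x}"

text \<open>The two vertices of \<open>\<box>\<^sup>1\<close> are \<open>face 0 1 False\<close> and \<open>face 0 1 True\<close>, and the cell
  \<open>w \<otimes> face 0 1 \<epsilon>\<close> has dimension \<open>k + 0 = k\<close> if \<open>w\<close> has dimension \<open>k\<close>.  The cells \<open>z \<otimes> e\<close> with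
  \<open>e \<in> (\<box>\<^sup>1)_k\<close> are those of \<open>{z} \<otimes> \<box>\<^sup>1\<close>.\<close>

definition pointed_homotopic ::
  "'a cubical \<Rightarrow> 'a \<Rightarrow> 'b cubical \<Rightarrow> 'b \<Rightarrow> (nat \<Rightarrow> 'a \<Rightarrow> 'b) \<Rightarrow> (nat \<Rightarrow> 'a \<Rightarrow> 'b) \<Rightarrow> bool" where
  "pointed_homotopic Z z X x F G \<longleftrightarrow>
     (\<exists>H\<in>cubical_maps (tensor Z (std_cube 1)) X.
        (\<forall>k. \<forall>w\<in>cells Z k. H k (tensor_cell Z (std_cube 1) k 0 w (face 0 1 False)) = F k w) \<and>
        (\<forall>k. \<forall>w\<in>cells Z k. H k (tensor_cell Z (std_cube 1) k 0 w (face 0 1 True)) = G k w) \<and>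
        (\<forall>k. \<forall>e\<in>cells (std_cube 1) k.
           H k (tensor_cell Z (std_cube 1) 0 k z e) = const_cell X x k))"

text \<open>Homotopy classes are taken for the generated equivalence relation; for a Kan complex \<open>X\<close> the
  relation \<open>pointed_homotopic\<close> is itself one.\<close>

definition pointed_equiv ::
  "'a cubical \<Rightarrow> 'a \<Rightarrow> 'b cubical \<Rightarrow> 'b \<Rightarrow> ((nat \<Rightarrow> 'a \<Rightarrow> 'b) \<times> (nat \<Rightarrow> 'a \<Rightarrow> 'b)) set" where
  "pointed_equiv Z z X x = gen_equiv (pointed_maps Z z X x)
     {(F, G). F \<in> pointed_maps Z z X x \<and> G \<in> pointed_maps Z z X x \<and> pointed_homotopic Z z X x F G}"

definition pointed_classes ::
  "'a cubical \<Rightarrow> 'a \<Rightarrow> 'b cubical \<Rightarrow> 'b \<Rightarrow> (nat \<Rightarrow> 'a \<Rightarrow> 'b) set set" where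
  "pointed_classes Z z X x = pointed_maps Z z X x // pointed_equiv Z z X x"

definition pointed_class ::
  "'a cubical \<Rightarrow> 'a \<Rightarrow> 'b cubical \<Rightarrow> 'b \<Rightarrow> (nat \<Rightarrow> 'a \<Rightarrow> 'b) \<Rightarrow> (nat \<Rightarrow> 'a \<Rightarrow> 'b) set" where
  "pointed_class Z z X x F = pointed_equiv Z z X x `` {F}"


section \<open>The natural map\<close>

definition sphere_equiv :: "nat \<Rightarrow> nat \<Rightarrow> ((cube_map + cube_map) \<times> (cube_map + cube_map)) set" where
  "sphere_equiv n = pushout_equiv (bdry_cube n) (std_cube n) (std_cube 0)
     (\<lambda>m. \<lambda>u\<in>cells (bdry_cube n) m. u) (\<lambda>m. \<lambda>u\<in>cells (bdry_cube n) m. terminal_map m)"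

text \<open>The quotient of the standard \<open>n\<close>-cube by its boundary.\<close>

definition sphere :: "nat \<Rightarrow> (cube_map + cube_map) set cubical" where
  "sphere n = pushout (bdry_cube n) (std_cube n) (std_cube 0)
     (\<lambda>m. \<lambda>u\<in>cells (bdry_cube n) m. u) (\<lambda>m. \<lambda>u\<in>cells (bdry_cube n) m. terminal_map m)"

text \<open>The quotient map \<open>[id]\<close>, and the cells of the base point \<open>[0]\<close>; the base point itself is
  \<open>sphere_base n 0\<close>.\<close>

definition sphere_quot :: "nat \<Rightarrow> nat \<Rightarrow> cube_map \<Rightarrow> (cube_map + cube_map) set" where
  "sphere_quot n m u = sphere_equiv n m `` {Inl u}"

definition sphere_base :: "nat \<Rightarrow> nat \<Rightarrow> (cube_map + cube_map) set" where
  "sphere_base n m = sphere_equiv n m `` {Inr (terminal_map m)}"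

text \<open>
  The end of \<open>\<box>\<^sup>1\<close> at which \<open>collapse\<close> below is \<open>[id]\<close>.  For \<open>n \<ge> 1\<close> it is the end \<open>0\<close>.  For \<open>n = 0\<close> the
  boundary of the \<open>n\<close>-cube is empty and \<open>\<partial>\<box>\<^sup>1\<close> consists of the two vertices \<open>0\<close> and \<open>1\<close>; putting
  \<open>[id]\<close> at the end \<open>0\<close> would send the base vertex \<open>0\<close> to the point of \<open>\<box>\<^sup>0/\<partial>\<box>\<^sup>0\<close> which is not the
  base point, so the two ends have to be exchanged for the map to be pointed.
\<close>

definition id_end :: "nat \<Rightarrow> bool" where
  "id_end n \<longleftrightarrow> n = 0"

text \<open>The map \<open>\<partial>\<box>^(n+1) \<rightarrow> \<box>^n/\<partial>\<box>^n\<close>.  A cell \<open>u = \<partial>\<^sub>n\<^sub>+\<^sub>1\<^sub>,\<^sub>\<epsilon> g\<close> of the face \<open>\<box>^n \<otimes> {\<epsilon>}\<close>, \<open>\<epsilon> = id_end n\<close>,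
  is sent to \<open>[g]\<close>, where \<open>g = \<sigma>\<^sub>n\<^sub>+\<^sub>1 u\<close>; all cells on the other faces are sent to the base point.\<close>

definition collapse :: "nat \<Rightarrow> nat \<Rightarrow> cube_map \<Rightarrow> (cube_map + cube_map) set" where
  "collapse n m = (\<lambda>u\<in>cells (bdry_cube (n + 1)) m.
     if u \<in> cells (face_union (n + 1) {(n + 1, id_end n)}) m
     then sphere_quot n m (compose (verts m) (degeneracy n (n + 1)) u)
     else sphere_base n m)"

definition zero_vertex :: "nat \<Rightarrow> cube_map" where
  "zero_vertex n = (\<lambda>v\<in>verts 0. replicate n False)"

lemma sphere_equiv_equiv: "equiv (cells (std_cube n) m <+> cells (std_cube 0) m) (sphere_equiv n m)"
  unfolding sphere_equiv_def pushout_equiv_def by (rule equiv_gen_equiv)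

lemma terminal_map_hom: "terminal_map n \<in> cube_hom n 0"
proof (induction n)
  case 0
  have "terminal_map 0 = id_map 0" by (auto simp: terminal_map_def id_map_def verts_def)
  then show ?case by (simp add: cube_hom_id)
next
  case (Suc n)
  have "degeneracy n 1 \<in> cube_hom (Suc n) n"
    using mor_degeneracy[of 1 n] by (simp add: cube_hom_def)
  moreover have "terminal_map (Suc n) = compose (verts (Suc n)) (terminal_map n) (degeneracy n 1)"
    by (auto simp: terminal_map_def degeneracy_def compose_def verts_def fun_eq_iff)
  ultimately show ?case using Suc by (simp add: cube_hom_comp)
qed

lemma terminal_comp: "f \<in> cube_hom k m \<Longrightarrow> compose (verts k) (terminal_map m) f = terminal_map k"
  by (drule cube_homD) (auto simp: terminal_map_def compose_def PiE_iff fun_eq_iff)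

lemma terminal_map_unique: "f \<in> cube_hom n 0 \<Longrightarrow> f = terminal_map n"
  by (drule cube_homD) (auto simp: terminal_map_def verts_def PiE_iff extensional_def fun_eq_iff)

lemma degenerate_point_eq_const_cell:
  assumes "cubical_set X" "x \<in> cells X 0"
  shows "degenerate_point X x n = const_cell X x n"
proof (induction n)
  case 0
  have "terminal_map 0 = id_map 0" by (auto simp: terminal_map_def id_map_def verts_def)
  then show ?case using assms by (simp add: const_cell_def cubical_set_id)
next
  case (Suc n)
  have d: "degeneracy n (n + 1) \<in> cube_hom (n + 1) n" 
    using mor_degeneracy[of "n + 1" n] by (simp add: cube_hom_def)
  show ?case
    using cubical_set_comp[OF assms(1) d terminal_map_hom assms(2)] terminal_comp[OF d] Suc
    by (simp add: const_cell_def)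
qed

lemma sphere_act_class:
  assumes f: "f \<in> cube_hom k m" and s: "s \<in> cells (std_cube n) m <+> cells (std_cube 0) m"
  shows "act (sphere n) k m f (sphere_equiv n m `` {s}) =
    sphere_equiv n k `` {map_sum (act (std_cube n) k m f) (act (std_cube 0) k m f) s}"
proof -
  define h where
    "h s = sphere_equiv n k `` {map_sum (act (std_cube n) k m f) (act (std_cube 0) k m f) s}" for s
  have inv: "h a = h b"
    if ab: "(a, b) \<in> {(Inl ((\<lambda>u\<in>cells (bdry_cube n) m. u) c),
      Inr ((\<lambda>u\<in>cells (bdry_cube n) m. terminal_map m) c)) | c. c \<in> cells (bdry_cube n) m}"
    for a b :: "cube_map + cube_map"
  proof -
    from ab obtain c where c: "c \<in> cells (bdry_cube n) m" and ac: "a = Inl c"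
      and b: "b = Inr (terminal_map m)"
      by auto
    from c obtain i \<epsilon> g where i: "1 \<le> i" "i \<le> n" and g: "g \<in> cube_hom m (n - 1)"
      and "c = compose (verts m) (face (n - 1) i \<epsilon>) g"
      by (auto simp: bdry_cube_def face_union_def)
    with ac have a: "a = Inl (compose (verts m) (face (n - 1) i \<epsilon>) g)" by simp
    have d: "face (n - 1) i \<epsilon> \<in> cube_hom (n - 1) n"
      using i mor_face[of i "n - 1" \<epsilon>] by (simp add: cube_hom_def)
    let ?v = "compose (verts k) (face (n - 1) i \<epsilon>) (compose (verts k) g f)"
    have gf: "compose (verts k) g f \<in> cube_hom k (n - 1)" by (rule cube_hom_comp[OF f g])
    have v: "?v \<in> cells (bdry_cube n) k" using i gf by (auto simp: bdry_cube_def face_union_def)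
    have "sphere_equiv n k `` {Inl ?v} = sphere_equiv n k `` {Inr (terminal_map k)}"
      unfolding sphere_equiv_def pushout_equiv_def
      by (rule gen_equiv_generator)
         (use v terminal_map_hom cube_hom_comp[OF gf d] in \<open>force simp: std_cube_def\<close>)+
    then show ?thesis
      by (simp add: h_def a b std_cube_def terminal_comp[OF f] comp_assoc[OF f g])
  qed
  have "h t = h s" if "t \<in> sphere_equiv n m `` {s}" for t
  proof -
    have "(s, t) \<in> sphere_equiv n m" using that by simp
    from gen_equiv_invariant[where h = h, OF this[unfolded sphere_equiv_def pushout_equiv_def] inv]
    show ?thesis by simp
  qed
  moreover have "s \<in> sphere_equiv n m `` {s}" by (rule equiv_class_self[OF sphere_equiv_equiv s])
  moreover have "act (sphere n) k m f (sphere_equiv n m `` {s}) = (\<Union>t\<in>sphere_equiv n m `` {s}. h t)"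
    by (simp add: sphere_def pushout_def h_def sphere_equiv_def)
  ultimately have "act (sphere n) k m f (sphere_equiv n m `` {s}) = h s" by blast
  then show ?thesis by (simp add: h_def)
qed

lemma sphere_quot_bdry:
  assumes "u \<in> cells (bdry_cube n) m"
  shows "sphere_quot n m u = sphere_base n m"
proof -
  from assms obtain i \<epsilon> g where i: "1 \<le> i" "i \<le> n" and g: "g \<in> cube_hom m (n - 1)"
    and u: "u = compose (verts m) (face (n - 1) i \<epsilon>) g"
    by (auto simp: bdry_cube_def face_union_def)
  have "face (n - 1) i \<epsilon> \<in> cube_hom (n - 1) n"
    using i mor_face[of i "n - 1" \<epsilon>] by (simp add: cube_hom_def)
  then have "u \<in> cube_hom m n" using g u cube_hom_comp by blast
  then show ?thesis
    unfolding sphere_quot_def sphere_base_def sphere_equiv_def pushout_equiv_def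
    by (intro gen_equiv_generator)
       (use assms terminal_map_hom in \<open>force simp: std_cube_def\<close>)+
qed

lemma degeneracy_face:
  assumes "g \<in> cube_hom m n"
  shows "compose (verts m) (degeneracy n (n + 1)) (compose (verts m) (face n (n + 1) \<epsilon>) g) = g"
  using cube_homD[OF assms]
  by (auto simp: degeneracy_def face_def compose_def verts_def PiE_iff extensional_def fun_eq_iff)

lemma collapse_face:
  assumes "g \<in> cube_hom m n"
  shows "collapse n m (compose (verts m) (face n (n + 1) (id_end n)) g) = sphere_quot n m g"
proof -
  have "compose (verts m) (face n (n + 1) (id_end n)) g
      \<in> cells (face_union (n + 1) {(n + 1, id_end n)}) m"
    "compose (verts m) (face n (n + 1) (id_end n)) g \<in> cells (bdry_cube (n + 1)) m"
    using assms unfolding face_union_def bdry_cube_def by force+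
  then show ?thesis
    using degeneracy_face[OF assms] by (simp add: collapse_def)
qed

lemma collapse_other_face:
  assumes i: "1 \<le> i" "i \<le> n + 1" and g: "g \<in> cube_hom m n" and ne: "(i, \<epsilon>) \<noteq> (n + 1, id_end n)"
  shows "collapse n m (compose (verts m) (face n i \<epsilon>) g) = sphere_base n m"
proof (cases "compose (verts m) (face n i \<epsilon>) g \<in> cells (face_union (n + 1) {(n + 1, id_end n)}) m")
  case False
  have "compose (verts m) (face n i \<epsilon>) g \<in> cells (bdry_cube (n + 1)) m"
    using i g unfolding face_union_def bdry_cube_def by force
  then show ?thesis using False by (simp add: collapse_def)
next
  case True
  then obtain h where h: "h \<in> cube_hom m n"
    and eq: "compose (verts m) (face n i \<epsilon>) g = compose (verts m) (face n (n + 1) (id_end n)) h"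
    by (auto simp: face_union_def)
  have gl: "v \<in> verts m \<Longrightarrow> length (g v) = n" and hl: "v \<in> verts m \<Longrightarrow> length (h v) = n" for v
    using cube_homD[OF g] cube_homD[OF h] by (auto simp: verts_def PiE_iff)
  have ev: "take (i - 1) (g v) @ [\<epsilon>] @ drop (i - 1) (g v) = h v @ [id_end n]" if "v \<in> verts m" for v
    using fun_cong[OF eq, of v] that gl[OF that] hl[OF that]
    by (simp add: compose_eq face_def verts_def)
  have "replicate m False \<in> verts m" by (simp add: verts_def)
  with ev[OF this] gl[OF this] have "i \<noteq> n + 1" using ne by auto
  with i have i': "1 \<le> i" "i \<le> n" by auto
  then obtain p where n: "n = Suc p" by (cases n) auto
  have d: "degeneracy p n \<in> cube_hom n p"
    using mor_degeneracy[of "p + 1" p] by (simp add: cube_hom_def n)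
  have "h = compose (verts m) (face p i \<epsilon>) (compose (verts m) (degeneracy p n) g)"
  proof
    fix v
    show "h v = compose (verts m) (face p i \<epsilon>) (compose (verts m) (degeneracy p n) g) v"
    proof (cases "v \<in> verts m")
      case True
      have "h v = butlast (take (i - 1) (g v) @ [\<epsilon>] @ drop (i - 1) (g v))"
        by (simp only: ev[OF True] butlast_snoc)
      moreover have "butlast (drop (i - 1) (g v)) = drop (i - 1) (take p (g v))"
        using gl[OF True] by (simp add: butlast_conv_take n drop_take)
      moreover have "drop (i - 1) (g v) \<noteq> []" using gl[OF True] i' by simp
      ultimately show ?thesis
        using True gl[OF True] i'
        by (simp add: compose_eq face_def degeneracy_def verts_def n butlast_append min_def)
    next
      case False
      then show ?thesis using cube_homD[OF h] by (auto simp: PiE_iff extensional_def compose_def)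
    qed
  qed
  then have "h \<in> cells (bdry_cube n) m"
    using i' cube_hom_comp[OF g d] by (force simp: face_union_def bdry_cube_def n)
  then show ?thesis
    unfolding eq collapse_face[OF h] by (rule sphere_quot_bdry)
qed

text \<open>With this choice \<open>collapse n\<close> is a pointed map for every \<open>n\<close>.\<close>

lemma collapse_pointed:
  "collapse n \<in> pointed_maps (bdry_cube (n + 1)) (zero_vertex (n + 1)) (sphere n) (sphere_base n 0)"
proof -
  have quot: "sphere_quot n m g \<in> cells (sphere n) m" if "g \<in> cube_hom m n" for m g
    using that unfolding sphere_quot_def sphere_equiv_def sphere_def pushout_def
    by (auto simp: std_cube_def intro!: quotientI)
  have base: "sphere_base n m \<in> cells (sphere n) m" for m
    using terminal_map_hom[of m] unfolding sphere_base_def sphere_equiv_def sphere_def pushout_def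
    by (auto simp: std_cube_def intro!: quotientI)
  have bdry: "\<exists>i \<epsilon> g. 1 \<le> i \<and> i \<le> n + 1 \<and> g \<in> cube_hom m n \<and> u = compose (verts m) (face n i \<epsilon>) g"
    if "u \<in> cells (bdry_cube (n + 1)) m" for m u
    using that by (auto simp: bdry_cube_def face_union_def)
  have cell: "collapse n m u \<in> cells (sphere n) m" if u: "u \<in> cells (bdry_cube (n + 1)) m" for m u
  proof -
    obtain i \<epsilon> g where *: "1 \<le> i" "i \<le> n + 1" "g \<in> cube_hom m n" "u = compose (verts m) (face n i \<epsilon>) g"
      using bdry[OF u] by blast
    show ?thesis
    proof (cases "(i, \<epsilon>) = (n + 1, id_end n)")
      case True
      then show ?thesis using collapse_face[OF *(3)] quot[OF *(3)] *(4) by simp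
    next
      case False
      show ?thesis unfolding *(4) collapse_other_face[OF *(1-3) False] by (rule base)
    qed
  qed
  have nat: "collapse n k (act (bdry_cube (n + 1)) k m f u) = act (sphere n) k m f (collapse n m u)"
    if u: "u \<in> cells (bdry_cube (n + 1)) m" and f: "f \<in> cube_hom k m" for k m f u
  proof -
    obtain i \<epsilon> g where *: "1 \<le> i" "i \<le> n + 1" "g \<in> cube_hom m n" "u = compose (verts m) (face n i \<epsilon>) g"
      using bdry[OF u] by blast
    have gf: "compose (verts k) g f \<in> cube_hom k n" by (rule cube_hom_comp[OF f *(3)])
    have act: "act (bdry_cube (n + 1)) k m f u = compose (verts k) (face n i \<epsilon>) (compose (verts k) g f)"
      by (simp add: bdry_cube_def face_union_def std_cube_def *(4) comp_assoc[OF f *(3)])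
    show ?thesis
    proof (cases "(i, \<epsilon>) = (n + 1, id_end n)")
      case True
      then have ie: "i = n + 1" "\<epsilon> = id_end n" by auto
      have "act (sphere n) k m f (sphere_quot n m g) = sphere_quot n k (compose (verts k) g f)"
        using sphere_act_class[OF f, of "Inl g" n] *(3) by (simp add: sphere_quot_def std_cube_def InlI)
      then show ?thesis
        unfolding act unfolding *(4) ie collapse_face[OF gf] collapse_face[OF *(3)] by simp
    next
      case False
      have "act (sphere n) k m f (sphere_base n m) = sphere_base n k"
        using sphere_act_class[OF f, of "Inr (terminal_map m)" n] terminal_map_hom[of m]
        by (simp add: sphere_base_def std_cube_def InrI terminal_comp[OF f])
      then show ?thesis
        unfolding act unfolding *(4) collapse_other_face[OF *(1,2) gf False]
          collapse_other_face[OF *(1-3) False] by simp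
    qed
  qed
  have "collapse n 0 (zero_vertex (n + 1)) = sphere_base n 0"
  proof -
    have step: "zero_vertex (Suc p) = compose (verts 0) (face p 1 False) (zero_vertex p)" for p
      by (auto simp: zero_vertex_def face_def verts_def compose_def fun_eq_iff)
    have hom: "zero_vertex p \<in> cube_hom 0 p" for p
    proof (induction p)
      case 0
      have "zero_vertex 0 = id_map 0" by (auto simp: zero_vertex_def id_map_def verts_def)
      then show ?case by (simp add: cube_hom_id)
    next
      case (Suc p)
      have "face p 1 False \<in> cube_hom p (Suc p)" using mor_face[of 1 p False] by (simp add: cube_hom_def)
      then show ?case unfolding step by (rule cube_hom_comp[OF Suc])
    qed
    have "(1, False) \<noteq> (n + 1, id_end n)" by (auto simp: id_end_def)
    from collapse_other_face[OF _ _ hom this] show ?thesis by (simp add: step)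
  qed
  then show ?thesis
    using cell nat by (auto simp: pointed_maps_def cubical_maps_def collapse_def)
qed

text \<open>
  The identification of \<open>\<pi>_n(X, x)\<close> with pointed homotopy classes of maps out of \<open>\<box>^n/\<partial>\<box>^n\<close>.  The
  0-cube of the \<open>n\<close>-fold loop space corresponding to a pointed map \<open>F\<close> is the \<open>n\<close>-cube \<open>F \<circ> [id]\<close> of
  \<open>X\<close>, that is, the image under \<open>F\<close> of the \<open>n\<close>-cell \<open>[id]\<close>.  A class \<open>c\<close> corresponds to the set of the
  pointed maps whose 0-cube lies in \<open>c\<close>.
\<close>

definition sphere_class ::
  "nat \<Rightarrow> 'a cubical \<Rightarrow> 'a \<Rightarrow> (nat \<times> 'a) set \<Rightarrow> (nat \<Rightarrow> (cube_map + cube_map) set \<Rightarrow> 'a) set" where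
  "sphere_class n X x c =
     {F \<in> pointed_maps (sphere n) (sphere_base n 0) X x. (0, F n (sphere_quot n n (id_map n))) \<in> c}"

text \<open>Precomposition with \<open>Q : (W, w) \<rightarrow> (Z, z)\<close> on pointed homotopy classes.\<close>

definition precomp_class ::
  "'a cubical \<Rightarrow> 'a \<Rightarrow> 'c cubical \<Rightarrow> 'c \<Rightarrow> (nat \<Rightarrow> 'a \<Rightarrow> 'b) \<Rightarrow> (nat \<Rightarrow> 'b \<Rightarrow> 'c) set \<Rightarrow>
    (nat \<Rightarrow> 'a \<Rightarrow> 'c) set" where
  "precomp_class W w X x Q K = (\<Union>F\<in>K. pointed_class W w X x (map_comp W F Q))"

definition natural_map ::
  "nat \<Rightarrow> 'a cubical \<Rightarrow> 'a \<Rightarrow> (nat \<times> 'a) set \<Rightarrow> (nat \<Rightarrow> cube_map \<Rightarrow> 'a) set" where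
  "natural_map n X x c = precomp_class (bdry_cube (n + 1)) (zero_vertex (n + 1)) X x (collapse n)
     (sphere_class n X x c)"

definition has_filler :: "nat \<Rightarrow> 'a cubical \<Rightarrow> (nat \<Rightarrow> cube_map \<Rightarrow> 'a) \<Rightarrow> bool" where
  "has_filler n X f \<longleftrightarrow> (\<exists>F\<in>cubical_maps (std_cube n) X.
     \<forall>m. \<forall>u\<in>cells (bdry_cube n) m. F m u = f m u)"

end

theory Submission
  imports Defs
begin

text \<open>
  Write \<open>A\<close> for the union of all faces of \<open>\<box>^(n+1)\<close> except the one on which the natural map is
  \<open>[id]\<close>.  A pointed map \<open>f : \<partial>\<box>^(n+1) \<rightarrow> X\<close> is extended from \<open>A\<close> to a cube \<open>g\<close> of \<open>X\<close>, and \<open>g\<close> is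
  contracted to the base point one coordinate at a time, from the last to the first, by connections.
  Extending the resulting deformation of \<open>f|A\<close> over the remaining face by filling open boxes deforms
  \<open>f\<close> to a map which is constant on \<open>A\<close>, that is, to the image of some n-cube \<open>w\<close> with trivial
  boundary (relation \<open>reduces\<close>).  This gives surjectivity.  The same construction, performed on a
  cube that fills a pointed homotopy from \<open>f\<close> to \<open>f'\<close> on \<open>A\<close>, yields a homotopy relative to the
  boundary between the corresponding cubes \<open>w\<close> and \<open>w'\<close>; so the class of \<open>w\<close> is an invariant of the
  class of \<open>f\<close>, which gives injectivity.  If \<open>f\<close> has a filler, it can serve as \<open>g\<close>, and then \<open>w\<close> can
  be taken constant; conversely, having a filler is a homotopy invariant, by filling one open box.
\<close>

text \<open>The order of the contraction is forced: connections combine adjacent coordinates only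
  and \<box> has no symmetries, so coordinate \<open>j\<close> can meet the time parameter, which
  comes last, only after the coordinates between them have become constant. The connection used is
  the minimum, which is the identity at time 1; hence each stage is read backwards, from its end 1
  to its end 0. The obstacle is that the deformation of the remaining face is not canonical: each
  stage fills a box, and \<open>w\<close> depends on the fillers. So \<open>reduces\<close> is a
  relation, and its independence of the choices, up to homotopy class, comes from comparing two
  reductions along a constant homotopy. The comparison along a homotopy repeats the contraction on a
  cube with one more coordinate, the homotopy parameter, which is itself not contracted. Both
  \<open>pointed_equiv\<close> and \<open>pi0_equiv\<close> are generated equivalence relations.
  Invariants are checked on generators, and homotopies are never composed or reversed by
  filling.\<close>

declare One_nat_def [simp del] One_nat_def [symmetric, simp]
  Suc_eq_plus1 [symmetric, simp] Suc_eq_plus1_left [symmetric, simp]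

section \<open>Cubical identities\<close>

lemma face_hom: "1 \<le> i \<Longrightarrow> i \<le> Suc n \<Longrightarrow> face n i \<epsilon> \<in> cube_hom n (Suc n)"
  using mor_face[of i n \<epsilon>] by (simp add: cube_hom_def)

lemma degeneracy_hom: "1 \<le> i \<Longrightarrow> i \<le> Suc n \<Longrightarrow> degeneracy n i \<in> cube_hom (Suc n) n"
  using mor_degeneracy[of i n] by (simp add: cube_hom_def)

lemma connection_hom: "1 \<le> i \<Longrightarrow> i \<le> n \<Longrightarrow> connection n i \<epsilon> \<in> cube_hom (Suc n) n"
  using mor_connection[of i n \<epsilon>] by (simp add: cube_hom_def)

lemma cube_hom_length: "f \<in> cube_hom m n \<Longrightarrow> length v = m \<Longrightarrow> length (f v) = n"
  by (drule cube_homD) (auto simp: verts_def PiE_iff)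

lemma cube_hom_eqI:
  assumes "f \<in> cube_hom m n" "g \<in> cube_hom m n'" "\<And>v. length v = m \<Longrightarrow> f v = g v"
  shows "f = g"
proof
  fix v
  show "f v = g v"
    using assms(3)[of v] cube_homD[OF assms(1)] cube_homD[OF assms(2)]
    by (cases "length v = m") (auto simp: PiE_iff extensional_def verts_def)
qed

lemma compose_app: "length v = n \<Longrightarrow> compose (verts n) g f v = g (f v)"
  by (simp add: compose_eq verts_def)

lemma face_app: "length v = n \<Longrightarrow> face n i \<epsilon> v = take (i - 1) v @ \<epsilon> # drop (i - 1) v"
  by (simp add: face_def verts_def)

lemma degeneracy_app: "length v = Suc n \<Longrightarrow> degeneracy n i v = take (i - 1) v @ drop i v"
  by (simp add: degeneracy_def verts_def)

lemma connection_app: "length v = Suc n \<Longrightarrow> connection n i \<epsilon> v =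
    take (i - 1) v @ (if \<epsilon> then v ! (i - 1) \<and> v ! i else v ! (i - 1) \<or> v ! i) # drop (i + 1) v"
  by (simp add: connection_def verts_def)

lemma id_map_app: "length v = n \<Longrightarrow> id_map n v = v"
  by (simp add: id_map_def verts_def)

lemma cube_tensor_app: "length v = m + m' \<Longrightarrow> cube_tensor m m' f g v = f (take m v) @ g (drop m v)"
  by (simp add: cube_tensor_def verts_def)

lemma zero_vertex_app: "zero_vertex n [] = replicate n False"
  by (simp add: zero_vertex_def verts_def)

lemma zero_vertex_Suc: "zero_vertex (Suc n) = compose (verts 0) (face n 1 False) (zero_vertex n)"
  by (auto simp: zero_vertex_def face_def verts_def compose_def fun_eq_iff)

lemma zero_vertex_hom: "zero_vertex n \<in> cube_hom 0 n"
proof (induction n)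
  case 0
  have "zero_vertex 0 = id_map 0" by (auto simp: zero_vertex_def id_map_def verts_def)
  then show ?case by (simp add: cube_hom_id)
next
  case (Suc n)
  then show ?case unfolding zero_vertex_Suc by (rule cube_hom_comp) (simp add: face_hom)
qed

lemma terminal_map_app: "length v = n \<Longrightarrow> terminal_map n v = []"
  by (simp add: terminal_map_def verts_def)

lemmas app_simps = compose_app face_app degeneracy_app connection_app id_map_app cube_tensor_app
  zero_vertex_app terminal_map_app

lemma split_list3:
  assumes "a \<le> b" "b \<le> length v"
  shows "\<exists>xs ys zs. v = xs @ ys @ zs \<and> length xs = a \<and> length ys = b - a"
proof -
  have "v = take a v @ take (b - a) (drop a v) @ drop b v"
    using assms by (metis append_assoc append_take_drop_id le_add_diff_inverse take_add)
  then show ?thesis using assms by (intro exI conjI) auto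
qed

text \<open>The list identity behind \<open>face_face\<close>: once \<open>p\<close> has been
  inserted at position \<open>a\<close>, the later slot \<open>b\<close> has moved to
  \<open>Suc b\<close>.\<close>

lemma insert_insert:
  assumes "a \<le> b" "b \<le> length v"
  shows "take (Suc b) (take a v @ p # drop a v) @ q # drop (Suc b) (take a v @ p # drop a v) =
    take a (take b v @ q # drop b v) @ p # drop a (take b v @ q # drop b v)"
proof -
  obtain xs ys zs where "v = xs @ ys @ zs" "length xs = a" "length ys = b - a"
    using assms split_list3[of a b v] by blast
  then show ?thesis using assms(1) by (auto simp: Suc_diff_le)
qed

lemma face_face:
  assumes "1 \<le> i" "i < j" "j \<le> Suc (Suc n)"
  shows "compose (verts n) (face (Suc n) j \<eta>) (face n i \<epsilon>) =
    compose (verts n) (face (Suc n) i \<epsilon>) (face n (j - 1) \<eta>)"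
proof (rule cube_hom_eqI)
  show "compose (verts n) (face (Suc n) j \<eta>) (face n i \<epsilon>) \<in> cube_hom n (Suc (Suc n))"
    using assms by (intro cube_hom_comp[OF face_hom face_hom]) auto
  show "compose (verts n) (face (Suc n) i \<epsilon>) (face n (j - 1) \<eta>) \<in> cube_hom n (Suc (Suc n))"
    using assms by (intro cube_hom_comp[OF face_hom face_hom]) auto
  fix v :: "bool list" assume v: "length v = n"
  obtain a where a: "i = Suc a" using assms by (cases i) auto
  obtain b where b: "j = Suc (Suc b)" using less_imp_Suc_add[OF assms(2)] a by auto
  show "compose (verts n) (face (Suc n) j \<eta>) (face n i \<epsilon>) v =
      compose (verts n) (face (Suc n) i \<epsilon>) (face n (j - 1) \<eta>) v"
    using assms insert_insert[of a b v \<epsilon> \<eta>] v by (simp add: app_simps a b)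
qed

lemma degeneracy_face_same:
  assumes "1 \<le> i" "i \<le> Suc n"
  shows "compose (verts n) (degeneracy n i) (face n i \<epsilon>) = id_map n"
proof (rule cube_hom_eqI[OF cube_hom_comp[OF face_hom degeneracy_hom] cube_hom_id])
  fix v :: "bool list" assume v: "length v = n"
  obtain a where "i = Suc a" using assms by (cases i) auto
  then show "compose (verts n) (degeneracy n i) (face n i \<epsilon>) v = id_map n v"
    using assms v by (simp add: app_simps drop_Cons')
qed (use assms in auto)

lemma degeneracy_face_less:
  assumes "1 \<le> i" "i < j" "j \<le> Suc (Suc n)"
  shows "compose (verts (Suc n)) (degeneracy (Suc n) j) (face (Suc n) i \<epsilon>) =
    compose (verts (Suc n)) (face n i \<epsilon>) (degeneracy n (j - 1))"
proof (rule cube_hom_eqI)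
  show "compose (verts (Suc n)) (degeneracy (Suc n) j) (face (Suc n) i \<epsilon>) \<in> cube_hom (Suc n) (Suc n)"
    using assms by (intro cube_hom_comp[OF face_hom degeneracy_hom]) auto
  show "compose (verts (Suc n)) (face n i \<epsilon>) (degeneracy n (j - 1)) \<in> cube_hom (Suc n) (Suc n)"
    using assms by (intro cube_hom_comp[OF degeneracy_hom face_hom]) auto
  fix v :: "bool list" assume v: "length v = Suc n"
  obtain a where a: "i = Suc a" using assms by (cases i) auto
  obtain b where b: "j = Suc (Suc b)" using less_imp_Suc_add[OF assms(2)] a by auto
  obtain xs ys zs' where vs': "v = xs @ ys @ zs'" and l': "length xs = a" "length ys = b - a"
    using assms v split_list3[of a b v] by (auto simp: a b)
  obtain z zs where "zs' = z # zs" using vs' l' v assms by (cases zs') (auto simp: a b)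
  then have vs: "v = xs @ ys @ z # zs" using vs' by simp
  have l: "length xs = a" "b = a + length ys" "n = a + length ys + length zs"
    using l' assms v vs by (simp_all add: a b)
  show "compose (verts (Suc n)) (degeneracy (Suc n) j) (face (Suc n) i \<epsilon>) v =
      compose (verts (Suc n)) (face n i \<epsilon>) (degeneracy n (j - 1)) v"
    using l by (simp add: app_simps vs a b Suc_diff_le)
qed

lemma degeneracy_face_greater:
  assumes "1 \<le> i" "i < j" "j \<le> Suc (Suc n)"
  shows "compose (verts (Suc n)) (degeneracy (Suc n) i) (face (Suc n) j \<epsilon>) =
    compose (verts (Suc n)) (face n (j - 1) \<epsilon>) (degeneracy n i)"
proof (rule cube_hom_eqI)
  show "compose (verts (Suc n)) (degeneracy (Suc n) i) (face (Suc n) j \<epsilon>) \<in> cube_hom (Suc n) (Suc n)"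
    using assms by (intro cube_hom_comp[OF face_hom degeneracy_hom]) auto
  show "compose (verts (Suc n)) (face n (j - 1) \<epsilon>) (degeneracy n i) \<in> cube_hom (Suc n) (Suc n)"
    using assms by (intro cube_hom_comp[OF degeneracy_hom face_hom]) auto
  fix v :: "bool list" assume v: "length v = Suc n"
  obtain a where a: "i = Suc a" using assms by (cases i) auto
  obtain b where b: "j = Suc (Suc b)" using less_imp_Suc_add[OF assms(2)] a by auto
  obtain xs ys zs' where vs': "v = xs @ ys @ zs'" and l': "length xs = a" "length ys = b - a"
    using assms v split_list3[of a b v] by (auto simp: a b)
  obtain z zs where "zs' = z # zs" using vs' l' v assms by (cases zs') (auto simp: a b)
  then have vs: "v = xs @ ys @ z # zs" using vs' by simp
  have l: "length xs = a" "b = a + length ys" "n = a + length ys + length zs"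
    using l' assms v vs by (simp_all add: a b)
  show "compose (verts (Suc n)) (degeneracy (Suc n) i) (face (Suc n) j \<epsilon>) v =
      compose (verts (Suc n)) (face n (j - 1) \<epsilon>) (degeneracy n i) v"
    using l by (cases ys) (simp_all add: app_simps vs a b Suc_diff_le take_Cons' drop_Cons')
qed

text \<open>The square of \<open>face_face\<close> is a pullback. Applying
  \<open>degeneracy (Suc n) j\<close> to the equation recovers \<open>h\<close>, applying
  \<open>degeneracy (Suc n) i\<close> recovers \<open>g\<close>, and both factor through the same
  \<open>l\<close>, namely \<open>g\<close> with coordinate \<open>j - 1\<close> deleted.\<close>

lemma faces_intersect:
  assumes g: "g \<in> cube_hom m (Suc n)" and h: "h \<in> cube_hom m (Suc n)"
    and ij: "1 \<le> i" "i < j" "j \<le> Suc (Suc n)"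
    and eq: "compose (verts m) (face (Suc n) i \<epsilon>) g = compose (verts m) (face (Suc n) j \<eta>) h"
  obtains l where "l \<in> cube_hom m n" "g = compose (verts m) (face n (j - 1) \<eta>) l"
    "h = compose (verts m) (face n i \<epsilon>) l"
proof -
  have fi: "face (Suc n) i \<epsilon> \<in> cube_hom (Suc n) (Suc (Suc n))" "face n i \<epsilon> \<in> cube_hom n (Suc n)"
    and fj: "face (Suc n) j \<eta> \<in> cube_hom (Suc n) (Suc (Suc n))"
      "face n (j - 1) \<eta> \<in> cube_hom n (Suc n)"
    and dj: "degeneracy n (j - 1) \<in> cube_hom (Suc n) n"
    and di: "degeneracy n i \<in> cube_hom (Suc n) n"
    using ij by (auto intro!: face_hom degeneracy_hom)
  let ?l = "compose (verts m) (degeneracy n (j - 1)) g"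
  have l: "?l \<in> cube_hom m n" by (rule cube_hom_comp[OF g dj])
  have "h = compose (verts m) (compose (verts (Suc n)) (degeneracy (Suc n) j) (face (Suc n) j \<eta>)) h"
    using ij by (simp add: degeneracy_face_same comp_id_left[OF h])
  also have "\<dots> = compose (verts m) (degeneracy (Suc n) j) (compose (verts m) (face (Suc n) i \<epsilon>) g)"
    by (simp add: comp_assoc[OF h fj(1)] eq)
  also have "\<dots> = compose (verts m) (face n i \<epsilon>) ?l"
    by (simp add: comp_assoc[OF g fi(1)] comp_assoc[OF g dj] degeneracy_face_less[OF ij])
  finally have hl: "h = compose (verts m) (face n i \<epsilon>) ?l" .
  have "g = compose (verts m) (compose (verts (Suc n)) (degeneracy (Suc n) i) (face (Suc n) i \<epsilon>)) g"
    using degeneracy_face_same[of i "Suc n"] ij comp_id_left[OF g] by simp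
  also have "\<dots> = compose (verts m) (degeneracy (Suc n) i) (compose (verts m) (face (Suc n) j \<eta>) h)"
    by (simp only: comp_assoc[OF g fi(1)] flip: eq)
  also have "\<dots> = compose (verts m) (face n (j - 1) \<eta>) (compose (verts m) (degeneracy n i) h)"
    by (simp add: comp_assoc[OF h fj(1)] comp_assoc[OF h di] degeneracy_face_greater[OF ij])
  also have "compose (verts m) (degeneracy n i) h = ?l"
    using ij by (subst hl) (simp add: comp_assoc[OF l fi(2)] degeneracy_face_same comp_id_left[OF l])
  finally show ?thesis using hl l that by blast
qed

lemma face_inject:
  assumes g: "g \<in> cube_hom m n" and h: "h \<in> cube_hom m n" and i: "1 \<le> i" "i \<le> Suc n"
    and eq: "compose (verts m) (face n i \<epsilon>) g = compose (verts m) (face n i \<eta>) h"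
  shows "\<epsilon> = \<eta> \<and> g = h"
proof -
  have *: "take (i - 1) (g v) @ \<epsilon> # drop (i - 1) (g v) = take (i - 1) (h v) @ \<eta> # drop (i - 1) (h v)"
    if "length v = m" for v
    using fun_cong[OF eq, of v] that by (simp add: app_simps cube_hom_length[OF g] cube_hom_length[OF h])
  have **: "\<epsilon> = \<eta> \<and> g v = h v" if v: "length v = m" for v
    using *[OF v] cube_hom_length[OF g v] cube_hom_length[OF h v] 
    by (metis append_eq_append_conv append_take_drop_id length_take list.inject)
  \<comment> \<open>Every cube has a vertex, so the two inserted values can be compared.\<close>
  show ?thesis using **[of "replicate m False"] cube_hom_eqI[OF g h] ** by auto
qed

section \<open>Maps out of unions of faces and geometric products\<close>

text \<open>The index \<open>n\<close> is the dimension of the resulting face.\<close>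

definition cface :: "'a cubical \<Rightarrow> nat \<Rightarrow> nat \<Rightarrow> bool \<Rightarrow> 'a \<Rightarrow> 'a" where
  "cface X n i \<epsilon> u = act X n (Suc n) (face n i \<epsilon>) u"

lemma cface_cell:
  "cubical_set X \<Longrightarrow> 1 \<le> i \<Longrightarrow> i \<le> Suc n \<Longrightarrow> u \<in> cells X (Suc n) \<Longrightarrow> cface X n i \<epsilon> u \<in> cells X n"
  unfolding cface_def by (rule cubical_set_act[OF _ face_hom])

lemma cface_act:
  "cubical_set X \<Longrightarrow> 1 \<le> i \<Longrightarrow> i \<le> Suc n \<Longrightarrow> f \<in> cube_hom (Suc n) m \<Longrightarrow> u \<in> cells X m \<Longrightarrow>
    cface X n i \<epsilon> (act X (Suc n) m f u) = act X n m (compose (verts n) f (face n i \<epsilon>)) u"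
  unfolding cface_def by (rule cubical_set_comp[OF _ face_hom])

lemma act_cface:
  "cubical_set X \<Longrightarrow> 1 \<le> i \<Longrightarrow> i \<le> Suc n \<Longrightarrow> f \<in> cube_hom m n \<Longrightarrow> u \<in> cells X (Suc n) \<Longrightarrow>
    act X m n f (cface X n i \<epsilon> u) = act X m (Suc n) (compose (verts m) (face n i \<epsilon>) f) u"
  unfolding cface_def by (rule cubical_set_comp[OF _ _ face_hom])

lemma cface_cface:
  assumes "cubical_set X" "1 \<le> i" "i < j" "j \<le> Suc (Suc n)" "u \<in> cells X (Suc (Suc n))"
  shows "cface X n i \<epsilon> (cface X (Suc n) j \<eta> u) = cface X n (j - 1) \<eta> (cface X (Suc n) i \<epsilon> u)"
proof -
  have "cface X n i \<epsilon> (cface X (Suc n) j \<eta> u) =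
      act X n (Suc (Suc n)) (compose (verts n) (face (Suc n) j \<eta>) (face n i \<epsilon>)) u"
    unfolding cface_def by (rule cubical_set_comp) (use assms in \<open>auto intro!: face_hom\<close>)
  also have "\<dots> = cface X n (j - 1) \<eta> (cface X (Suc n) i \<epsilon> u)"
    unfolding cface_def face_face[OF assms(2-4)]
    by (rule cubical_set_comp[symmetric]) (use assms in \<open>auto intro!: face_hom\<close>)
  finally show ?thesis .
qed

text \<open>The data of a map out of a union of faces: a cube for each face in \<open>S\<close>,
  with agreement on the intersections of faces in different directions. Opposite faces are disjoint,
  and so are all faces of a 1-cube; hence \<open>i < j\<close> and \<open>n = Suc p\<close> in the
  matching condition.\<close>

definition face_family :: "'a cubical \<Rightarrow> nat \<Rightarrow> (nat \<times> bool) set \<Rightarrow> (nat \<Rightarrow> bool \<Rightarrow> 'a) \<Rightarrow> bool" where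
  "face_family X n S a \<longleftrightarrow>
     (\<forall>i \<epsilon>. 1 \<le> i \<longrightarrow> i \<le> Suc n \<longrightarrow> (i, \<epsilon>) \<in> S \<longrightarrow> a i \<epsilon> \<in> cells X n) \<and>
     (\<forall>p i j \<epsilon> \<eta>. n = Suc p \<longrightarrow> 1 \<le> i \<longrightarrow> i < j \<longrightarrow> j \<le> Suc n \<longrightarrow> (i, \<epsilon>) \<in> S \<longrightarrow> (j, \<eta>) \<in> S \<longrightarrow>
        cface X p i \<epsilon> (a j \<eta>) = cface X p (j - 1) \<eta> (a i \<epsilon>))"

lemma face_familyI:
  assumes "\<And>i \<epsilon>. 1 \<le> i \<Longrightarrow> i \<le> Suc n \<Longrightarrow> (i, \<epsilon>) \<in> S \<Longrightarrow> a i \<epsilon> \<in> cells X n"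
    and "\<And>p i j \<epsilon> \<eta>. n = Suc p \<Longrightarrow> 1 \<le> i \<Longrightarrow> i < j \<Longrightarrow> j \<le> Suc n \<Longrightarrow> (i, \<epsilon>) \<in> S \<Longrightarrow> (j, \<eta>) \<in> S \<Longrightarrow>
        cface X p i \<epsilon> (a j \<eta>) = cface X p (j - 1) \<eta> (a i \<epsilon>)"
  shows "face_family X n S a"
  using assms unfolding face_family_def by blast

lemma face_family_cell:
  "face_family X n S a \<Longrightarrow> 1 \<le> i \<Longrightarrow> i \<le> Suc n \<Longrightarrow> (i, \<epsilon>) \<in> S \<Longrightarrow> a i \<epsilon> \<in> cells X n"
  unfolding face_family_def by blast

lemma face_family_eq:
  "face_family X (Suc p) S a \<Longrightarrow> 1 \<le> i \<Longrightarrow> i < j \<Longrightarrow> j \<le> Suc (Suc p) \<Longrightarrow> (i, \<epsilon>) \<in> S \<Longrightarrow> (j, \<eta>) \<in> S \<Longrightarrow>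
    cface X p i \<epsilon> (a j \<eta>) = cface X p (j - 1) \<eta> (a i \<epsilon>)"
  unfolding face_family_def by blast

lemma face_family_cong:
  assumes "face_family X n S a" "\<And>i \<epsilon>. 1 \<le> i \<Longrightarrow> i \<le> Suc n \<Longrightarrow> a i \<epsilon> = b i \<epsilon>"
  shows "face_family X n S b"
proof (rule face_familyI)
  fix p i j \<epsilon> \<eta>
  assume "n = Suc p" "1 \<le> i" "i < j" "j \<le> Suc n" "(i, \<epsilon>) \<in> S" "(j, \<eta>) \<in> S"
  then show "cface X p i \<epsilon> (b j \<eta>) = cface X p (j - 1) \<eta> (b i \<epsilon>)"
    using face_family_eq[of X p S a i j \<epsilon> \<eta>] assms(1) assms(2)[of i \<epsilon>] assms(2)[of j \<eta>] by simp
qed (use assms in \<open>auto dest: face_family_cell\<close>)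

lemma face_union_cell_iff:
  "u \<in> cells (face_union (Suc n) S) m \<longleftrightarrow>
    (\<exists>i \<epsilon> g. (i, \<epsilon>) \<in> S \<and> 1 \<le> i \<and> i \<le> Suc n \<and> g \<in> cube_hom m n \<and> u = compose (verts m) (face n i \<epsilon>) g)"
  by (auto simp: face_union_def)

lemma face_union_act: "act (face_union n S) k m f u = compose (verts k) u f"
  by (simp add: face_union_def std_cube_def)

lemma face_union_cell_hom: "u \<in> cells (face_union (Suc n) S) m \<Longrightarrow> u \<in> cube_hom m (Suc n)"
  by (auto simp: face_union_cell_iff intro!: cube_hom_comp face_hom)

lemma cubical_set_face_union: "cubical_set (face_union (Suc n) S)"
  unfolding cubical_set_def face_union_act
proof (intro conjI allI ballI)
  fix m k f u assume f: "f \<in> cube_hom m k" and u: "u \<in> cells (face_union (Suc n) S) k"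
  then obtain i \<epsilon> g where *: "(i, \<epsilon>) \<in> S" "1 \<le> i" "i \<le> Suc n" "g \<in> cube_hom k n"
    and u: "u = compose (verts k) (face n i \<epsilon>) g"
    by (auto simp: face_union_cell_iff)
  show "compose (verts m) u f \<in> cells (face_union (Suc n) S) m"
    unfolding u comp_assoc[OF f *(4), symmetric] face_union_cell_iff
    using * cube_hom_comp[OF f *(4)] by blast
next
  fix m u assume "u \<in> cells (face_union (Suc n) S) m"
  then show "compose (verts m) u (id_map m) = u" by (rule comp_id_right[OF face_union_cell_hom])
next
  fix k l m f g u assume "f \<in> cube_hom k l" "g \<in> cube_hom l m"
  then show "compose (verts k) u (compose (verts k) g f) = compose (verts k) (compose (verts l) u g) f"
    by (rule comp_assoc)
qed

text \<open>A cell on two faces in different directions factors through their intersection, by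
  \<open>faces_intersect\<close>, and there the matching condition applies. For faces in the same
  direction \<open>face_inject\<close> applies: opposite faces are disjoint, and each face is a
  monomorphism.\<close>

lemma face_family_well_defined:
  assumes X: "cubical_set X" and a: "face_family X n S a"
    and i: "1 \<le> i" "i \<le> Suc n" "(i, \<epsilon>) \<in> S" and j: "1 \<le> j" "j \<le> Suc n" "(j, \<eta>) \<in> S"
    and g: "g \<in> cube_hom m n" and h: "h \<in> cube_hom m n"
    and eq: "compose (verts m) (face n i \<epsilon>) g = compose (verts m) (face n j \<eta>) h"
  shows "act X m n g (a i \<epsilon>) = act X m n h (a j \<eta>)"
proof -
  have less: "act X m n g (a i \<epsilon>) = act X m n h (a j \<eta>)"
    if i: "1 \<le> i" "(i, \<epsilon>) \<in> S" and j: "j \<le> Suc n" "(j, \<eta>) \<in> S" and ij: "i < j"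
      and g: "g \<in> cube_hom m n" and h: "h \<in> cube_hom m n"
      and eq: "compose (verts m) (face n i \<epsilon>) g = compose (verts m) (face n j \<eta>) h"
    for i j \<epsilon> \<eta> g h
  proof -
    obtain p where n: "n = Suc p" using i ij j by (cases n) auto
    obtain l where l: "l \<in> cube_hom m p" "g = compose (verts m) (face p (j - 1) \<eta>) l"
      "h = compose (verts m) (face p i \<epsilon>) l"
      using faces_intersect[OF g[unfolded n] h[unfolded n] i(1) ij j(1)[unfolded n] eq[unfolded n]] by blast
    have c: "a i \<epsilon> \<in> cells X (Suc p)" "a j \<eta> \<in> cells X (Suc p)"
      using face_family_cell[OF a, of i \<epsilon>] face_family_cell[OF a, of j \<eta>] i j ij n by auto
    have "act X m n g (a i \<epsilon>) = act X m p l (cface X p (j - 1) \<eta> (a i \<epsilon>))"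
      unfolding l(2) n by (rule act_cface[symmetric, OF X _ _ l(1) c(1)]) (use i j ij n in auto)
    also have "cface X p (j - 1) \<eta> (a i \<epsilon>) = cface X p i \<epsilon> (a j \<eta>)"
      by (rule face_family_eq[symmetric, OF a[unfolded n] _ ij]) (use i j n in auto)
    also have "act X m p l (cface X p i \<epsilon> (a j \<eta>)) = act X m n h (a j \<eta>)"
      unfolding l(3) n by (rule act_cface[OF X _ _ l(1) c(2)]) (use i j ij n in auto)
    finally show ?thesis .
  qed
  consider "i < j" | "i = j" | "j < i" by linarith
  then show ?thesis
  proof cases
    case 1
    show ?thesis by (rule less[OF i(1,3) j(2,3) 1 g h eq])
  next
    case 2
    then show ?thesis using face_inject[OF g h i(1,2), of \<epsilon> \<eta>] eq by auto
  next
    case 3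
    show ?thesis by (rule less[OF j(1,3) i(2,3) 3 h g eq[symmetric], symmetric])
  qed
qed

text \<open>Maps on boundaries, open boxes and cylinders are all obtained from this lemma, so that
  afterwards only cubes and their faces have to be matched.\<close>

lemma face_family_extends:
  assumes X: "cubical_set X" and a: "face_family X n S a"
  obtains F where "F \<in> cubical_maps (face_union (Suc n) S) X"
    "\<And>i \<epsilon> m g. 1 \<le> i \<Longrightarrow> i \<le> Suc n \<Longrightarrow> (i, \<epsilon>) \<in> S \<Longrightarrow> g \<in> cube_hom m n \<Longrightarrow>
      F m (compose (verts m) (face n i \<epsilon>) g) = act X m n g (a i \<epsilon>)"
proof -
  \<comment> \<open>\<open>R\<close> relates a cell to the values computed from all its
    presentations on faces; \<open>face_family_well_defined\<close> makes the description in
    \<open>F\<close> unique.\<close>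
  define R where "R m u y \<longleftrightarrow> (\<exists>i \<epsilon> g. (i, \<epsilon>) \<in> S \<and> 1 \<le> i \<and> i \<le> Suc n \<and> g \<in> cube_hom m n \<and>
    u = compose (verts m) (face n i \<epsilon>) g \<and> y = act X m n g (a i \<epsilon>))" for m u y
  define F where "F m = (\<lambda>u\<in>cells (face_union (Suc n) S) m. THE y. R m u y)" for m
  have F: "F m (compose (verts m) (face n i \<epsilon>) g) = act X m n g (a i \<epsilon>)"
    if "1 \<le> i" "i \<le> Suc n" "(i, \<epsilon>) \<in> S" "g \<in> cube_hom m n" for i \<epsilon> m g
  proof -
    let ?u = "compose (verts m) (face n i \<epsilon>) g"
    have "?u \<in> cells (face_union (Suc n) S) m" using that by (auto simp: face_union_cell_iff)
    moreover have "(THE y. R m ?u y) = act X m n g (a i \<epsilon>)"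
      unfolding R_def using that face_family_well_defined[OF X a]
      by (intro the_equality) metis+
    ultimately show ?thesis by (simp add: F_def)
  qed
  have "F \<in> cubical_maps (face_union (Suc n) S) X"
    unfolding cubical_maps_def
  proof (intro CollectI conjI allI ballI)
    fix m
    show "F m \<in> cells (face_union (Suc n) S) m \<rightarrow>\<^sub>E cells X m"
    proof (rule PiE_I)
      fix u assume "u \<in> cells (face_union (Suc n) S) m"
      then obtain i \<epsilon> g where *: "(i, \<epsilon>) \<in> S" "1 \<le> i" "i \<le> Suc n" "g \<in> cube_hom m n"
        and u: "u = compose (verts m) (face n i \<epsilon>) g"
        by (auto simp: face_union_cell_iff)
      show "F m u \<in> cells X m"
        unfolding u F[OF *(2,3,1,4)]
        by (rule cubical_set_act[OF X *(4) face_family_cell[OF a *(2,3,1)]])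
    qed (simp add: F_def)
  next
    fix k m f u assume f: "f \<in> cube_hom k m" and "u \<in> cells (face_union (Suc n) S) m"
    then obtain i \<epsilon> g where *: "(i, \<epsilon>) \<in> S" "1 \<le> i" "i \<le> Suc n" "g \<in> cube_hom m n"
      and u: "u = compose (verts m) (face n i \<epsilon>) g"
      by (auto simp: face_union_cell_iff)
    show "F k (act (face_union (Suc n) S) k m f u) = act X k m f (F m u)"
      unfolding u F[OF *(2,3,1,4)] face_union_act comp_assoc[OF f *(4), symmetric]
        F[OF *(2,3,1) cube_hom_comp[OF f *(4)]]
      by (rule cubical_set_comp[symmetric, OF X f *(4) face_family_cell[OF a *(2,3,1)]])
  qed
  with F that show ?thesis by blast
qed

section \<open>Maps determined by their values on faces\<close>

lemma cubical_maps_cell: "F \<in> cubical_maps X Y \<Longrightarrow> u \<in> cells X n \<Longrightarrow> F n u \<in> cells Y n"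
  by (auto simp: cubical_maps_def PiE_iff)

lemma cubical_maps_act:
  "F \<in> cubical_maps X Y \<Longrightarrow> f \<in> cube_hom m n \<Longrightarrow> u \<in> cells X n \<Longrightarrow> F m (act X m n f u) = act Y m n f (F n u)"
  by (auto simp: cubical_maps_def)

lemma cubical_maps_eqI:
  assumes "F \<in> cubical_maps X Y" "G \<in> cubical_maps X Y" "\<And>m u. u \<in> cells X m \<Longrightarrow> F m u = G m u"
  shows "F = G"
proof (intro ext)
  fix m u
  show "F m u = G m u"
    using assms by (cases "u \<in> cells X m") (auto simp: cubical_maps_def PiE_iff extensional_def)
qed

lemma face_in_face_union:
  "1 \<le> i \<Longrightarrow> i \<le> Suc n \<Longrightarrow> (i, \<epsilon>) \<in> S \<Longrightarrow> face n i \<epsilon> \<in> cells (face_union (Suc n) S) n"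
  unfolding face_union_cell_iff
  by (intro exI[of _ i] exI[of _ \<epsilon>] exI[of _ "id_map n"])
     (simp add: cube_hom_id comp_id_right[OF face_hom])

lemma face_union_map_face:
  assumes "F \<in> cubical_maps (face_union (Suc n) S) X" "1 \<le> i" "i \<le> Suc n" "(i, \<epsilon>) \<in> S" "g \<in> cube_hom m n"
  shows "F m (compose (verts m) (face n i \<epsilon>) g) = act X m n g (F n (face n i \<epsilon>))"
  using cubical_maps_act[OF assms(1,5) face_in_face_union[OF assms(2-4)]] by (simp add: face_union_act)

lemma face_union_map_family:
  assumes "cubical_set X" "F \<in> cubical_maps (face_union (Suc n) S) X"
  shows "face_family X n S (\<lambda>i \<epsilon>. F n (face n i \<epsilon>))"
proof (rule face_familyI)
  fix i \<epsilon> assume "1 \<le> i" "i \<le> Suc n" "(i, \<epsilon>) \<in> S"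
  then show "F n (face n i \<epsilon>) \<in> cells X n"
    by (intro cubical_maps_cell[OF assms(2)] face_in_face_union)
next
  fix p i j \<epsilon> \<eta> assume n: "n = Suc p" and ij: "1 \<le> i" "i < j" "j \<le> Suc n" "(i, \<epsilon>) \<in> S" "(j, \<eta>) \<in> S"
  have "cface X p i \<epsilon> (F n (face n j \<eta>)) = F p (compose (verts p) (face n j \<eta>) (face p i \<epsilon>))"
    unfolding cface_def n by (rule face_union_map_face[symmetric, OF assms(2)[unfolded n]])
      (use ij n in \<open>auto intro!: face_hom\<close>)
  also have "\<dots> = cface X p (j - 1) \<eta> (F n (face n i \<epsilon>))"
    unfolding cface_def n face_face[OF ij(1,2) ij(3)[unfolded n]]
    by (rule face_union_map_face[OF assms(2)[unfolded n]]) (use ij n in \<open>auto intro!: face_hom\<close>)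
  finally show "cface X p i \<epsilon> (F n (face n j \<eta>)) = cface X p (j - 1) \<eta> (F n (face n i \<epsilon>))" .
qed

lemma face_union_maps_eqI:
  assumes "F \<in> cubical_maps (face_union (Suc n) S) X" "G \<in> cubical_maps (face_union (Suc n) S) X"
    and "\<And>i \<epsilon>. 1 \<le> i \<Longrightarrow> i \<le> Suc n \<Longrightarrow> (i, \<epsilon>) \<in> S \<Longrightarrow> F n (face n i \<epsilon>) = G n (face n i \<epsilon>)"
  shows "F = G"
proof (rule cubical_maps_eqI[OF assms(1,2)])
  fix m u assume "u \<in> cells (face_union (Suc n) S) m"
  then obtain i \<epsilon> g where *: "(i, \<epsilon>) \<in> S" "1 \<le> i" "i \<le> Suc n" "g \<in> cube_hom m n"
    and u: "u = compose (verts m) (face n i \<epsilon>) g"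
    by (auto simp: face_union_cell_iff)
  then show "F m u = G m u"
    using face_union_map_face[OF assms(1)] face_union_map_face[OF assms(2)] assms(3) by simp
qed

lemma std_cube_map:
  assumes "cubical_set X" "c \<in> cells X n"
  shows "(\<lambda>m. \<lambda>f\<in>cube_hom m n. act X m n f c) \<in> cubical_maps (std_cube n) X"
  using assms unfolding cubical_maps_def std_cube_def
  by (auto simp: cubical_set_act cubical_set_comp cube_hom_comp)

text \<open>By the Yoneda correspondence the extension to the standard cube is a cube
  \<open>c\<close>, its value at the identity. The Kan condition thus becomes the existence of a
  cube with all but one of its faces prescribed.\<close>

lemma kan_fill:
  assumes X: "kan_complex X" and i: "1 \<le> i" "i \<le> Suc n" and a: "face_family X n (UNIV - {(i, \<epsilon>)}) a"
  obtains c where "c \<in> cells X (Suc n)"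
    "\<And>j \<eta>. 1 \<le> j \<Longrightarrow> j \<le> Suc n \<Longrightarrow> (j, \<eta>) \<noteq> (i, \<epsilon>) \<Longrightarrow> cface X n j \<eta> c = a j \<eta>"
proof -
  have X': "cubical_set X" using X by (simp add: kan_complex_def)
  obtain F where F: "F \<in> cubical_maps (open_box (Suc n) i \<epsilon>) X"
    "\<And>j \<eta> m g. 1 \<le> j \<Longrightarrow> j \<le> Suc n \<Longrightarrow> (j, \<eta>) \<in> UNIV - {(i, \<epsilon>)} \<Longrightarrow> g \<in> cube_hom m n \<Longrightarrow>
      F m (compose (verts m) (face n j \<eta>) g) = act X m n g (a j \<eta>)"
    using face_family_extends[OF X' a] unfolding open_box_def by blast
  obtain G where G: "G \<in> cubical_maps (std_cube (Suc n)) X"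
    "\<And>m u. u \<in> cells (open_box (Suc n) i \<epsilon>) m \<Longrightarrow> G m u = F m u"
    using X i F(1) unfolding kan_complex_def by blast
  have idc: "id_map (Suc n) \<in> cells (std_cube (Suc n)) (Suc n)" by (simp add: std_cube_def cube_hom_id)
  show ?thesis
  proof (rule that)
    show "G (Suc n) (id_map (Suc n)) \<in> cells X (Suc n)" by (rule cubical_maps_cell[OF G(1) idc])
    fix j \<eta> assume j: "1 \<le> j" "j \<le> Suc n" "(j, \<eta>) \<noteq> (i, \<epsilon>)"
    have "cface X n j \<eta> (G (Suc n) (id_map (Suc n))) = G n (face n j \<eta>)"
      unfolding cface_def cubical_maps_act[OF G(1) face_hom[OF j(1,2)] idc, symmetric]
      by (simp add: std_cube_def comp_id_left[OF face_hom[OF j(1,2)]])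
    also have "\<dots> = F n (compose (verts n) (face n j \<eta>) (id_map n))"
      using G(2) j by (simp add: open_box_def face_in_face_union comp_id_right[OF face_hom[OF j(1,2)]])
    also have "\<dots> = a j \<eta>"
      using j face_family_cell[OF a] by (subst F(2)) (auto simp: cube_hom_id cubical_set_id[OF X'])
    finally show "cface X n j \<eta> (G (Suc n) (id_map (Suc n))) = a j \<eta>" .
  qed
qed

text \<open>The universal property of the pointwise Kan extension: \<open>val\<close> is the value
  at a representative, \<open>inv\<close> its invariance under the generating identifications,
  \<open>nat\<close> its naturality.\<close>

lemma tensor_map_extends:
  assumes Z: "cubical_set Z" and Y: "cubical_set Y" and X: "cubical_set X"
    and cell: "\<And>k m n f u w. (m, n, f, u, w) \<in> tensor_reps Z Y k \<Longrightarrow> val k m n f u w \<in> cells X k"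
    and inv: "\<And>k m n m' n' a b f u w. a \<in> cube_hom m m' \<Longrightarrow> b \<in> cube_hom n n' \<Longrightarrow>
      f \<in> cube_hom k (m + n) \<Longrightarrow> u \<in> cells Z m' \<Longrightarrow> w \<in> cells Y n' \<Longrightarrow>
      val k m' n' (compose (verts k) (cube_tensor m n a b) f) u w =
      val k m n f (act Z m m' a u) (act Y n n' b w)"
    and nat: "\<And>k' k g m n f u w. g \<in> cube_hom k' k \<Longrightarrow> (m, n, f, u, w) \<in> tensor_reps Z Y k \<Longrightarrow>
      val k' m n (compose (verts k') f g) u w = act X k' k g (val k m n f u w)"
  obtains H where "H \<in> cubical_maps (tensor Z Y) X"
    "\<And>k m n f u w. (m, n, f, u, w) \<in> tensor_reps Z Y k \<Longrightarrow>
      H k (tensor_equiv Z Y k `` {(m, n, f, u, w)}) = val k m n f u w"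
proof -
  define v where "v k = (\<lambda>(m, n, f, u, w). val k m n f u w)" for k
  define H where "H k = (\<lambda>C\<in>cells (tensor Z Y) k. the_elem (v k ` C))" for k
  have cellT: "C \<in> cells (tensor Z Y) k \<longleftrightarrow> (\<exists>r\<in>tensor_reps Z Y k. C = tensor_equiv Z Y k `` {r})" for C k
    by (auto simp: tensor_def quotient_def)
  have H: "H k (tensor_equiv Z Y k `` {r}) = v k r" if r: "r \<in> tensor_reps Z Y k" for k r
  proof -
    have "v k s = v k r" if "s \<in> tensor_equiv Z Y k `` {r}" for s
    proof -
      have "(r, s) \<in> gen_equiv (tensor_reps Z Y k) (tensor_gen Z Y k)"
        using that by (simp add: tensor_equiv_def)
      moreover have "v k p = v k q" if "(p, q) \<in> tensor_gen Z Y k" for p q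
        using that inv unfolding tensor_gen_def v_def by auto
      ultimately show ?thesis using gen_equiv_invariant[where h = "v k"] by metis
    qed
    moreover have "r \<in> tensor_equiv Z Y k `` {r}"
      unfolding tensor_equiv_def by (rule equiv_class_self[OF equiv_gen_equiv r])
    ultimately have "v k ` (tensor_equiv Z Y k `` {r}) = {v k r}" by blast
    moreover have "tensor_equiv Z Y k `` {r} \<in> cells (tensor Z Y) k" using r cellT by blast
    ultimately show ?thesis by (simp add: H_def)
  qed
  have "H \<in> cubical_maps (tensor Z Y) X"
    unfolding cubical_maps_def
  proof (intro CollectI conjI allI ballI)
    fix k
    show "H k \<in> cells (tensor Z Y) k \<rightarrow>\<^sub>E cells X k"
    proof (rule PiE_I)
      fix C assume "C \<in> cells (tensor Z Y) k"
      then obtain r where "r \<in> tensor_reps Z Y k" "C = tensor_equiv Z Y k `` {r}"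
        using cellT by blast
      then show "H k C \<in> cells X k" using H cell by (cases r) (simp add: v_def)
    qed (simp add: H_def)
  next
    fix k' k g C assume g: "g \<in> cube_hom k' k" and "C \<in> cells (tensor Z Y) k"
    then obtain m n f u w where r: "(m, n, f, u, w) \<in> tensor_reps Z Y k"
      and C: "C = tensor_equiv Z Y k `` {(m, n, f, u, w)}"
      using cellT by (metis prod_cases5)
    have r': "(m, n, compose (verts k') f g, u, w) \<in> tensor_reps Z Y k'"
      using r cube_hom_comp[OF g] by (simp add: tensor_reps_def)
    show "H k' (act (tensor Z Y) k' k g C) = act X k' k g (H k C)"
      unfolding C tensor_act_class[OF Z Y g r] H[OF r] H[OF r'] using nat[OF g r] by (simp add: v_def)
  qed
  moreover have "H k (tensor_equiv Z Y k `` {(m, n, f, u, w)}) = val k m n f u w"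
    if "(m, n, f, u, w) \<in> tensor_reps Z Y k" for k m n f u w
    using H[OF that] by (simp add: v_def)
  ultimately show ?thesis using that by blast
qed

section \<open>Homotopies of maps on the boundary of a cube\<close>

lemma tensor_face_left:
  assumes "u \<in> cube_hom m n" "w \<in> cube_hom m' n'" "1 \<le> i" "i \<le> Suc n"
  shows "cube_tensor m m' (compose (verts m) (face n i \<epsilon>) u) w =
    compose (verts (m + m')) (face (n + n') i \<epsilon>) (cube_tensor m m' u w)"
proof (rule cube_hom_eqI)
  show "cube_tensor m m' (compose (verts m) (face n i \<epsilon>) u) w \<in> cube_hom (m + m') (Suc n + n')"
    by (intro cube_tensor_hom cube_hom_comp[OF assms(1)] face_hom assms)
  show "compose (verts (m + m')) (face (n + n') i \<epsilon>) (cube_tensor m m' u w)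
      \<in> cube_hom (m + m') (Suc (n + n'))"
    using assms by (intro cube_hom_comp[OF cube_tensor_hom[OF assms(1,2)]] face_hom) auto
  fix v :: "bool list" assume "length v = m + m'"
  moreover obtain a where "i = Suc a" using assms by (cases i) auto
  ultimately show "cube_tensor m m' (compose (verts m) (face n i \<epsilon>) u) w v =
      compose (verts (m + m')) (face (n + n') i \<epsilon>) (cube_tensor m m' u w) v"
    using assms by (simp add: app_simps cube_hom_length[OF assms(1)] cube_hom_length[OF assms(2)])
qed

lemma tensor_id_id: "cube_tensor m n (id_map m) (id_map n) = id_map (m + n)"
  by (auto simp: cube_tensor_def id_map_def verts_def fun_eq_iff)

lemma tensor_face_right:
  assumes "u \<in> cube_hom m n"
  shows "cube_tensor m 0 u (face 0 1 \<epsilon>) = compose (verts m) (face n (Suc n) \<epsilon>) u"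
proof (rule cube_hom_eqI)
  show "cube_tensor m 0 u (face 0 1 \<epsilon>) \<in> cube_hom m (Suc n)"
    using cube_tensor_hom[OF assms face_hom[of 1 0 \<epsilon>]] by simp
  show "compose (verts m) (face n (Suc n) \<epsilon>) u \<in> cube_hom m (Suc n)"
    by (intro cube_hom_comp[OF assms] face_hom) auto
qed (simp add: app_simps cube_hom_length[OF assms])

text \<open>The edge of the cylinder over the vertex 0, on which a pointed homotopy has to be
  constant.\<close>

definition zero_edge :: "nat \<Rightarrow> cube_map" where
  "zero_edge n = cube_tensor 0 1 (zero_vertex n) (id_map 1)"

lemma zero_edge_hom: "zero_edge n \<in> cube_hom 1 (Suc n)"
  using cube_tensor_hom[OF zero_vertex_hom[of n] cube_hom_id[of 1]] by (simp add: zero_edge_def)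

lemma zero_edge_comp:
  assumes "e \<in> cube_hom k 1"
  shows "compose (verts k) (zero_edge n) e = cube_tensor 0 k (zero_vertex n) e"
proof (rule cube_hom_eqI[OF cube_hom_comp[OF assms zero_edge_hom]])
  show "cube_tensor 0 k (zero_vertex n) e \<in> cube_hom k (Suc n)"
    using cube_tensor_hom[OF zero_vertex_hom[of n] assms] by simp
qed (simp add: zero_edge_def app_simps cube_hom_length[OF assms])

lemma act_const_cell:
  assumes "cubical_set X" "x \<in> cells X 0" "f \<in> cube_hom k m"
  shows "act X k m f (const_cell X x m) = const_cell X x k"
  unfolding const_cell_def
  using cubical_set_comp[OF assms(1,3) terminal_map_hom assms(2)] terminal_comp[OF assms(3)] by simp

lemma const_cell_in: "cubical_set X \<Longrightarrow> x \<in> cells X 0 \<Longrightarrow> const_cell X x n \<in> cells X n"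
  unfolding const_cell_def by (rule cubical_set_act[OF _ terminal_map_hom])

lemma const_cell_0: "cubical_set X \<Longrightarrow> x \<in> cells X 0 \<Longrightarrow> const_cell X x 0 = x"
  using degenerate_point_eq_const_cell[of X x 0] by simp

lemma cface_const_cell:
  "cubical_set X \<Longrightarrow> x \<in> cells X 0 \<Longrightarrow> 1 \<le> i \<Longrightarrow> i \<le> Suc n \<Longrightarrow>
    cface X n i \<epsilon> (const_cell X x (Suc n)) = const_cell X x n"
  unfolding cface_def by (rule act_const_cell[OF _ _ face_hom])

lemma act_tensor_cell:
  assumes Z: "cubical_set Z" and Y: "cubical_set Y" and a: "a \<in> cube_hom p m" and b: "b \<in> cube_hom q n"
    and u: "u \<in> cells Z m" and w: "w \<in> cells Y n"
  shows "act (tensor Z Y) (p + q) (m + n) (cube_tensor p q a b) (tensor_cell Z Y m n u w) =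
    tensor_cell Z Y p q (act Z p m a u) (act Y q n b w)"
proof -
  have ab: "cube_tensor p q a b \<in> cube_hom (p + q) (m + n)" by (rule cube_tensor_hom[OF a b])
  have "(m, n, id_map (m + n), u, w) \<in> tensor_reps Z Y (m + n)"
    using u w by (simp add: tensor_reps_def cube_hom_id)
  from tensor_act_class[OF Z Y ab this]
  have "act (tensor Z Y) (p + q) (m + n) (cube_tensor p q a b) (tensor_cell Z Y m n u w) =
      tensor_equiv Z Y (p + q) `` {(m, n, cube_tensor p q a b, u, w)}"
    by (simp add: tensor_cell_def comp_id_left[OF ab])
  also have "\<dots> = tensor_cell Z Y p q (act Z p m a u) (act Y q n b w)"
    using tensor_class_eq[OF Z Y a b cube_hom_id u w] by (simp add: tensor_cell_def comp_id_right[OF ab])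
  finally show ?thesis .
qed

lemma tensor_cell_in:
  "u \<in> cells Z m \<Longrightarrow> w \<in> cells Y n \<Longrightarrow> tensor_cell Z Y m n u w \<in> cells (tensor Z Y) (m + n)"
  unfolding tensor_cell_def tensor_def by (auto intro!: quotientI simp: tensor_reps_def cube_hom_id)

text \<open>A homotopy of maps \<open>\<partial>\<box>^(n+1) \<rightarrow> X\<close>, given by the (n+1)-cubes on the cells
  \<open>\<partial>\<^sub>i\<^sub>,\<^sub>\<epsilon> \<otimes> \<box>\<^sup>1\<close>; these are the faces of \<open>\<box>^(n+2)\<close> in the directions \<open>1, \<dots>, n + 1\<close>.\<close>

definition bdry_homotopy ::
  "'a cubical \<Rightarrow> 'a \<Rightarrow> nat \<Rightarrow> (nat \<Rightarrow> bool \<Rightarrow> 'a) \<Rightarrow> (nat \<Rightarrow> bool \<Rightarrow> 'a) \<Rightarrow> (nat \<Rightarrow> bool \<Rightarrow> 'a) \<Rightarrow> bool" where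
  "bdry_homotopy X x n a b h \<longleftrightarrow> face_family X (Suc n) {(i, \<epsilon>). i \<le> Suc n} h \<and>
     (\<forall>i \<epsilon>. 1 \<le> i \<longrightarrow> i \<le> Suc n \<longrightarrow> cface X n (Suc n) False (h i \<epsilon>) = a i \<epsilon>) \<and>
     (\<forall>i \<epsilon>. 1 \<le> i \<longrightarrow> i \<le> Suc n \<longrightarrow> cface X n (Suc n) True (h i \<epsilon>) = b i \<epsilon>) \<and>
     act X 1 (Suc n) (zero_edge n) (h 1 False) = const_cell X x 1"

text \<open>The cylinder over the boundary of the (n+1)-cube is mapped to \<box>^(n+2) by sending
  \<open>u\<close> \<otimes> \<open>w\<close> to \<open>cube_tensor m m' u w\<close>, with values in
  the union of the faces in directions \<open>1, ..., n + 1\<close>. The family \<open>h\<close>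
  defines a map \<open>F\<close> on that union, which is pulled back to the tensor product.\<close>

lemma pointed_homotopicI:
  assumes X: "cubical_set X" and x: "x \<in> cells X 0"
    and f: "f \<in> cubical_maps (bdry_cube (Suc n)) X" and g: "g \<in> cubical_maps (bdry_cube (Suc n)) X"
    and h: "bdry_homotopy X x n (\<lambda>i \<epsilon>. f n (face n i \<epsilon>)) (\<lambda>i \<epsilon>. g n (face n i \<epsilon>)) h"
  shows "pointed_homotopic (bdry_cube (Suc n)) (zero_vertex (Suc n)) X x f g"
proof -
  let ?Z = "bdry_cube (Suc n)" and ?I = "std_cube 1" and ?S = "{(i, \<epsilon> :: bool). i \<le> Suc n}"
  let ?U = "face_union (Suc (Suc n)) ?S"
  have hf: "face_family X (Suc n) ?S h"
    and h0: "\<And>i \<epsilon>. 1 \<le> i \<Longrightarrow> i \<le> Suc n \<Longrightarrow> cface X n (Suc n) False (h i \<epsilon>) = f n (face n i \<epsilon>)"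
    and h1: "\<And>i \<epsilon>. 1 \<le> i \<Longrightarrow> i \<le> Suc n \<Longrightarrow> cface X n (Suc n) True (h i \<epsilon>) = g n (face n i \<epsilon>)"
    and hx: "act X 1 (Suc n) (zero_edge n) (h 1 False) = const_cell X x 1"
    using h unfolding bdry_homotopy_def by auto
  obtain F where F: "F \<in> cubical_maps ?U X"
    "\<And>i \<epsilon> m g. 1 \<le> i \<Longrightarrow> i \<le> Suc (Suc n) \<Longrightarrow> (i, \<epsilon>) \<in> ?S \<Longrightarrow> g \<in> cube_hom m (Suc n) \<Longrightarrow>
      F m (compose (verts m) (face (Suc n) i \<epsilon>) g) = act X m (Suc n) g (h i \<epsilon>)"
    using face_family_extends[OF X hf] by blast
  have Z: "cubical_set ?Z" unfolding bdry_cube_def by (rule cubical_set_face_union)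
  have I: "cubical_set ?I" by (rule cubical_set_std_cube)
  have cellI: "cells ?I m = cube_hom m 1" "act ?I m n a e = compose (verts m) e a" for m n a e
    by (simp_all add: std_cube_def)
  have actZ: "act ?Z k m a u = compose (verts k) u a" for k m a u
    by (simp add: bdry_cube_def face_union_act)
  have homZ: "u \<in> cells ?Z m \<Longrightarrow> u \<in> cube_hom m (Suc n)" for u m
    unfolding bdry_cube_def by (rule face_union_cell_hom)
  have cellZ: "u \<in> cells ?Z m \<longleftrightarrow>
      (\<exists>i \<epsilon> g. 1 \<le> i \<and> i \<le> Suc n \<and> g \<in> cube_hom m n \<and> u = compose (verts m) (face n i \<epsilon>) g)" for u m
    unfolding bdry_cube_def face_union_cell_iff by simp
  have tl: "cube_tensor m m' (compose (verts m) (face n i \<epsilon>) u) w =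
      compose (verts (m + m')) (face (Suc n) i \<epsilon>) (cube_tensor m m' u w)"
    if "u \<in> cube_hom m n" "w \<in> cube_hom m' 1" "1 \<le> i" "i \<le> Suc n" for m m' i \<epsilon> u w
    using tensor_face_left[OF that] by simp
  have tU: "compose (verts k) (cube_tensor m m' u w) a \<in> cells ?U k"
    if u: "u \<in> cells ?Z m" and "w \<in> cube_hom m' 1" "a \<in> cube_hom k (m + m')" for k m m' u w a
  proof -
    obtain i \<epsilon> g where u: "1 \<le> i" "i \<le> Suc n" "g \<in> cube_hom m n" "u = compose (verts m) (face n i \<epsilon>) g"
      using u cellZ[of u m] by blast
    have gw: "cube_tensor m m' g w \<in> cube_hom (m + m') (Suc n)"
      using cube_tensor_hom[OF u(3) that(2)] by simp
    show ?thesis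
      unfolding face_union_cell_iff u(4) tl[OF u(3) that(2) u(1,2)] comp_assoc[OF that(3) gw, symmetric]
      using u(1,2) cube_hom_comp[OF that(3) gw] by fastforce
  qed
  obtain H where H: "H \<in> cubical_maps (tensor ?Z ?I) X"
    "\<And>k m m' a u w. (m, m', a, u, w) \<in> tensor_reps ?Z ?I k \<Longrightarrow>
      H k (tensor_equiv ?Z ?I k `` {(m, m', a, u, w)}) = F k (compose (verts k) (cube_tensor m m' u w) a)"
  proof (rule tensor_map_extends[OF Z I X, where val = "\<lambda>k m m' a u w. F k (compose (verts k) (cube_tensor m m' u w) a)"])
    fix k m m' a u w assume "(m, m', a, u, w) \<in> tensor_reps ?Z ?I k"
    then show "F k (compose (verts k) (cube_tensor m m' u w) a) \<in> cells X k"
      by (intro cubical_maps_cell[OF F(1)] tU) (auto simp: tensor_reps_def cellI)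
  next
    fix k m p m' p' a b f u w
    assume *: "a \<in> cube_hom m m'" "b \<in> cube_hom p p'" "f \<in> cube_hom k (m + p)" "u \<in> cells ?Z m'" "w \<in> cells ?I p'"
    show "F k (compose (verts k) (cube_tensor m' p' u w) (compose (verts k) (cube_tensor m p a b) f)) =
        F k (compose (verts k) (cube_tensor m p (act ?Z m m' a u) (act ?I p p' b w)) f)"
      unfolding actZ cellI comp_assoc[OF *(3) cube_tensor_hom[OF *(1,2)]] cube_tensor_comp[OF *(1,2)] ..
  next
    fix k' k g m m' a u w assume g: "g \<in> cube_hom k' k" and r: "(m, m', a, u, w) \<in> tensor_reps ?Z ?I k"
    then have r: "a \<in> cube_hom k (m + m')" "u \<in> cells ?Z m" "w \<in> cube_hom m' 1"
      by (auto simp: tensor_reps_def cellI)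
    show "F k' (compose (verts k') (cube_tensor m m' u w) (compose (verts k') a g)) =
        act X k' k g (F k (compose (verts k) (cube_tensor m m' u w) a))"
      unfolding cubical_maps_act[OF F(1) g tU[OF r(2,3,1)], symmetric] face_union_act comp_assoc[OF g r(1)] ..
  qed blast
  have Hcell: "H (m + m') (tensor_cell ?Z ?I m m' u w) = F (m + m') (cube_tensor m m' u w)"
    if "u \<in> cells ?Z m" "w \<in> cube_hom m' 1" for m m' u w
    unfolding tensor_cell_def
    by (subst H(2)) (use that in \<open>simp_all add: tensor_reps_def cube_hom_id cellI
      comp_id_right[OF cube_tensor_hom[OF homZ[OF that(1)] that(2)]]\<close>)
  have end_cell: "H k (tensor_cell ?Z ?I k 0 w (face 0 1 \<delta>)) = q k w"
    if w: "w \<in> cells ?Z k" and q: "q \<in> cubical_maps ?Z X"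
      and hq: "\<And>i \<epsilon>. 1 \<le> i \<Longrightarrow> i \<le> Suc n \<Longrightarrow> cface X n (Suc n) \<delta> (h i \<epsilon>) = q n (face n i \<epsilon>)" for k w \<delta> q
  proof -
    have e: "face 0 1 \<delta> \<in> cube_hom 0 1" using face_hom[of 1 0 \<delta>] by simp
    obtain i \<epsilon> g where u: "1 \<le> i" "i \<le> Suc n" "g \<in> cube_hom k n" "w = compose (verts k) (face n i \<epsilon>) g"
      using w cellZ[of w k] by blast
    have gh: "compose (verts k) (face n (Suc n) \<delta>) g \<in> cube_hom k (Suc n)"
      by (intro cube_hom_comp[OF u(3)] face_hom) auto
    have hi: "h i \<epsilon> \<in> cells X (Suc n)" using face_family_cell[OF hf] u by simp
    have "H k (tensor_cell ?Z ?I k 0 w (face 0 1 \<delta>)) = F k (cube_tensor k 0 w (face 0 1 \<delta>))"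
      using Hcell[OF w e] by simp
    also have "cube_tensor k 0 w (face 0 1 \<delta>) =
        compose (verts k) (face (Suc n) i \<epsilon>) (compose (verts k) (face n (Suc n) \<delta>) g)"
      using tl[OF u(3) e u(1,2)] by (simp add: u(4) tensor_face_right[OF u(3)])
    also have "F k \<dots> = act X k (Suc n) (compose (verts k) (face n (Suc n) \<delta>) g) (h i \<epsilon>)"
      using u gh by (intro F(2)) auto
    also have "\<dots> = act X k n g (cface X n (Suc n) \<delta> (h i \<epsilon>))"
      by (rule act_cface[symmetric, OF X _ _ u(3) hi]) auto
    also have "\<dots> = q k w"
      unfolding hq[OF u(1,2)] u(4)
      by (rule face_union_map_face[symmetric, OF q[unfolded bdry_cube_def] u(1,2) _ u(3)]) simp
    finally show ?thesis .
  qed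
  \<comment> \<open>The vertex 0 lies on the face \<open>(1, False)\<close>, so the edge over it is
    the zero edge of that face.\<close>
  have base: "H k (tensor_cell ?Z ?I 0 k (zero_vertex (Suc n)) e) = const_cell X x k"
    if e: "e \<in> cube_hom k 1" for k e
  proof -
    have zZ: "zero_vertex (Suc n) \<in> cells ?Z 0"
      unfolding cellZ zero_vertex_Suc using zero_vertex_hom by fastforce
    have "H k (tensor_cell ?Z ?I 0 k (zero_vertex (Suc n)) e) = F k (cube_tensor 0 k (zero_vertex (Suc n)) e)"
      using Hcell[OF zZ e] by simp
    also have "cube_tensor 0 k (zero_vertex (Suc n)) e =
        compose (verts k) (face (Suc n) 1 False) (compose (verts k) (zero_edge n) e)"
      using tl[OF zero_vertex_hom e, of 1] by (simp add: zero_vertex_Suc zero_edge_comp[OF e])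
    also have "F k \<dots> = act X k (Suc n) (compose (verts k) (zero_edge n) e) (h 1 False)"
      using cube_hom_comp[OF e zero_edge_hom] by (intro F(2)) auto
    also have "\<dots> = act X k 1 e (act X 1 (Suc n) (zero_edge n) (h 1 False))"
      using face_family_cell[OF hf, of 1 False]
      by (intro cubical_set_comp[symmetric, OF X e zero_edge_hom]) auto
    also have "\<dots> = const_cell X x k" unfolding hx by (rule act_const_cell[OF X x e])
    finally show ?thesis .
  qed
  show ?thesis
    unfolding pointed_homotopic_def cellI
    using H(1) end_cell[OF _ f h0] end_cell[OF _ g h1] base by blast
qed

text \<open>The cubes are the values of the homotopy at the products of a face with the identity of
  \<box>^1. All conditions then follow from the naturality of \<open>H\<close> under products of
  operators, isolated as \<open>act_h\<close>.\<close>

lemma pointed_homotopicE: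
  assumes X: "cubical_set X" and x: "x \<in> cells X 0"
    and fg: "pointed_homotopic (bdry_cube (Suc n)) (zero_vertex (Suc n)) X x f g"
  obtains h where "bdry_homotopy X x n (\<lambda>i \<epsilon>. f n (face n i \<epsilon>)) (\<lambda>i \<epsilon>. g n (face n i \<epsilon>)) h"
proof -
  let ?Z = "bdry_cube (Suc n)" and ?I = "std_cube 1"
  have Z: "cubical_set ?Z" unfolding bdry_cube_def by (rule cubical_set_face_union)
  have I: "cubical_set ?I" by (rule cubical_set_std_cube)
  have cellI: "cells ?I m = cube_hom m 1" "act ?I m n a e = compose (verts m) e a" for m n a e
    by (simp_all add: std_cube_def)
  have actZ: "act ?Z k m a u = compose (verts k) u a" for k m a u
    by (simp add: bdry_cube_def face_union_act)
  have faceZ: "face n i \<epsilon> \<in> cells ?Z n" if "1 \<le> i" "i \<le> Suc n" for i \<epsilon>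
    unfolding bdry_cube_def using that by (intro face_in_face_union) auto
  obtain H where H: "H \<in> cubical_maps (tensor ?Z ?I) X"
    and H0: "\<And>k w. w \<in> cells ?Z k \<Longrightarrow> H k (tensor_cell ?Z ?I k 0 w (face 0 1 False)) = f k w"
    and H1: "\<And>k w. w \<in> cells ?Z k \<Longrightarrow> H k (tensor_cell ?Z ?I k 0 w (face 0 1 True)) = g k w"
    and Hx: "\<And>k e. e \<in> cells ?I k \<Longrightarrow>
      H k (tensor_cell ?Z ?I 0 k (zero_vertex (Suc n)) e) = const_cell X x k"
    using fg unfolding pointed_homotopic_def by blast
  define h where "h i \<epsilon> = H (Suc n) (tensor_cell ?Z ?I n 1 (face n i \<epsilon>) (id_map 1))" for i \<epsilon>
  have act_h: "act X (p + q) (Suc n) (cube_tensor p q a b) (h i \<epsilon>) =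
      H (p + q) (tensor_cell ?Z ?I p q (compose (verts p) (face n i \<epsilon>) a) b)"
    if i: "1 \<le> i" "i \<le> Suc n" and a: "a \<in> cube_hom p n" and b: "b \<in> cube_hom q 1" for p q a b i \<epsilon>
  proof -
    have c: "tensor_cell ?Z ?I n 1 (face n i \<epsilon>) (id_map 1) \<in> cells (tensor ?Z ?I) (n + 1)"
      by (intro tensor_cell_in faceZ i) (simp add: cellI cube_hom_id)
    have "act X (p + q) (n + 1) (cube_tensor p q a b) (h i \<epsilon>) = H (p + q) (act (tensor ?Z ?I) (p + q) (n + 1)
        (cube_tensor p q a b) (tensor_cell ?Z ?I n 1 (face n i \<epsilon>) (id_map 1)))"
      using cubical_maps_act[OF H cube_tensor_hom[OF a b] c] by (simp add: h_def)
    also have "\<dots> = H (p + q) (tensor_cell ?Z ?I p q (compose (verts p) (face n i \<epsilon>) a) b)"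
      by (subst act_tensor_cell[OF Z I a b faceZ[OF i]])
         (simp_all add: cellI cube_hom_id actZ comp_id_left[OF b])
    finally show ?thesis by simp
  qed
  have cell: "h i \<epsilon> \<in> cells X (Suc n)" if "1 \<le> i" "i \<le> Suc n" for i \<epsilon>
    using cubical_maps_cell[OF H tensor_cell_in[OF faceZ[OF that], of "id_map 1" ?I 1]]
    by (simp add: h_def cellI cube_hom_id)
  have ends: "cface X n (Suc n) \<delta> (h i \<epsilon>) = H n (tensor_cell ?Z ?I n 0 (face n i \<epsilon>) (face 0 1 \<delta>))"
    if "1 \<le> i" "i \<le> Suc n" for i \<epsilon> \<delta>
  proof -
    have e: "face 0 1 \<delta> \<in> cube_hom 0 1" using face_hom[of 1 0 \<delta>] by simp
    have "cube_tensor n 0 (id_map n) (face 0 1 \<delta>) = face n (Suc n) \<delta>"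
      unfolding tensor_face_right[OF cube_hom_id] by (intro comp_id_right[OF face_hom]) auto
    then show ?thesis
      using act_h[OF that cube_hom_id e] unfolding comp_id_right[OF face_hom[OF that]]
      by (simp add: cface_def)
  qed
  have "bdry_homotopy X x n (\<lambda>i \<epsilon>. f n (face n i \<epsilon>)) (\<lambda>i \<epsilon>. g n (face n i \<epsilon>)) h"
    unfolding bdry_homotopy_def
  proof (intro conjI allI impI)
    show "face_family X (Suc n) {(i, \<epsilon>). i \<le> Suc n} h"
    proof (rule face_familyI)
      fix i \<epsilon> assume "1 \<le> i" "(i, \<epsilon> :: bool) \<in> {(i, \<epsilon>). i \<le> Suc n}"
      then show "h i \<epsilon> \<in> cells X (Suc n)" using cell by simp
    next
      fix p i j and \<epsilon> \<eta> :: bool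
      assume p: "Suc n = Suc p" and i: "1 \<le> i" and ij: "i < j" and "(j, \<eta>) \<in> {(i, \<epsilon>). i \<le> Suc n}"
      then have p: "p = n" and j: "j \<le> Suc n" by auto
      obtain q where n: "n = Suc q" using i ij j by (cases n) auto
      \<comment> \<open>An operator has to be written as a product before \<open>act_h\<close>
        applies to it.\<close>
      have ft: "face n i \<epsilon> = cube_tensor q 1 (face q i \<epsilon>) (id_map 1)" if "1 \<le> i" "i \<le> Suc q" for i \<epsilon>
        using tensor_face_left[OF cube_hom_id[of q] cube_hom_id[of 1] that, where \<epsilon> = \<epsilon>]
        comp_id_right[OF face_hom, of i "Suc q" \<epsilon>]
        comp_id_right[OF face_hom, of i q \<epsilon>] that
        by (simp add: n tensor_id_id)
      have one: "Suc q = q + 1" by simp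
      have "cface X n i \<epsilon> (h j \<eta>) =
          H (q + 1) (tensor_cell ?Z ?I q 1 (compose (verts q) (face n j \<eta>) (face q i \<epsilon>)) (id_map 1))"
        unfolding cface_def using act_h[of j "face q i \<epsilon>" q "id_map 1" 1 \<eta>] i ij j n
        by (simp add: ft[unfolded n] face_hom cube_hom_id)
      also have "compose (verts q) (face n j \<eta>) (face q i \<epsilon>) =
          compose (verts q) (face n i \<epsilon>) (face q (j - 1) \<eta>)"
        unfolding n by (rule face_face) (use i ij j n in auto)
      also have "H (q + 1) (tensor_cell ?Z ?I q 1 \<dots> (id_map 1)) = cface X n (j - 1) \<eta> (h i \<epsilon>)"
        unfolding cface_def using act_h[of i "face q (j - 1) \<eta>" q "id_map 1" 1 \<epsilon>] i ij j n
        by (simp add: ft[unfolded n] face_hom cube_hom_id)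
      finally show "cface X p i \<epsilon> (h j \<eta>) = cface X p (j - 1) \<eta> (h i \<epsilon>)" unfolding p .
    qed
    have "act X (0 + 1) (Suc n) (cube_tensor 0 1 (zero_vertex n) (id_map 1)) (h 1 False) =
        H (0 + 1) (tensor_cell ?Z ?I 0 1 (compose (verts 0) (face n 1 False) (zero_vertex n)) (id_map 1))"
      by (rule act_h) (auto simp: zero_vertex_hom cube_hom_id)
    then show "act X 1 (Suc n) (zero_edge n) (h 1 False) = const_cell X x 1"
      using Hx[of "id_map 1" 1] by (simp add: zero_edge_def zero_vertex_Suc cellI cube_hom_id)
  qed (use ends H0 H1 faceZ in auto)
  then show ?thesis using that by blast
qed

section \<open>Contracting a cube\<close>

text \<open>The coordinatewise contraction of \<open>\<box>^n\<close> to its vertex \<open>0\<close>: \<open>contract n j\<close> is the homotopy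
  \<open>(v, t) \<mapsto> (v\<^sub>1, \<dots>, v\<^sub>j \<and> t, 0, \<dots>, 0)\<close> from \<open>trunc n (j - 1)\<close> to \<open>trunc n j\<close>.  Contracting all
  coordinates at once would require diagonals, which \<open>\<box>\<close> does not have.\<close>

definition trunc :: "nat \<Rightarrow> nat \<Rightarrow> cube_map" where
  "trunc n j = (\<lambda>v\<in>verts n. take j v @ replicate (n - j) False)"

definition contract :: "nat \<Rightarrow> nat \<Rightarrow> cube_map" where
  "contract n j = (\<lambda>v\<in>verts (Suc n). take (j - 1) v @ (v ! (j - 1) \<and> v ! n) # replicate (n - j) False)"

lemma trunc_app: "length v = n \<Longrightarrow> trunc n j v = take j v @ replicate (n - j) False"
  by (simp add: trunc_def verts_def)

lemma contract_app: "length v = Suc n \<Longrightarrow>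
    contract n j v = take (j - 1) v @ (v ! (j - 1) \<and> v ! n) # replicate (n - j) False"
  by (simp add: contract_def verts_def)

lemma trunc_eq:
  assumes "j \<le> n"
  shows "trunc n j =
    cube_tensor j (n - j) (id_map j) (compose (verts (n - j)) (zero_vertex (n - j)) (terminal_map (n - j)))"
  using assms by (auto simp: trunc_def cube_tensor_def id_map_def compose_def verts_def terminal_map_def
      zero_vertex_def fun_eq_iff)

lemma trunc_hom: "j \<le> n \<Longrightarrow> trunc n j \<in> cube_hom n n"
  unfolding trunc_eq
  using cube_tensor_hom[OF cube_hom_id[of j] cube_hom_comp[OF terminal_map_hom[of "n - j"] zero_vertex_hom[of "n - j"]]]
  by simp

text \<open>Coordinates \<open>j + 1, ..., n\<close> are deleted first, by \<open>a\<close>, which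
  makes coordinate \<open>j\<close> adjacent to the time coordinate; then one connection applies,
  and \<open>b\<close> appends zeros.\<close>

lemma contract_hom:
  assumes "1 \<le> j" "j \<le> n"
  shows "contract n j \<in> cube_hom (Suc n) n"
proof -
  define a where "a = cube_tensor n 1 (cube_tensor j (n - j) (id_map j) (terminal_map (n - j))) (id_map 1)"
  define b where "b = cube_tensor j 0 (id_map j) (zero_vertex (n - j))"
  have a: "a \<in> cube_hom (Suc n) (Suc j)"
    using cube_tensor_hom[OF cube_tensor_hom[OF cube_hom_id[of j] terminal_map_hom[of "n - j"]] cube_hom_id[of 1]] assms
    by (simp add: a_def)
  have c: "connection j j True \<in> cube_hom (Suc j) j" using assms by (intro connection_hom) auto
  have b: "b \<in> cube_hom j n"
    using cube_tensor_hom[OF cube_hom_id[of j] zero_vertex_hom[of "n - j"]] assms by (simp add: b_def)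
  have "contract n j = compose (verts (Suc n)) b (compose (verts (Suc n)) (connection j j True) a)"
  proof
    fix v
    show "contract n j v = compose (verts (Suc n)) b (compose (verts (Suc n)) (connection j j True) a) v"
    proof (cases "length v = Suc n")
      case True
      obtain i where j: "j = Suc i" using assms by (cases j) auto
      have av: "a v = take j v @ drop n v" using True assms by (simp add: a_def app_simps min_def)
      have "drop n v = [v ! n]" using True by (metis Cons_nth_drop_Suc drop_all le_refl lessI)
      then have "connection j j True (a v) = take (j - 1) v @ [v ! (j - 1) \<and> v ! n]"
        unfolding av using True assms by (subst connection_app) (auto simp: j nth_append min_def)
      then show ?thesis using True assms by (simp add: app_simps contract_app b_def j)
    qed (simp add: contract_def compose_def verts_def)
  qed
  then show ?thesis using cube_hom_comp[OF cube_hom_comp[OF a c] b] by simp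
qed

lemma contract_end:
  assumes "1 \<le> j" "j \<le> n"
  shows "compose (verts n) (contract n j) (face n (Suc n) \<epsilon>) = trunc n (if \<epsilon> then j else j - 1)"
proof (rule cube_hom_eqI[OF cube_hom_comp[OF face_hom contract_hom] trunc_hom])
  fix v :: "bool list" assume v: "length v = n"
  obtain i where j: "j = Suc i" using assms by (cases j) auto
  show "compose (verts n) (contract n j) (face n (Suc n) \<epsilon>) v = trunc n (if \<epsilon> then j else j - 1) v"
    using assms v by (simp add: app_simps contract_app trunc_app j nth_append take_Suc_conv_app_nth
        Suc_diff_Suc flip: replicate_Suc)
qed (use assms in auto)

lemma trunc_self: "trunc n n = id_map n"
  by (auto simp: trunc_def id_map_def verts_def)

text \<open>The contraction fixes the vertex 0 at all times, which keeps the resulting homotopies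
  pointed.\<close>

lemma contract_zero_edge:
  assumes "1 \<le> j" "j \<le> n"
  shows "compose (verts 1) (contract n j) (zero_edge n) = compose (verts 1) (zero_vertex n) (terminal_map 1)"
proof (rule cube_hom_eqI[OF cube_hom_comp[OF zero_edge_hom contract_hom[OF assms]]
      cube_hom_comp[OF terminal_map_hom zero_vertex_hom]])
  fix v :: "bool list" assume v: "length v = 1"
  obtain i where j: "j = Suc i" using assms by (cases j) auto
  have n: "n = i + Suc (n - j)" using assms j by simp
  have "replicate n False = replicate i False @ False # replicate (n - j) False"
    by (subst n, subst replicate_add) simp
  then show "compose (verts 1) (contract n j) (zero_edge n) v = compose (verts 1) (zero_vertex n) (terminal_map 1) v"
    using assms v by (simp add: app_simps contract_app zero_edge_def j nth_append)
qed

text \<open>When the positions of a cylinder have been contracted completely, only the edge over the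
  vertex 0 is left. A pointed homotopy is constant there, which is why the path extracted from it in
  \<open>chain_homotopy\<close> has constant sides.\<close>

lemma trunc_0_tensor:
  "cube_tensor n 1 (trunc n 0) (id_map 1) =
    compose (verts (Suc n)) (zero_edge n) (cube_tensor n 1 (terminal_map n) (id_map 1))"
  by (auto simp: cube_tensor_def trunc_def compose_def zero_edge_def zero_vertex_def terminal_map_def
      id_map_def verts_def fun_eq_iff)

text \<open>Coordinates \<open>1, ..., n\<close> are positions, \<open>n + 1\<close> is the time of
  the contraction and \<open>n + 2\<close> the parameter of the cylinder. The time is kept directly
  behind the positions, so that \<open>contract\<close> applies to the left factor.\<close>

lemma contract_tensor_end:
  assumes "1 \<le> j" "j \<le> n"
  shows "compose (verts (Suc n)) (cube_tensor (Suc n) 1 (contract n j) (id_map 1)) (face (Suc n) (Suc n) \<epsilon>) =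
    cube_tensor n 1 (trunc n (if \<epsilon> then j else j - 1)) (id_map 1)"
proof -
  have f: "face n (Suc n) \<epsilon> \<in> cube_hom n (Suc n)" by (intro face_hom) auto
  have "face (Suc n) (Suc n) \<epsilon> = cube_tensor n 1 (face n (Suc n) \<epsilon>) (id_map 1)"
    using tensor_face_left[OF cube_hom_id[of n] cube_hom_id[of 1], where \<epsilon> = \<epsilon> and i = "Suc n"]
      comp_id_right[OF f] comp_id_right[OF face_hom, of "Suc n" "Suc n" \<epsilon>]
    by (simp add: tensor_id_id)
  then show ?thesis
    using cube_tensor_comp[OF f cube_hom_id[of 1], of "contract n j" "id_map 1"] contract_end[OF assms, of \<epsilon>]
      comp_id_left[OF cube_hom_id[of 1]] by simp
qed

lemma contract_tensor_side:
  assumes "1 \<le> j" "j \<le> n"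
  shows "compose (verts (Suc n)) (cube_tensor (Suc n) 1 (contract n j) (id_map 1)) (face (Suc n) (Suc (Suc n)) \<epsilon>) =
    compose (verts (Suc n)) (face n (Suc n) \<epsilon>) (contract n j)"
proof -
  have e: "face 0 1 \<epsilon> \<in> cube_hom 0 1" using face_hom[of 1 0 \<epsilon>] by simp
  have f: "face (Suc n) (Suc (Suc n)) \<epsilon> = cube_tensor (Suc n) 0 (id_map (Suc n)) (face 0 1 \<epsilon>)"
    using tensor_face_right[OF cube_hom_id[of "Suc n"], of \<epsilon>]
      comp_id_right[OF face_hom, of "Suc (Suc n)" "Suc n" \<epsilon>] by simp
  show ?thesis
    unfolding f
    using cube_tensor_comp[OF cube_hom_id[of "Suc n"] e, of "contract n j" "id_map 1"]
      comp_id_right[OF contract_hom[OF assms]] comp_id_left[OF e]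
      tensor_face_right[OF contract_hom[OF assms], of \<epsilon>]
    by simp
qed

text \<open>A face of a cube can be exchanged for a cube \<open>c\<close> with the same boundary,
  because the matching conditions involve only the boundary of each face. Agreement is asked for
  just where \<open>c\<close> meets another face in \<open>S\<close>, so open boxes and the sides of
  a cylinder are covered as well.\<close>

lemma face_family_replace:
  assumes X: "cubical_set X" and B: "B \<in> cells X (Suc m)" and k: "1 \<le> k" "k \<le> Suc m" and c: "c \<in> cells X m"
    and lo: "\<And>p i \<epsilon>. m = Suc p \<Longrightarrow> 1 \<le> i \<Longrightarrow> i < k \<Longrightarrow> (i, \<epsilon>) \<in> S \<Longrightarrow>
      cface X p i \<epsilon> c = cface X p i \<epsilon> (cface X m k \<delta> B)"
    and hi: "\<And>p i \<epsilon>. m = Suc p \<Longrightarrow> k < i \<Longrightarrow> i \<le> Suc m \<Longrightarrow> (i, \<epsilon>) \<in> S \<Longrightarrow>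
      cface X p (i - 1) \<epsilon> c = cface X p (i - 1) \<epsilon> (cface X m k \<delta> B)"
  shows "face_family X m S (\<lambda>i \<epsilon>. if i = k \<and> \<epsilon> = \<delta> then c else cface X m i \<epsilon> B)"
proof (rule face_familyI)
  fix p i j \<epsilon> \<eta>
  assume m: "m = Suc p" and ij: "1 \<le> i" "i < j" "j \<le> Suc m" "(i, \<epsilon>) \<in> S" "(j, \<eta>) \<in> S"
  have eq: "cface X p i \<epsilon> (cface X m j \<eta> B) = cface X p (j - 1) \<eta> (cface X m i \<epsilon> B)"
    unfolding m by (rule cface_cface[OF X]) (use ij m B in auto)
  show "cface X p i \<epsilon> (if j = k \<and> \<eta> = \<delta> then c else cface X m j \<eta> B) =
      cface X p (j - 1) \<eta> (if i = k \<and> \<epsilon> = \<delta> then c else cface X m i \<epsilon> B)"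
    using ij eq lo[OF m, of i \<epsilon>] hi[OF m, of j \<eta>] by auto
qed (use c cface_cell[OF X] B in auto)

text \<open>The sides \<open>h\<close> match one another already; only a side and an end can still
  conflict. The set \<open>S\<close> is left arbitrary to cover two kinds of open box, those missing
  an end and those missing a side.\<close>

lemma cylinder_family:
  assumes h: "face_family X (Suc n) {(i, \<epsilon>) \<in> S. i \<le> Suc n} h"
    and c: "\<And>\<delta>. (Suc (Suc n), \<delta>) \<in> S \<Longrightarrow> c \<delta> \<in> cells X (Suc n)"
    and hc: "\<And>i \<epsilon> \<delta>. 1 \<le> i \<Longrightarrow> i \<le> Suc n \<Longrightarrow> (i, \<epsilon>) \<in> S \<Longrightarrow> (Suc (Suc n), \<delta>) \<in> S \<Longrightarrow>
      cface X n (Suc n) \<delta> (h i \<epsilon>) = cface X n i \<epsilon> (c \<delta>)"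
  shows "face_family X (Suc n) S (\<lambda>i \<epsilon>. if i = Suc (Suc n) then c \<epsilon> else h i \<epsilon>)"
proof (rule face_familyI)
  fix i \<epsilon> assume "1 \<le> i" "i \<le> Suc (Suc n)" "(i, \<epsilon>) \<in> S"
  then show "(if i = Suc (Suc n) then c \<epsilon> else h i \<epsilon>) \<in> cells X (Suc n)"
    using c face_family_cell[OF h, of i \<epsilon>] by auto
next
  fix p i j \<epsilon> \<eta>
  assume "Suc n = Suc p" and ij: "1 \<le> i" "i < j" "j \<le> Suc (Suc n)" "(i, \<epsilon>) \<in> S" "(j, \<eta>) \<in> S"
  then have p: "p = n" by simp
  show "cface X p i \<epsilon> (if j = Suc (Suc n) then c \<eta> else h j \<eta>) =
      cface X p (j - 1) \<eta> (if i = Suc (Suc n) then c \<epsilon> else h i \<epsilon>)"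
    unfolding p using ij hc[of i \<epsilon> \<eta>] face_family_eq[OF h, of i j \<epsilon> \<eta>]
    by (cases "j = Suc (Suc n)") (auto simp: Suc_eq_plus1_left[symmetric])
qed

section \<open>Loop spaces and spheres\<close>

text \<open>Each new loop coordinate is placed behind the earlier ones: the faces in direction 1 of
  the \<open>n\<close>-fold loop space are faces in direction \<open>n + 1\<close> of
  \<open>X\<close>.\<close>

lemma id_tensor_face: "cube_tensor n k (id_map n) (face k 1 \<epsilon>) = face (n + k) (Suc n) \<epsilon>"
proof (rule cube_hom_eqI)
  show "cube_tensor n k (id_map n) (face k 1 \<epsilon>) \<in> cube_hom (n + k) (n + Suc k)"
    by (intro cube_tensor_hom cube_hom_id face_hom) auto
  show "face (n + k) (Suc n) \<epsilon> \<in> cube_hom (n + k) (Suc (n + k))" by (intro face_hom) auto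
qed (simp add: app_simps)

lemma tensor_id_assoc:
  "cube_tensor n (Suc m) (id_map n) (cube_tensor 1 m (id_map 1) f) = cube_tensor (Suc n) m (id_map (Suc n)) f"
proof
  fix v
  show "cube_tensor n (Suc m) (id_map n) (cube_tensor 1 m (id_map 1) f) v =
      cube_tensor (Suc n) m (id_map (Suc n)) f v"
  proof (cases "length v = n + Suc m")
    case True
    moreover have "take (Suc n) v = take n v @ take 1 (drop n v)" using take_add[of n 1 v] by simp
    ultimately show ?thesis by (simp add: app_simps)
  qed (simp add: cube_tensor_def verts_def)
qed

lemma id_tensor_comp_face:
  assumes "f \<in> cube_hom m n"
  shows "compose (verts m) (cube_tensor 1 m (id_map 1) f) (face m 1 \<epsilon>) = compose (verts m) (face n 1 \<epsilon>) f"
proof (rule cube_hom_eqI)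
  show "compose (verts m) (cube_tensor 1 m (id_map 1) f) (face m 1 \<epsilon>) \<in> cube_hom m (1 + n)"
    by (rule cube_hom_comp[OF face_hom]) (use cube_tensor_hom[OF cube_hom_id[of 1] assms] in auto)
  show "compose (verts m) (face n 1 \<epsilon>) f \<in> cube_hom m (Suc n)"
    by (rule cube_hom_comp[OF assms face_hom]) auto
qed (simp add: app_simps cube_hom_length[OF assms] take_Cons' drop_Cons')

lemma cubical_set_loop_obj:
  assumes Y: "cubical_set Y" and y: "y \<in> cells Y 0"
  shows "cubical_set (loop_obj Y y)"
proof -
  have cells: "u \<in> cells (loop_obj Y y) n \<longleftrightarrow>
      u \<in> cells Y (Suc n) \<and> (\<forall>\<epsilon>. act Y n (Suc n) (face n 1 \<epsilon>) u = const_cell Y y n)" for u n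
    by (simp add: loop_obj_def path_obj_def)
  have act: "act (loop_obj Y y) m n f u = act Y (Suc m) (Suc n) (cube_tensor 1 m (id_map 1) f) u" for m n f u
    by (simp add: loop_obj_def path_obj_def)
  have hom: "cube_tensor 1 m (id_map 1) f \<in> cube_hom (Suc m) (Suc n)" if "f \<in> cube_hom m n" for m n f
    using cube_tensor_hom[OF cube_hom_id[of 1] that] by simp
  show ?thesis
    unfolding cubical_set_def
  proof (intro conjI allI ballI)
    fix m n f u assume f: "f \<in> cube_hom m n" and u: "u \<in> cells (loop_obj Y y) n"
    have "act Y m (Suc m) (face m 1 \<epsilon>) (act (loop_obj Y y) m n f u) = const_cell Y y m" for \<epsilon>
    proof -
      have "act Y m (Suc m) (face m 1 \<epsilon>) (act (loop_obj Y y) m n f u) =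
          act Y m (Suc n) (compose (verts m) (face n 1 \<epsilon>) f) u"
        unfolding act id_tensor_comp_face[OF f, symmetric]
        by (rule cubical_set_comp[OF Y face_hom hom[OF f]]) (use u cells in auto)
      also have "\<dots> = act Y m n f (act Y n (Suc n) (face n 1 \<epsilon>) u)"
        by (rule cubical_set_comp[symmetric, OF Y f face_hom]) (use u cells in auto)
      finally show ?thesis using u act_const_cell[OF Y y f] by (simp add: cells)
    qed
    then show "act (loop_obj Y y) m n f u \<in> cells (loop_obj Y y) m"
      using u cubical_set_act[OF Y hom[OF f]] by (simp add: cells act)
  next
    fix n u assume "u \<in> cells (loop_obj Y y) n"
    then show "act (loop_obj Y y) n n (id_map n) u = u"
      using tensor_id_id[of 1 n] by (simp add: act cells cubical_set_id[OF Y])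
  next
    fix k m n f g u assume f: "f \<in> cube_hom k m" and g: "g \<in> cube_hom m n" and u: "u \<in> cells (loop_obj Y y) n"
    then show "act (loop_obj Y y) k n (compose (verts k) g f) u =
        act (loop_obj Y y) k m f (act (loop_obj Y y) m n g u)"
      using cube_tensor_comp[OF cube_hom_id[of 1] f, of "id_map 1" g] comp_id_left[OF cube_hom_id[of 1]]
      by (simp add: act cells cubical_set_comp[OF Y hom[OF f] hom[OF g]])
  qed
qed

lemma map_comp_maps:
  assumes "Q \<in> cubical_maps W Z" "F \<in> cubical_maps Z X" "cubical_set W"
  shows "map_comp W F Q \<in> cubical_maps W X"
  using assms(1,2) cubical_set_act[OF assms(3)]
  by (auto simp: map_comp_def cubical_maps_def compose_def PiE_iff)

section \<open>Cells of the quotient of the cube by its boundary\<close>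

lemma sphere_act_base: "f \<in> cube_hom k m \<Longrightarrow> act (sphere n) k m f (sphere_base n m) = sphere_base n k"
  using sphere_act_class[of f k m "Inr (terminal_map m)" n] terminal_map_hom[of m]
  by (simp add: sphere_base_def std_cube_def InrI terminal_comp)

lemma sphere_act_quot:
  "f \<in> cube_hom k m \<Longrightarrow> g \<in> cube_hom m n \<Longrightarrow>
    act (sphere n) k m f (sphere_quot n m g) = sphere_quot n k (compose (verts k) g f)"
  using sphere_act_class[of f k m "Inl g" n] by (simp add: sphere_quot_def std_cube_def InlI)

lemma sphere_cell_cases:
  assumes "C \<in> cells (sphere n) m"
  obtains g where "g \<in> cube_hom m n" "C = sphere_quot n m g" | "C = sphere_base n m"
  using assms terminal_map_unique[of _ m]
  by (auto simp: sphere_def pushout_def sphere_quot_def sphere_base_def sphere_equiv_def std_cube_def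
      elim!: quotientE)

lemma sphere_quot_in: "g \<in> cube_hom m n \<Longrightarrow> sphere_quot n m g \<in> cells (sphere n) m"
  unfolding sphere_quot_def sphere_equiv_def sphere_def pushout_def
  by (auto simp: std_cube_def intro!: quotientI)

lemma sphere_base_in: "sphere_base n m \<in> cells (sphere n) m"
  using terminal_map_hom[of m] unfolding sphere_base_def sphere_equiv_def sphere_def pushout_def
  by (auto simp: std_cube_def intro!: quotientI)

section \<open>Reduction of a map on the boundary to a single cube\<close>

locale pointed_kan =
  fixes X :: "'a cubical" and x :: 'a
  assumes kan: "kan_complex X" and point: "x \<in> cells X 0"
begin

lemma cub: "cubical_set X"
  using kan by (simp add: kan_complex_def)

text \<open>The vertex 0 of the boundary is read off on the face \<open>(1, False)\<close>, in
  accordance with \<open>zero_vertex_Suc\<close>.\<close>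

definition pointed_family :: "nat \<Rightarrow> (nat \<Rightarrow> bool \<Rightarrow> 'a) \<Rightarrow> bool" where
  "pointed_family n a \<longleftrightarrow> face_family X n UNIV a \<and> act X 0 n (zero_vertex n) (a 1 False) = x"

text \<open>The (n+2)-cube \<open>g \<circ> contract (n + 1) j\<close> deforms \<open>g\<close> to the base point in \<open>n + 1\<close> steps.  The
  \<open>h j\<close> are the values of the face \<open>\<partial>\<^sub>n\<^sub>+\<^sub>1\<close> along an extension of the deformation of the other faces
  of \<open>a\<close>, so that \<open>h 0\<close> is the n-cube to which \<open>a\<close> is reduced.\<close>

definition chain ::
  "nat \<Rightarrow> (nat \<Rightarrow> bool \<Rightarrow> 'a) \<Rightarrow> 'a \<Rightarrow> (nat \<Rightarrow> 'a) \<Rightarrow> (nat \<Rightarrow> 'a) \<Rightarrow> bool" where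
  "chain n a g h M \<longleftrightarrow> g \<in> cells X (Suc n) \<and>
     (\<forall>i \<epsilon>. 1 \<le> i \<longrightarrow> i \<le> Suc n \<longrightarrow> (i, \<epsilon>) \<noteq> (Suc n, id_end n) \<longrightarrow> cface X n i \<epsilon> g = a i \<epsilon>) \<and>
     h (Suc n) = a (Suc n) (id_end n) \<and>
     (\<forall>j. 1 \<le> j \<longrightarrow> j \<le> Suc n \<longrightarrow> M j \<in> cells X (Suc n) \<and>
        cface X n (Suc n) True (M j) = h j \<and> cface X n (Suc n) False (M j) = h (j - 1) \<and>
        (\<forall>i \<epsilon>. 1 \<le> i \<longrightarrow> i \<le> n \<longrightarrow> cface X n i \<epsilon> (M j) = cface X n i \<epsilon>
          (cface X (Suc n) (Suc n) (id_end n) (act X (Suc (Suc n)) (Suc n) (contract (Suc n) j) g))))"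

text \<open>These are the 0-cubes of the \<open>n\<close>-fold loop space, see
  \<open>loops_0_iff\<close>. For \<open>n = 0\<close> every vertex qualifies.\<close>

definition spherical :: "nat \<Rightarrow> 'a \<Rightarrow> bool" where
  "spherical n w \<longleftrightarrow> w \<in> cells X n \<and>
     (\<forall>p i \<epsilon>. n = Suc p \<longrightarrow> 1 \<le> i \<longrightarrow> i \<le> n \<longrightarrow> cface X p i \<epsilon> w = const_cell X x p)"

text \<open>The faces of the boundary map that precomposition with \<open>collapse\<close> produces
  from the cube \<open>w\<close>.\<close>

definition cap_family :: "nat \<Rightarrow> 'a \<Rightarrow> nat \<Rightarrow> bool \<Rightarrow> 'a" where
  "cap_family n w i \<epsilon> = (if i = Suc n \<and> \<epsilon> = id_end n then w else const_cell X x n)"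

text \<open>A homotopy relative to the boundary, with its parameter as last coordinate; equivalently
  a 1-cube of the \<open>n\<close>-fold loop space with vertices \<open>w\<close> and
  \<open>w'\<close>.\<close>

definition rel_path :: "nat \<Rightarrow> 'a \<Rightarrow> 'a \<Rightarrow> 'a \<Rightarrow> bool" where
  "rel_path n w w' p \<longleftrightarrow> p \<in> cells X (Suc n) \<and> cface X n (Suc n) False p = w \<and>
     cface X n (Suc n) True p = w' \<and>
     (\<forall>i \<epsilon>. 1 \<le> i \<longrightarrow> i \<le> n \<longrightarrow> cface X n i \<epsilon> p = const_cell X x n)"

text \<open>The face used to read off the base vertex belongs to \<open>A\<close>, where
  \<open>g\<close> agrees with the given map. For \<open>n = 0\<close> this holds because
  \<open>id_end\<close> exchanges the two ends.\<close>

lemma id_end_ne: "(1, False) \<noteq> (Suc n, id_end n)"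
  by (auto simp: id_end_def)

section \<open>Constant cells and faces of contracted cubes\<close>

lemma const_in: "const_cell X x n \<in> cells X n"
  by (rule const_cell_in[OF cub point])

lemma cface_const: "1 \<le> i \<Longrightarrow> i \<le> Suc n \<Longrightarrow> cface X n i \<epsilon> (const_cell X x (Suc n)) = const_cell X x n"
  by (rule cface_const_cell[OF cub point])

lemma act_const: "f \<in> cube_hom k m \<Longrightarrow> act X k m f (const_cell X x m) = const_cell X x k"
  by (rule act_const_cell[OF cub point])

lemma contract_in: "1 \<le> j \<Longrightarrow> j \<le> n \<Longrightarrow> g \<in> cells X n \<Longrightarrow> act X (Suc n) n (contract n j) g \<in> cells X (Suc n)"
  by (rule cubical_set_act[OF cub contract_hom])

lemma trunc_in: "j \<le> n \<Longrightarrow> g \<in> cells X n \<Longrightarrow> act X n n (trunc n j) g \<in> cells X n"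
  by (rule cubical_set_act[OF cub trunc_hom])

lemma cface_contract:
  assumes "1 \<le> j" "j \<le> n" "g \<in> cells X n"
  shows "cface X n (Suc n) \<epsilon> (act X (Suc n) n (contract n j) g) = act X n n (trunc n (if \<epsilon> then j else j - 1)) g"
  by (subst cface_act[OF cub _ _ contract_hom])
     (use assms in \<open>auto simp del: if_split simp: contract_end\<close>)

lemma cface_swap:
  assumes "u \<in> cells X (Suc (Suc n))" "1 \<le> i" "i \<le> Suc n"
  shows "cface X n i \<epsilon> (cface X (Suc n) (Suc (Suc n)) \<eta> u) = cface X n (Suc n) \<eta> (cface X (Suc n) i \<epsilon> u)"
  using cface_cface[OF cub assms(2), of "Suc (Suc n)" n u] assms by simp

lemma cface_swap2:
  assumes "u \<in> cells X (Suc (Suc n))" "1 \<le> i" "i \<le> n"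
  shows "cface X n i \<epsilon> (cface X (Suc n) (Suc n) \<eta> u) = cface X n n \<eta> (cface X (Suc n) i \<epsilon> u)"
  using cface_cface[OF cub assms(2), of "Suc n" n u] assms by simp

lemma cface_contract_face:
  assumes "1 \<le> j" "j \<le> Suc n" "g \<in> cells X (Suc n)"
  shows "cface X n (Suc n) \<epsilon> (cface X (Suc n) (Suc n) e (act X (Suc (Suc n)) (Suc n) (contract (Suc n) j) g)) =
    cface X n (Suc n) e (act X (Suc n) (Suc n) (trunc (Suc n) (if \<epsilon> then j else j - 1)) g)"
proof -
  have "cface X n (Suc n) \<epsilon> (cface X (Suc n) (Suc n) e (act X (Suc (Suc n)) (Suc n) (contract (Suc n) j) g)) =
      cface X n (Suc n) e (cface X (Suc n) (Suc (Suc n)) \<epsilon> (act X (Suc (Suc n)) (Suc n) (contract (Suc n) j) g))"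
    by (rule cface_swap[symmetric]) (use assms contract_in in auto)
  then show ?thesis by (simp only: cface_contract[OF assms])
qed

lemma trunc_0_const:
  assumes g: "g \<in> cells X n" and gx: "act X 0 n (zero_vertex n) g = x"
  shows "act X n n (trunc n 0) g = const_cell X x n"
proof -
  have "trunc n 0 = compose (verts n) (zero_vertex n) (terminal_map n)"
    by (auto simp: trunc_def compose_def terminal_map_def zero_vertex_def verts_def fun_eq_iff)
  then show ?thesis
    using cubical_set_comp[OF cub terminal_map_hom zero_vertex_hom g, of n] gx by (simp add: const_cell_def)
qed

text \<open>The vertex 0 lies on the face \<open>(1, False)\<close>, on which \<open>g\<close>
  agrees with \<open>a\<close>.\<close>

lemma chain_zero:
  assumes a: "pointed_family n a" and c: "chain n a g h M"
  shows "act X 0 (Suc n) (zero_vertex (Suc n)) g = x"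
proof -
  have g: "g \<in> cells X (Suc n)" and g1: "cface X n 1 False g = a 1 False"
    using c id_end_ne[of n] by (auto simp: chain_def)
  have "act X 0 (Suc n) (zero_vertex (Suc n)) g = act X 0 n (zero_vertex n) (cface X n 1 False g)"
    unfolding zero_vertex_Suc by (rule act_cface[symmetric, OF cub _ _ zero_vertex_hom g]) auto
  then show ?thesis using a by (simp add: g1 pointed_family_def)
qed

text \<open>The cube \<open>h j\<close> and the remaining face of the truncated \<open>g\<close>
  agree on their boundaries, but need not be equal. For \<open>j \<le> n\<close> the cube
  \<open>h j\<close> is the end 0 of \<open>M (j + 1)\<close>, whose sides are those of the
  contracted cube; for \<open>j = n + 1\<close> the matching conditions of \<open>a\<close>
  apply.\<close>

lemma chain_bdry:
  assumes a: "face_family X n UNIV a" and c: "chain n a g h M" and j: "j \<le> Suc n"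
  shows "h j \<in> cells X n \<and> (\<forall>p i \<epsilon>. n = Suc p \<longrightarrow> 1 \<le> i \<longrightarrow> i \<le> n \<longrightarrow> cface X p i \<epsilon> (h j) =
    cface X p i \<epsilon> (cface X n (Suc n) (id_end n) (act X (Suc n) (Suc n) (trunc (Suc n) j) g)))"
proof (cases "j = Suc n")
  case True
  have g: "g \<in> cells X (Suc n)" using c by (simp add: chain_def)
  have h: "h j = a (Suc n) (id_end n)" using c True by (simp add: chain_def)
  have T: "act X (Suc n) (Suc n) (trunc (Suc n) j) g = g"
    by (simp add: True trunc_self cubical_set_id[OF cub g])
  have "cface X p i \<epsilon> (h j) = cface X p i \<epsilon> (cface X n (Suc n) (id_end n) g)"
    if n: "n = Suc p" and i: "1 \<le> i" "i \<le> n" for p i \<epsilon>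
  proof -
    have "cface X p i \<epsilon> (h j) = cface X p n (id_end n) (a i \<epsilon>)"
      using face_family_eq[OF a[unfolded n] i(1), of "Suc n" \<epsilon> "id_end n"] i n by (simp add: h)
    also have "a i \<epsilon> = cface X n i \<epsilon> g" using c i by (simp add: chain_def)
    also have "cface X p n (id_end n) (cface X n i \<epsilon> g) = cface X p i \<epsilon> (cface X n (Suc n) (id_end n) g)"
      using cface_swap[of g p i] i n g by simp
    finally show ?thesis .
  qed
  moreover have "h j \<in> cells X n" unfolding h by (rule face_family_cell[OF a]) auto
  ultimately show ?thesis unfolding T by blast
next
  case False
  then have j': "1 \<le> Suc j" "Suc j \<le> Suc n" using j by auto
  define G where "G = act X (Suc (Suc n)) (Suc n) (contract (Suc n) (Suc j)) g"
  define B where "B = cface X (Suc n) (Suc n) (id_end n) G"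
  have g: "g \<in> cells X (Suc n)" using c by (simp add: chain_def)
  have G: "G \<in> cells X (Suc (Suc n))" unfolding G_def by (rule contract_in[OF j' g])
  have B: "B \<in> cells X (Suc n)" unfolding B_def by (rule cface_cell[OF cub _ _ G]) auto
  have M: "M (Suc j) \<in> cells X (Suc n)" and Mh: "cface X n (Suc n) False (M (Suc j)) = h j"
    and Mi: "\<And>i \<epsilon>. 1 \<le> i \<Longrightarrow> i \<le> n \<Longrightarrow> cface X n i \<epsilon> (M (Suc j)) = cface X n i \<epsilon> B"
    using c j' unfolding chain_def G_def B_def by auto
  have "h j \<in> cells X n" unfolding Mh[symmetric] by (rule cface_cell[OF cub _ _ M]) auto
  moreover have "cface X p i \<epsilon> (h j) =
    cface X p i \<epsilon> (cface X n (Suc n) (id_end n) (act X (Suc n) (Suc n) (trunc (Suc n) j) g))"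
    if n: "n = Suc p" and i: "1 \<le> i" "i \<le> n" for p i \<epsilon>
  proof -
    have "cface X p i \<epsilon> (h j) = cface X p n False (cface X n i \<epsilon> (M (Suc j)))"
      unfolding Mh[symmetric] using cface_swap[of "M (Suc j)" p i] M n i by simp
    also have "\<dots> = cface X p i \<epsilon> (cface X n (Suc n) False B)"
      unfolding Mi[OF i] using cface_swap[of B p i] B n i by simp
    also have "cface X n (Suc n) False B = cface X n (Suc n) (id_end n) (act X (Suc n) (Suc n) (trunc (Suc n) j) g)"
      unfolding B_def G_def by (subst cface_contract_face[OF j' g]) simp
    finally show ?thesis .
  qed
  ultimately show ?thesis by blast
qed

text \<open>Truncation to stage 0 makes the cube constant at the base point, and \<open>h 0\<close>
  has the boundary of a face of it.\<close>

lemma chain_spherical: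
  assumes a: "pointed_family n a" and c: "chain n a g h M"
  shows "spherical n (h 0)"
proof -
  have af: "face_family X n UNIV a" using a by (simp add: pointed_family_def)
  have g: "g \<in> cells X (Suc n)" using c by (simp add: chain_def)
  have "cface X p i \<epsilon> (h 0) = const_cell X x p" if "n = Suc p" "1 \<le> i" "i \<le> n" for p i \<epsilon>
    using chain_bdry[OF af c, of 0] that trunc_0_const[OF g chain_zero[OF a c]]
    by (simp add: cface_const)
  then show ?thesis using chain_bdry[OF af c, of 0] by (simp add: spherical_def)
qed

text \<open>The stages are constructed from \<open>n + 1\<close> downwards. Each is a filling of the
  box whose end 1 is the cube reached so far, whose sides come from the contraction of
  \<open>g\<close>, and whose end 0 is left open.\<close>

lemma chain_exists:
  assumes a: "pointed_family n a"
  obtains g h M where "chain n a g h M"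
proof -
  have af: "face_family X n UNIV a" using a by (simp add: pointed_family_def)
  have af': "face_family X n (UNIV - {(Suc n, id_end n)}) a"
    using af by (auto simp: face_family_def)
  obtain g where g: "g \<in> cells X (Suc n)"
    and gi: "\<And>i \<epsilon>. 1 \<le> i \<Longrightarrow> i \<le> Suc n \<Longrightarrow> (i, \<epsilon>) \<noteq> (Suc n, id_end n) \<Longrightarrow> cface X n i \<epsilon> g = a i \<epsilon>"
    using kan_fill[OF kan _ _ af'] by auto
  define B where "B j = cface X (Suc n) (Suc n) (id_end n) (act X (Suc (Suc n)) (Suc n) (contract (Suc n) j) g)" for j
  define T where "T j = cface X n (Suc n) (id_end n) (act X (Suc n) (Suc n) (trunc (Suc n) j) g)" for j
  have B: "B j \<in> cells X (Suc n)" if "1 \<le> j" "j \<le> Suc n" for j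
    unfolding B_def by (rule cface_cell[OF cub _ _ contract_in[OF that g]]) auto
  have BT: "cface X n (Suc n) \<epsilon> (B j) = T (if \<epsilon> then j else j - 1)" if "1 \<le> j" "j \<le> Suc n" for j \<epsilon>
    unfolding B_def T_def by (rule cface_contract_face[OF that g])
  \<comment> \<open>The invariant carried down: sharing its boundary with \<open>T j\<close> is what
    lets \<open>u\<close> replace the end 1 of \<open>B j\<close>.\<close>
  define Q where "Q j u \<longleftrightarrow> u \<in> cells X n \<and>
    (\<forall>p i \<epsilon>. n = Suc p \<longrightarrow> 1 \<le> i \<longrightarrow> i \<le> n \<longrightarrow> cface X p i \<epsilon> u = cface X p i \<epsilon> (T j))" for j u
  define step where "step j m u u' \<longleftrightarrow> m \<in> cells X (Suc n) \<and> cface X n (Suc n) True m = u \<and>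
    cface X n (Suc n) False m = u' \<and> (\<forall>i \<epsilon>. 1 \<le> i \<longrightarrow> i \<le> n \<longrightarrow> cface X n i \<epsilon> m = cface X n i \<epsilon> (B j))"
    for j m u u'
  have ex_step: "\<exists>m u'. step (Suc k) m u u' \<and> Q k u'" if u: "Q (Suc k) u" and k: "k \<le> n" for k u
  proof -
    have k': "1 \<le> Suc k" "Suc k \<le> Suc n" using k by auto
    have "face_family X n (UNIV - {(Suc n, False)})
        (\<lambda>i \<epsilon>. if i = Suc n \<and> \<epsilon> = True then u else cface X n i \<epsilon> (B (Suc k)))"
      by (rule face_family_replace[OF cub B[OF k']])
         (use u BT[OF k', of True] in \<open>auto simp: Q_def\<close>)
    from kan_fill[OF kan _ _ this] obtain m where m: "m \<in> cells X (Suc n)"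
      "\<And>i \<epsilon>. 1 \<le> i \<Longrightarrow> i \<le> Suc n \<Longrightarrow> (i, \<epsilon>) \<noteq> (Suc n, False) \<Longrightarrow>
        cface X n i \<epsilon> m = (if i = Suc n \<and> \<epsilon> = True then u else cface X n i \<epsilon> (B (Suc k)))"
      by auto
    \<comment> \<open>The boundary of the new end lies on the prescribed sides, hence agrees with
      that of the end 0 of \<open>B (Suc k)\<close>.\<close>
    have "cface X p i \<epsilon> (cface X n (Suc n) False m) = cface X p i \<epsilon> (T k)"
      if n: "n = Suc p" and i: "1 \<le> i" "i \<le> n" for p i \<epsilon>
    proof -
      have "cface X p i \<epsilon> (cface X n (Suc n) False m) = cface X p n False (cface X n i \<epsilon> m)"
        using cface_swap[of m p i] m(1) n i by simp
      also have "\<dots> = cface X p i \<epsilon> (cface X n (Suc n) False (B (Suc k)))"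
        using cface_swap[of "B (Suc k)" p i] m(2)[of i \<epsilon>] B[OF k'] n i by simp
      finally show ?thesis using BT[OF k', of False] by simp
    qed
    then have "Q k (cface X n (Suc n) False m)" using cface_cell[OF cub _ _ m(1)] by (simp add: Q_def)
    moreover have "step (Suc k) m u (cface X n (Suc n) False m)" using m by (simp add: step_def)
    ultimately show ?thesis by blast
  qed
  \<comment> \<open>The remaining faces of \<open>a\<close> and of \<open>g\<close> have the same
    boundary because all other faces coincide.\<close>
  have "Q (Suc n) (a (Suc n) (id_end n))"
  proof -
    have "cface X p i \<epsilon> (a (Suc n) (id_end n)) = cface X p i \<epsilon> (cface X n (Suc n) (id_end n) g)"
      if n: "n = Suc p" and i: "1 \<le> i" "i \<le> n" for p i \<epsilon>
    proof -
      have "cface X p i \<epsilon> (a (Suc n) (id_end n)) = cface X p n (id_end n) (a i \<epsilon>)"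
        using face_family_eq[OF af[unfolded n] i(1), of "Suc n" \<epsilon> "id_end n"] i n by simp
      also have "\<dots> = cface X p i \<epsilon> (cface X n (Suc n) (id_end n) g)"
        using cface_swap[of g p i] gi[of i \<epsilon>] i n g by simp
      finally show ?thesis .
    qed
    then show ?thesis
      using face_family_cell[OF af, of "Suc n" "id_end n"]
      unfolding Q_def T_def trunc_self cubical_set_id[OF cub g] by auto
  qed
  have "\<exists>h M. h (Suc n) = a (Suc n) (id_end n) \<and> Q k (h k) \<and>
      (\<forall>j. k < j \<longrightarrow> j \<le> Suc n \<longrightarrow> step j (M j) (h j) (h (j - 1)))" if "k \<le> Suc n" for k
    using that
  proof (induction rule: inc_induct)
    case base
    show ?case
      by (rule exI[of _ "\<lambda>_. a (Suc n) (id_end n)"]) (use \<open>Q (Suc n) _\<close> in auto)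
  next
    case (step k)
    then obtain h M where h: "h (Suc n) = a (Suc n) (id_end n)" "Q (Suc k) (h (Suc k))"
      "\<And>j. Suc k < j \<Longrightarrow> j \<le> Suc n \<Longrightarrow> step j (M j) (h j) (h (j - 1))" by blast
    obtain m u' where mu: "step (Suc k) m (h (Suc k)) u'" "Q k u'"
      using ex_step[OF h(2)] step.hyps by auto
    have "step j ((M(Suc k := m)) j) ((h(k := u')) j) ((h(k := u')) (j - 1))" if "k < j" "j \<le> Suc n" for j
      using that mu(1) h(3)[of j] by (cases "j = Suc k") auto
    then show ?case
      using mu(2) h(1) step.hyps
      by (intro exI[of _ "h(k := u')"] exI[of _ "M(Suc k := m)"]) auto
  qed
  from this[of 0] obtain h M where h: "h (Suc n) = a (Suc n) (id_end n)"
    "\<And>j. 0 < j \<Longrightarrow> j \<le> Suc n \<Longrightarrow> step j (M j) (h j) (h (j - 1))" by auto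
  have "chain n a g h M"
    unfolding chain_def using g gi h(1) h(2)[unfolded step_def B_def] by auto
  then show ?thesis by (rule that)
qed

section \<open>Chains that need no filling: caps and filled boundaries\<close>

lemma cface_degen:
  assumes "w \<in> cells X (Suc p)" "1 \<le> i" "i \<le> Suc p"
  shows "cface X (Suc p) i \<epsilon> (act X (Suc (Suc p)) (Suc p) (degeneracy (Suc p) (Suc (Suc p))) w) =
    act X (Suc p) p (degeneracy p (Suc p)) (cface X p i \<epsilon> w)"
proof -
  have "cface X (Suc p) i \<epsilon> (act X (Suc (Suc p)) (Suc p) (degeneracy (Suc p) (Suc (Suc p))) w) =
      act X (Suc p) (Suc p) (compose (verts (Suc p)) (degeneracy (Suc p) (Suc (Suc p))) (face (Suc p) i \<epsilon>)) w"
    using assms by (intro cface_act[OF cub _ _ degeneracy_hom]) auto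
  also have "compose (verts (Suc p)) (degeneracy (Suc p) (Suc (Suc p))) (face (Suc p) i \<epsilon>) =
      compose (verts (Suc p)) (face p i \<epsilon>) (degeneracy p (Suc p))"
    using degeneracy_face_less[of i "Suc (Suc p)" p \<epsilon>] assms by simp
  also have "act X (Suc p) (Suc p) \<dots> w = act X (Suc p) p (degeneracy p (Suc p)) (cface X p i \<epsilon> w)"
    using assms by (intro act_cface[symmetric, OF cub]) (auto intro: degeneracy_hom)
  finally show ?thesis .
qed

lemma degen_in: "w \<in> cells X n \<Longrightarrow> act X (Suc n) n (degeneracy n (Suc n)) w \<in> cells X (Suc n)"
  by (rule cubical_set_act[OF cub degeneracy_hom]) auto

lemma cface_degen_last:
  assumes "w \<in> cells X n"
  shows "cface X n (Suc n) \<epsilon> (act X (Suc n) n (degeneracy n (Suc n)) w) = w"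
  using cface_act[OF cub _ _ degeneracy_hom, of "Suc n" n "Suc n" w \<epsilon>] assms
    degeneracy_face_same[of "Suc n" n \<epsilon>] cubical_set_id[OF cub assms] by simp

text \<open>A cap is constant on \<open>A\<close>, so the constant cube serves as \<open>g\<close>
  and the degenerate cube on \<open>w\<close> as every \<open>M j\<close>. Hence a cap reduces to
  the cube it came from.\<close>

lemma chain_cap:
  assumes w: "spherical n w"
  shows "chain n (cap_family n w) (const_cell X x (Suc n)) (\<lambda>_. w)
    (\<lambda>_. act X (Suc n) n (degeneracy n (Suc n)) w)"
proof -
  have wn: "w \<in> cells X n" using w by (simp add: spherical_def)
  have "cface X n i \<epsilon> (act X (Suc n) n (degeneracy n (Suc n)) w) = const_cell X x n"
    if i: "1 \<le> i" "i \<le> n" for i \<epsilon>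
  proof -
    obtain p where n: "n = Suc p" using i by (cases n) auto
    show ?thesis
      using cface_degen[of w p i \<epsilon>] act_const[OF degeneracy_hom, of "Suc p" p] w i
      by (simp add: n spherical_def)
  qed
  moreover have "act X (Suc (Suc n)) (Suc n) (contract (Suc n) j) (const_cell X x (Suc n)) =
      const_cell X x (Suc (Suc n))" if "1 \<le> j" "j \<le> Suc n" for j
    by (rule act_const[OF contract_hom[OF that]])
  ultimately show ?thesis
    unfolding chain_def cap_family_def
    using const_in degen_in[OF wn] cface_degen_last[OF wn] by (auto simp: cface_const)
qed

text \<open>When \<open>g\<close> fills all of \<open>a\<close>, the remaining face of its
  contraction is itself a deformation of the remaining face of \<open>a\<close>, and it ends at the
  constant cube.\<close>

lemma chain_filler:
  assumes a: "pointed_family n a" and c: "c \<in> cells X (Suc n)"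
    and ca: "\<And>i \<epsilon>. 1 \<le> i \<Longrightarrow> i \<le> Suc n \<Longrightarrow> cface X n i \<epsilon> c = a i \<epsilon>"
  obtains h M where "chain n a c h M" "h 0 = const_cell X x n"
proof -
  define h where "h j = cface X n (Suc n) (id_end n) (act X (Suc n) (Suc n) (trunc (Suc n) j) c)" for j
  define M where "M j = cface X (Suc n) (Suc n) (id_end n) (act X (Suc (Suc n)) (Suc n) (contract (Suc n) j) c)" for j
  have "M j \<in> cells X (Suc n)" if "1 \<le> j" "j \<le> Suc n" for j
    unfolding M_def by (rule cface_cell[OF cub _ _ contract_in[OF that c]]) auto
  moreover have "cface X n (Suc n) \<epsilon> (M j) = h (if \<epsilon> then j else j - 1)" if "1 \<le> j" "j \<le> Suc n" for j \<epsilon>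
    unfolding M_def h_def by (rule cface_contract_face[OF that c])
  moreover have "h (Suc n) = a (Suc n) (id_end n)"
    by (simp add: h_def trunc_self cubical_set_id[OF cub c] ca)
  ultimately have ch: "chain n a c h M"
    unfolding chain_def using c ca M_def by auto
  show ?thesis
    by (rule that[OF ch]) (simp add: h_def trunc_0_const[OF c chain_zero[OF a ch]] cface_const)
qed

text \<open>Stage \<open>j\<close> of the deformation: \<open>A\<close> moves with the truncations
  of \<open>g\<close> and the remaining face with \<open>h\<close>. For a chain of a pointed family
  \<open>a\<close>, stage \<open>n + 1\<close> is \<open>a\<close> and stage 0 is the cap of
  \<open>h 0\<close>.\<close>

definition chain_family :: "nat \<Rightarrow> 'a \<Rightarrow> (nat \<Rightarrow> 'a) \<Rightarrow> nat \<Rightarrow> nat \<Rightarrow> bool \<Rightarrow> 'a" where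
  "chain_family n g h j i \<epsilon> = (if i = Suc n \<and> \<epsilon> = id_end n then h j
     else cface X n i \<epsilon> (act X (Suc n) (Suc n) (trunc (Suc n) j) g))"

lemma trunc_zero: "j \<le> n \<Longrightarrow> trunc n j (replicate n False) = replicate n False"
  by (simp add: trunc_app min_def flip: replicate_add)

lemma chain_family_pointed:
  assumes a: "pointed_family n a" and c: "chain n a g h M" and j: "j \<le> Suc n"
  shows "pointed_family n (chain_family n g h j)"
proof -
  have af: "face_family X n UNIV a" using a by (simp add: pointed_family_def)
  have g: "g \<in> cells X (Suc n)" using c by (simp add: chain_def)
  let ?T = "act X (Suc n) (Suc n) (trunc (Suc n) j) g"
  have T: "?T \<in> cells X (Suc n)" by (rule trunc_in[OF j g])
  have h: "h j \<in> cells X n" and hb: "\<And>p i \<epsilon>. n = Suc p \<Longrightarrow> 1 \<le> i \<Longrightarrow> i \<le> n \<Longrightarrow>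
      cface X p i \<epsilon> (h j) = cface X p i \<epsilon> (cface X n (Suc n) (id_end n) ?T)"
    using chain_bdry[OF af c j] by blast+
  have fam: "face_family X n UNIV (chain_family n g h j)"
    unfolding chain_family_def
    by (rule face_family_replace[OF cub T _ _ h]) (use hb in auto)
  have z: "compose (verts 0) (trunc (Suc n) j) (zero_vertex (Suc n)) = zero_vertex (Suc n)"
    using trunc_zero[OF j] by (auto simp: compose_def zero_vertex_def verts_def fun_eq_iff)
  have "act X 0 n (zero_vertex n) (cface X n 1 False ?T) = act X 0 (Suc n) (zero_vertex (Suc n)) ?T"
    unfolding zero_vertex_Suc by (rule act_cface[OF cub _ _ zero_vertex_hom T]) auto
  also have "\<dots> = x"
    using cubical_set_comp[OF cub zero_vertex_hom trunc_hom[OF j] g] chain_zero[OF a c] by (simp add: z)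
  finally show ?thesis using fam id_end_ne[of n] by (auto simp: pointed_family_def chain_family_def)
qed

text \<open>The contracted cube supplies the sides of the cylinder except over the remaining face,
  where \<open>M j\<close> takes over. The ends of \<open>M j\<close> may differ from those of the
  contracted cube, as the matching conditions concern the sides only.\<close>

lemma chain_family_homotopy:
  assumes a: "pointed_family n a" and c: "chain n a g h M" and j: "1 \<le> j" "j \<le> Suc n"
  shows "bdry_homotopy X x n (chain_family n g h (j - 1)) (chain_family n g h j)
    (\<lambda>i \<epsilon>. if i = Suc n \<and> \<epsilon> = id_end n then M j
      else cface X (Suc n) i \<epsilon> (act X (Suc (Suc n)) (Suc n) (contract (Suc n) j) g))"
    (is "bdry_homotopy X x n _ _ ?H")
proof -
  let ?G = "act X (Suc (Suc n)) (Suc n) (contract (Suc n) j) g"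
  have g: "g \<in> cells X (Suc n)" and M: "M j \<in> cells X (Suc n)"
    and M1: "cface X n (Suc n) True (M j) = h j" and M0: "cface X n (Suc n) False (M j) = h (j - 1)"
    and Mi: "\<And>i \<epsilon>. 1 \<le> i \<Longrightarrow> i \<le> n \<Longrightarrow> cface X n i \<epsilon> (M j) = cface X n i \<epsilon> (cface X (Suc n) (Suc n) (id_end n) ?G)"
    using c j by (auto simp: chain_def)
  have G: "?G \<in> cells X (Suc (Suc n))" by (rule contract_in[OF j g])
  have ends: "cface X n (Suc n) \<delta> (?H i \<epsilon>) = chain_family n g h (if \<delta> then j else j - 1) i \<epsilon>"
    if "1 \<le> i" "i \<le> Suc n" for i \<epsilon> \<delta>
    using cface_swap[OF G that, of \<epsilon> \<delta>] cface_contract[OF j g, of \<delta>] M0 M1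
    by (auto simp: chain_family_def)
  have "act X 1 (Suc n) (zero_edge n) (cface X (Suc n) 1 False ?G) = const_cell X x 1"
  proof -
    have ze: "zero_edge (Suc n) = compose (verts 1) (face (Suc n) 1 False) (zero_edge n)"
      using tensor_face_left[OF zero_vertex_hom[of n] cube_hom_id[of 1], of 1 False]
      by (simp add: zero_edge_def zero_vertex_Suc)
    have "act X 1 (Suc n) (zero_edge n) (cface X (Suc n) 1 False ?G) = act X 1 (Suc (Suc n)) (zero_edge (Suc n)) ?G"
      unfolding ze by (rule act_cface[OF cub _ _ zero_edge_hom G]) auto
    also have "\<dots> = act X 1 (Suc n) (compose (verts 1) (contract (Suc n) j) (zero_edge (Suc n))) g"
      by (rule cubical_set_comp[OF cub zero_edge_hom contract_hom[OF j] g])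
    also have "\<dots> = act X 1 0 (terminal_map 1) (act X 0 (Suc n) (zero_vertex (Suc n)) g)"
      unfolding contract_zero_edge[OF j]
      by (rule cubical_set_comp[symmetric, OF cub terminal_map_hom zero_vertex_hom g])
    finally show ?thesis by (simp add: chain_zero[OF a c] const_cell_def)
  qed
  moreover have "face_family X (Suc n) {(i, \<epsilon>). i \<le> Suc n} ?H"
    by (rule face_family_replace[OF cub G _ _ M]) (use Mi in auto)
  ultimately show ?thesis
    unfolding bdry_homotopy_def using ends[where \<delta> = False] ends[where \<delta> = True] id_end_ne[of n] by auto
qed

text \<open>The construction of a chain, one dimension higher. An open box gives a cube
  \<open>K\<close> with \<open>g\<close> and \<open>g'\<close> at its ends and the homotopy over
  \<open>A\<close>. The positions of \<open>K\<close> are contracted, and boxes with the given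
  \<open>M\<close> and \<open>M'\<close> at their ends carry the homotopy of the remaining face down
  to a path from \<open>h 0\<close> to \<open>h' 0\<close>.\<close>

lemma chain_homotopy:
  assumes a: "pointed_family n a" and c: "chain n a g h M"
    and a': "pointed_family n a'" and c': "chain n a' g' h' M'" and H: "bdry_homotopy X x n a a' H"
  obtains p where "rel_path n (h 0) (h' 0) p"
proof -
  let ?e = "id_end n"
  have Hf: "face_family X (Suc n) {(i, \<epsilon>). i \<le> Suc n} H"
    and H0: "\<And>i \<epsilon>. 1 \<le> i \<Longrightarrow> i \<le> Suc n \<Longrightarrow> cface X n (Suc n) False (H i \<epsilon>) = a i \<epsilon>"
    and H1: "\<And>i \<epsilon>. 1 \<le> i \<Longrightarrow> i \<le> Suc n \<Longrightarrow> cface X n (Suc n) True (H i \<epsilon>) = a' i \<epsilon>"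
    and Hx: "act X 1 (Suc n) (zero_edge n) (H 1 False) = const_cell X x 1"
    using H by (auto simp: bdry_homotopy_def)
  \<comment> \<open>The Boolean \<delta> selects an end of the homotopy, so that both chains are
    treated at once.\<close>
  define gg where "gg \<delta> = (if \<delta> then g' else g)" for \<delta>
  define hh where "hh \<delta> = (if \<delta> then h' else h)" for \<delta>
  define MM where "MM \<delta> = (if \<delta> then M' else M)" for \<delta>
  define aa where "aa \<delta> = (if \<delta> then a' else a)" for \<delta>
  have C: "chain n (aa \<delta>) (gg \<delta>) (hh \<delta>) (MM \<delta>)" for \<delta>
    using c c' by (simp add: aa_def gg_def hh_def MM_def)
  have HH: "cface X n (Suc n) \<delta> (H i \<epsilon>) = aa \<delta> i \<epsilon>" if "1 \<le> i" "i \<le> Suc n" for i \<epsilon> \<delta>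
    using H0[OF that] H1[OF that] by (simp add: aa_def)
  have gg: "gg \<delta> \<in> cells X (Suc n)" for \<delta> using C[of \<delta>] by (simp add: chain_def)
  \<comment> \<open>The omitted face is the cylinder over the remaining face, where \<open>H\<close>
    need not match \<open>g\<close> and \<open>g'\<close>.\<close>
  have "face_family X (Suc n) (UNIV - {(Suc n, ?e)}) (\<lambda>i \<epsilon>. if i = Suc (Suc n) then gg \<epsilon> else H i \<epsilon>)"
  proof (rule cylinder_family)
    show "face_family X (Suc n) {(i, \<epsilon>) \<in> UNIV - {(Suc n, ?e)}. i \<le> Suc n} H"
      using Hf by (auto simp: face_family_def)
    fix i \<epsilon> \<delta> assume "1 \<le> i" "i \<le> Suc n" "(i, \<epsilon>) \<in> UNIV - {(Suc n, ?e)}"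
    then show "cface X n (Suc n) \<delta> (H i \<epsilon>) = cface X n i \<epsilon> (gg \<delta>)"
      using HH[of i \<delta> \<epsilon>] C[of \<delta>] by (auto simp: chain_def)
  qed (rule gg)
  from kan_fill[OF kan _ _ this] obtain K where K: "K \<in> cells X (Suc (Suc n))"
    and Kf: "\<And>i \<epsilon>. 1 \<le> i \<Longrightarrow> i \<le> Suc (Suc n) \<Longrightarrow> (i, \<epsilon>) \<noteq> (Suc n, ?e) \<Longrightarrow>
      cface X (Suc n) i \<epsilon> K = (if i = Suc (Suc n) then gg \<epsilon> else H i \<epsilon>)"
    by auto
  define G where "G j = act X (Suc (Suc (Suc n))) (Suc (Suc n))
    (cube_tensor (Suc (Suc n)) 1 (contract (Suc n) j) (id_map 1)) K" for j
  define T where "T j = act X (Suc (Suc n)) (Suc (Suc n))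
    (cube_tensor (Suc n) 1 (trunc (Suc n) j) (id_map 1)) K" for j
  \<comment> \<open>The coordinates of \<open>G j\<close> are the positions up to
    \<open>n + 1\<close>, then the time, then the parameter of the homotopy. In \<open>B j\<close>
    the last position is fixed, so the time becomes coordinate \<open>n + 1\<close>.\<close>
  define B where "B j = cface X (Suc (Suc n)) (Suc n) ?e (G j)" for j
  have ct: "cube_tensor (Suc (Suc n)) 1 (contract (Suc n) j) (id_map 1) \<in> cube_hom (Suc (Suc (Suc n))) (Suc (Suc n))"
    if "1 \<le> j" "j \<le> Suc n" for j
    using cube_tensor_hom[OF contract_hom[OF that] cube_hom_id[of 1]] by simp
  have tt: "cube_tensor (Suc n) 1 (trunc (Suc n) j) (id_map 1) \<in> cube_hom (Suc (Suc n)) (Suc (Suc n))"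
    if "j \<le> Suc n" for j
    using cube_tensor_hom[OF trunc_hom[OF that] cube_hom_id[of 1]] by simp
  have G: "G j \<in> cells X (Suc (Suc (Suc n)))" if "1 \<le> j" "j \<le> Suc n" for j
    unfolding G_def by (rule cubical_set_act[OF cub ct[OF that] K])
  have T: "T j \<in> cells X (Suc (Suc n))" if "j \<le> Suc n" for j
    unfolding T_def by (rule cubical_set_act[OF cub tt[OF that] K])
  have B: "B j \<in> cells X (Suc (Suc n))" if "1 \<le> j" "j \<le> Suc n" for j
    unfolding B_def by (rule cface_cell[OF cub _ _ G[OF that]]) auto
  have G_end: "cface X (Suc (Suc n)) (Suc (Suc n)) \<epsilon> (G j) = T (if \<epsilon> then j else j - 1)"
    if "1 \<le> j" "j \<le> Suc n" for j \<epsilon>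
    unfolding G_def T_def
    by (subst cface_act[OF cub _ _ ct[OF that] K]) (use contract_tensor_end[OF that] in auto)
  have G_side: "cface X (Suc (Suc n)) (Suc (Suc (Suc n))) \<delta> (G j) =
      act X (Suc (Suc n)) (Suc n) (contract (Suc n) j) (gg \<delta>)" if j: "1 \<le> j" "j \<le> Suc n" for j \<delta>
  proof -
    have "cface X (Suc (Suc n)) (Suc (Suc (Suc n))) \<delta> (G j) = act X (Suc (Suc n)) (Suc (Suc n))
        (compose (verts (Suc (Suc n))) (face (Suc n) (Suc (Suc n)) \<delta>) (contract (Suc n) j)) K"
      unfolding G_def
      by (subst cface_act[OF cub _ _ ct[OF j] K]) (use contract_tensor_side[OF j] in auto)
    also have "\<dots> = act X (Suc (Suc n)) (Suc n) (contract (Suc n) j) (cface X (Suc n) (Suc (Suc n)) \<delta> K)"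
      by (rule act_cface[symmetric, OF cub _ _ contract_hom[OF j] K]) auto
    finally show ?thesis using Kf[of "Suc (Suc n)" \<delta>] by simp
  qed
  have B_end: "cface X (Suc n) (Suc n) \<epsilon> (B j) = cface X (Suc n) (Suc n) ?e (T (if \<epsilon> then j else j - 1))"
    if j: "1 \<le> j" "j \<le> Suc n" for j \<epsilon>
    unfolding B_def using cface_swap2[OF G[OF j], of "Suc n" ?e \<epsilon>] G_end[OF j, of \<epsilon>] by simp
  have B_side: "cface X (Suc n) (Suc (Suc n)) \<delta> (B j) =
      cface X (Suc n) (Suc n) ?e (act X (Suc (Suc n)) (Suc n) (contract (Suc n) j) (gg \<delta>))"
    if j: "1 \<le> j" "j \<le> Suc n" for j \<delta>
    unfolding B_def using cface_swap[OF G[OF j], of "Suc n" ?e \<delta>] G_side[OF j, of \<delta>] by simp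
  \<comment> \<open>The ends of \<open>u\<close> lie on the two given chains, its sides on the
    contracted cylinder. Once \<open>T 0\<close> is known to be constant, \<open>Q 0\<close> says
    that \<open>u\<close> is the path sought.\<close>
  define Q where "Q j u \<longleftrightarrow> u \<in> cells X (Suc n) \<and> (\<forall>\<delta>. cface X n (Suc n) \<delta> u = hh \<delta> j) \<and>
    (\<forall>i \<epsilon>. 1 \<le> i \<longrightarrow> i \<le> n \<longrightarrow> cface X n i \<epsilon> u = cface X n i \<epsilon> (cface X (Suc n) (Suc n) ?e (T j)))" for j u
  have step: "\<exists>u'. Q k u'" if u: "Q (Suc k) u" and k: "k \<le> n" for k u
  proof -
    have j: "1 \<le> Suc k" "Suc k \<le> Suc n" using k by auto
    have MM: "MM \<delta> (Suc k) \<in> cells X (Suc n)" and M1: "cface X n (Suc n) True (MM \<delta> (Suc k)) = hh \<delta> (Suc k)"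
      and M0: "cface X n (Suc n) False (MM \<delta> (Suc k)) = hh \<delta> k" for \<delta>
      using C[of \<delta>] j by (auto simp: chain_def)
    have Mi: "cface X n i \<epsilon> (MM \<delta> (Suc k)) = cface X n i \<epsilon> (cface X (Suc n) (Suc (Suc n)) \<delta> (B (Suc k)))"
      if "1 \<le> i" "i \<le> n" for i \<epsilon> \<delta>
      using C[of \<delta>] j that by (simp add: chain_def B_side[OF j])
    \<comment> \<open>The open box of dimension \<open>n + 2\<close> has \<open>u\<close> at time 1,
      nothing at time 0, faces of \<open>B (Suc k)\<close> in the position directions, and the cubes
      \<open>MM\<close> at the two ends of the homotopy.\<close>
    let ?h = "\<lambda>i \<epsilon>. if i = Suc n \<and> \<epsilon> = True then u else cface X (Suc n) i \<epsilon> (B (Suc k))"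
    let ?S = "UNIV - {(Suc n, False)}"
    have "face_family X (Suc n) {(i, \<epsilon>) \<in> ?S. i \<le> Suc n} ?h"
      by (rule face_family_replace[OF cub B[OF j]])
         (use u B_end[OF j, of True] in \<open>auto simp: Q_def\<close>)
    then have "face_family X (Suc n) ?S (\<lambda>i \<epsilon>. if i = Suc (Suc n) then MM \<epsilon> (Suc k) else ?h i \<epsilon>)"
    proof (rule cylinder_family)
      fix i \<epsilon> \<delta> assume i: "1 \<le> i" "i \<le> Suc n" "(i, \<epsilon>) \<in> ?S"
      show "cface X n (Suc n) \<delta> (?h i \<epsilon>) = cface X n i \<epsilon> (MM \<delta> (Suc k))"
      proof (cases "i = Suc n")
        case True
        then show ?thesis using i u M1 by (auto simp: Q_def)
      next
        case False
        then show ?thesis using i Mi[of i \<epsilon> \<delta>] cface_swap[OF B[OF j] i(1,2), of \<epsilon> \<delta>] by simp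
      qed
    qed (rule MM)
    from kan_fill[OF kan _ _ this] obtain m where m: "m \<in> cells X (Suc (Suc n))"
      and mf: "\<And>i \<epsilon>. 1 \<le> i \<Longrightarrow> i \<le> Suc (Suc n) \<Longrightarrow> (i, \<epsilon>) \<noteq> (Suc n, False) \<Longrightarrow>
        cface X (Suc n) i \<epsilon> m = (if i = Suc (Suc n) then MM \<epsilon> (Suc k) else ?h i \<epsilon>)"
      by auto
    have "cface X (Suc n) (Suc n) False m \<in> cells X (Suc n)" by (rule cface_cell[OF cub _ _ m]) auto
    moreover have "cface X n (Suc n) \<delta> (cface X (Suc n) (Suc n) False m) = hh \<delta> k" for \<delta>
      using cface_swap[OF m, of "Suc n" False \<delta>] mf[of "Suc (Suc n)" \<delta>] M0[of \<delta>] by simp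
    moreover have "cface X n i \<epsilon> (cface X (Suc n) (Suc n) False m) =
        cface X n i \<epsilon> (cface X (Suc n) (Suc n) ?e (T k))" if i: "1 \<le> i" "i \<le> n" for i \<epsilon>
    proof -
      have "cface X n i \<epsilon> (cface X (Suc n) (Suc n) False m) = cface X n n False (cface X (Suc n) i \<epsilon> (B (Suc k)))"
        using cface_swap2[OF m i, of \<epsilon> False] mf[of i \<epsilon>] i by simp
      also have "\<dots> = cface X n i \<epsilon> (cface X (Suc n) (Suc n) False (B (Suc k)))"
        by (rule cface_swap2[OF B[OF j] i, symmetric])
      finally show ?thesis using B_end[OF j, of False] by simp
    qed
    ultimately show ?thesis by (auto simp: Q_def)
  qed
  have top: "Q (Suc n) (H (Suc n) ?e)"
  proof -
    have TK: "T (Suc n) = K"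
      using cubical_set_id[OF cub K] tensor_id_id[of "Suc n" 1] by (simp add: T_def trunc_self)
    have "cface X n i \<epsilon> (H (Suc n) ?e) = cface X n i \<epsilon> (cface X (Suc n) (Suc n) ?e K)"
      if i: "1 \<le> i" "i \<le> n" for i \<epsilon>
    proof -
      have "cface X n i \<epsilon> (H (Suc n) ?e) = cface X n n ?e (H i \<epsilon>)"
        using face_family_eq[OF Hf i(1), of "Suc n" \<epsilon> ?e] i by simp
      then show ?thesis using cface_swap2[OF K i, of \<epsilon> ?e] Kf[of i \<epsilon>] i by simp
    qed
    moreover have "cface X n (Suc n) \<delta> (H (Suc n) ?e) = hh \<delta> (Suc n)" for \<delta>
      using HH[of "Suc n" \<delta> ?e] C[of \<delta>] by (simp add: chain_def)
    moreover have "H (Suc n) ?e \<in> cells X (Suc n)" using face_family_cell[OF Hf, of "Suc n" ?e] by simp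
    ultimately show ?thesis unfolding Q_def TK by blast
  qed
  have "\<exists>u. Q k u" if "k \<le> Suc n" for k
    using that by (induction rule: inc_induct) (use top step in \<open>auto simp: less_Suc_eq_le\<close>)
  from this[of 0] obtain p where p: "Q 0 p" by auto
  \<comment> \<open>Here the homotopy has to be pointed: constancy on the zero edge becomes
    constancy of the whole contracted cylinder.\<close>
  have T0: "T 0 = const_cell X x (Suc (Suc n))"
  proof -
    have pr: "cube_tensor (Suc n) 1 (terminal_map (Suc n)) (id_map 1) \<in> cube_hom (Suc (Suc n)) 1"
      using cube_tensor_hom[OF terminal_map_hom[of "Suc n"] cube_hom_id[of 1]] by simp
    have ze: "zero_edge (Suc n) = compose (verts 1) (face (Suc n) 1 False) (zero_edge n)"
      using tensor_face_left[OF zero_vertex_hom[of n] cube_hom_id[of 1], of 1 False]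
      by (simp add: zero_edge_def zero_vertex_Suc)
    have "act X 1 (Suc (Suc n)) (zero_edge (Suc n)) K = act X 1 (Suc n) (zero_edge n) (cface X (Suc n) 1 False K)"
      unfolding ze by (rule act_cface[symmetric, OF cub _ _ zero_edge_hom K]) auto
    also have "cface X (Suc n) 1 False K = H 1 False" using Kf[of 1 False] id_end_ne[of n] by auto
    finally have "act X 1 (Suc (Suc n)) (zero_edge (Suc n)) K = const_cell X x 1" using Hx by simp
    then show ?thesis
      unfolding T_def trunc_0_tensor cubical_set_comp[OF cub pr zero_edge_hom K, symmetric]
      using act_const[OF pr] by simp
  qed
  have "rel_path n (h 0) (h' 0) p"
    using p by (auto simp: rel_path_def Q_def T0 cface_const hh_def)
  then show ?thesis by (rule that)
qed

section \<open>Homotopies of caps, constant homotopies and transport of fillers\<close>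

lemma cap_family_pointed:
  assumes "spherical n w"
  shows "pointed_family n (cap_family n w)"
proof -
  have "face_family X n UNIV (\<lambda>i \<epsilon>. if i = Suc n \<and> \<epsilon> = id_end n then w else cface X n i \<epsilon> (const_cell X x (Suc n)))"
    by (rule face_family_replace[OF cub const_in]) (use assms in \<open>auto simp: spherical_def cface_const\<close>)
  then have "face_family X n UNIV (cap_family n w)"
    by (rule face_family_cong) (auto simp: cap_family_def cface_const)
  moreover have "cap_family n w 1 False = const_cell X x n"
    using id_end_ne[of n] by (auto simp: cap_family_def)
  ultimately show ?thesis
    using act_const[OF zero_vertex_hom] const_cell_0[OF cub point] by (simp add: pointed_family_def)
qed

text \<open>The sides of \<open>p\<close> are constant, so it fits into the constant cylinder in
  place of the side over the remaining face.\<close>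

lemma rel_path_homotopy:
  assumes p: "rel_path n w w' p"
  shows "bdry_homotopy X x n (cap_family n w) (cap_family n w')
    (\<lambda>i \<epsilon>. if i = Suc n \<and> \<epsilon> = id_end n then p else const_cell X x (Suc n))"
proof -
  have "face_family X (Suc n) {(i, \<epsilon>). i \<le> Suc n}
      (\<lambda>i \<epsilon>. if i = Suc n \<and> \<epsilon> = id_end n then p else cface X (Suc n) i \<epsilon> (const_cell X x (Suc (Suc n))))"
    by (rule face_family_replace[OF cub const_in]) (use p in \<open>auto simp: rel_path_def cface_const\<close>)
  then have "face_family X (Suc n) {(i, \<epsilon>). i \<le> Suc n}
      (\<lambda>i \<epsilon>. if i = Suc n \<and> \<epsilon> = id_end n then p else const_cell X x (Suc n))"
    by (rule face_family_cong) (auto simp: cface_const)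
  then show ?thesis
    using p id_end_ne[of n] act_const[OF zero_edge_hom[of n]]
    by (auto simp: bdry_homotopy_def cap_family_def rel_path_def cface_const)
qed

text \<open>The constant homotopy serves to compare two reductions of one and the same map.\<close>

lemma homotopy_refl:
  assumes a: "pointed_family n a"
  shows "bdry_homotopy X x n a a (\<lambda>i \<epsilon>. act X (Suc n) n (degeneracy n (Suc n)) (a i \<epsilon>))"
proof -
  have af: "face_family X n UNIV a" using a by (simp add: pointed_family_def)
  have cell: "a i \<epsilon> \<in> cells X n" if "1 \<le> i" "i \<le> Suc n" for i \<epsilon>
    using face_family_cell[OF af that] by simp
  have "face_family X (Suc n) {(i, \<epsilon>). i \<le> Suc n} (\<lambda>i \<epsilon>. act X (Suc n) n (degeneracy n (Suc n)) (a i \<epsilon>))"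
  proof (rule face_familyI)
    fix q i j and \<epsilon> \<eta> :: bool
    assume "Suc n = Suc q" and i: "1 \<le> i" and ij: "i < j" and "(j, \<eta>) \<in> {(i, \<epsilon>). i \<le> Suc n}"
    then have q: "q = n" and j: "j \<le> Suc n" by auto
    obtain p where n: "n = Suc p" using i ij j by (cases n) auto
    show "cface X q i \<epsilon> (act X (Suc n) n (degeneracy n (Suc n)) (a j \<eta>)) =
        cface X q (j - 1) \<eta> (act X (Suc n) n (degeneracy n (Suc n)) (a i \<epsilon>))"
      using cface_degen[of "a j \<eta>" p i \<epsilon>] cface_degen[of "a i \<epsilon>" p "j - 1" \<eta>] i ij j
        cell[of i \<epsilon>] cell[of j \<eta>] face_family_eq[OF af[unfolded n] i ij, of \<epsilon> \<eta>]
      by (simp add: q n)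
  qed (use degen_in cell in auto)
  moreover have "act X 1 (Suc n) (zero_edge n) (act X (Suc n) n (degeneracy n (Suc n)) (a 1 False)) = const_cell X x 1"
  proof -
    have d: "degeneracy n (Suc n) \<in> cube_hom (Suc n) n" by (intro degeneracy_hom) auto
    have "compose (verts 1) (degeneracy n (Suc n)) (zero_edge n) = compose (verts 1) (zero_vertex n) (terminal_map 1)"
      by (rule cube_hom_eqI[OF cube_hom_comp[OF zero_edge_hom d] cube_hom_comp[OF terminal_map_hom zero_vertex_hom]])
         (simp add: app_simps zero_edge_def)
    then have "act X 1 (Suc n) (zero_edge n) (act X (Suc n) n (degeneracy n (Suc n)) (a 1 False)) =
        act X 1 0 (terminal_map 1) (act X 0 n (zero_vertex n) (a 1 False))"
      using cubical_set_comp[OF cub zero_edge_hom d cell[of 1 False]]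
        cubical_set_comp[OF cub terminal_map_hom[of 1] zero_vertex_hom cell[of 1 False]] by simp
    then show ?thesis using a by (simp add: pointed_family_def const_cell_def)
  qed
  ultimately show ?thesis
    using cface_degen_last[OF cell] by (auto simp: bdry_homotopy_def)
qed

text \<open>The cube \<open>c\<close> at one end and the homotopy on the sides form an open box, and
  the missing end of its filling is the required cube. The Boolean \<delta> is the end at which
  \<open>c\<close> sits; it takes the place of reversing the homotopy.\<close>

lemma homotopy_filler:
  assumes H: "bdry_homotopy X x n a b H"
    and c: "c \<in> cells X (Suc n)"
    and ca: "\<And>i \<epsilon>. 1 \<le> i \<Longrightarrow> i \<le> Suc n \<Longrightarrow> cface X n i \<epsilon> c = (if \<delta> then b else a) i \<epsilon>"
  shows "\<exists>c'\<in>cells X (Suc n). \<forall>i \<epsilon>. 1 \<le> i \<longrightarrow> i \<le> Suc n \<longrightarrow> cface X n i \<epsilon> c' = (if \<delta> then a else b) i \<epsilon>"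
proof -
  have Hf: "face_family X (Suc n) {(i, \<epsilon>). i \<le> Suc n} H"
    and HH: "\<And>i \<epsilon> \<delta>. 1 \<le> i \<Longrightarrow> i \<le> Suc n \<Longrightarrow> cface X n (Suc n) \<delta> (H i \<epsilon>) = (if \<delta> then b else a) i \<epsilon>"
    using H by (auto simp: bdry_homotopy_def)
  have "face_family X (Suc n) (UNIV - {(Suc (Suc n), \<not> \<delta>)}) (\<lambda>i \<epsilon>. if i = Suc (Suc n) then c else H i \<epsilon>)"
  proof (rule cylinder_family)
    show "face_family X (Suc n) {(i, \<epsilon>) \<in> UNIV - {(Suc (Suc n), \<not> \<delta>)}. i \<le> Suc n} H"
      using Hf by (auto simp: face_family_def)
    fix i \<epsilon> \<eta> assume "1 \<le> i" "i \<le> Suc n" "(Suc (Suc n), \<eta>) \<in> UNIV - {(Suc (Suc n), \<not> \<delta>)}"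
    then show "cface X n (Suc n) \<eta> (H i \<epsilon>) = cface X n i \<epsilon> c" using HH[of i \<eta> \<epsilon>] ca[of i \<epsilon>] by auto
  qed (rule c)
  from kan_fill[OF kan _ _ this] obtain m where m: "m \<in> cells X (Suc (Suc n))"
    and mf: "\<And>i \<epsilon>. 1 \<le> i \<Longrightarrow> i \<le> Suc (Suc n) \<Longrightarrow> (i, \<epsilon>) \<noteq> (Suc (Suc n), \<not> \<delta>) \<Longrightarrow>
        cface X (Suc n) i \<epsilon> m = (if i = Suc (Suc n) then c else H i \<epsilon>)"
    by auto
  show ?thesis
  proof (intro bexI allI impI)
    show "cface X (Suc n) (Suc (Suc n)) (\<not> \<delta>) m \<in> cells X (Suc n)" by (rule cface_cell[OF cub _ _ m]) auto
    fix i \<epsilon> assume i: "1 \<le> i" "i \<le> Suc n"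
    show "cface X n i \<epsilon> (cface X (Suc n) (Suc (Suc n)) (\<not> \<delta>) m) = (if \<delta> then a else b) i \<epsilon>"
      using cface_swap[OF m i, of \<epsilon> "\<not> \<delta>"] mf[of i \<epsilon>] HH[OF i, of "\<not> \<delta>" \<epsilon>] i by auto
  qed
qed

section \<open>Comparison with the homotopy group\<close>

abbreviation loops :: "nat \<Rightarrow> 'a cubical" where
  "loops n \<equiv> fst (iter_loop n X x)"

text \<open>The parts are proved together: the base point of stage \<open>n\<close> enters the
  definition of the cells of stage \<open>n + 1\<close>, and the faces in that definition are
  computed with the action of stage \<open>n\<close>.\<close>

lemma iter_loop_props:
  "cubical_set (loops n) \<and> snd (iter_loop n X x) = const_cell X x n \<and> const_cell X x n \<in> cells (loops n) 0 \<and>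
    (\<forall>m k. \<forall>f\<in>cube_hom m k. \<forall>u. act (loops n) m k f u = act X (n + m) (n + k) (cube_tensor n m (id_map n) f) u) \<and>
    (\<forall>k u. u \<in> cells (loops n) k \<longleftrightarrow> u \<in> cells X (n + k) \<and>
      (\<forall>p i \<epsilon>. n + k = Suc p \<longrightarrow> 1 \<le> i \<longrightarrow> i \<le> n \<longrightarrow> cface X p i \<epsilon> u = const_cell X x p))"
proof (induction n)
  case 0
  have "cube_tensor 0 m (id_map 0) f = f" if "f \<in> cube_hom m k" for m k f
    using cube_homD[OF that] by (auto simp: cube_tensor_def id_map_def verts_def fun_eq_iff PiE_iff extensional_def)
  then show ?case using cub point by (auto simp: const_cell_0)
next
  case (Suc n)
  then have C: "cubical_set (loops n)" and y: "snd (iter_loop n X x) = const_cell X x n"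
    and y0: "const_cell X x n \<in> cells (loops n) 0"
    and A: "\<And>m k f u. f \<in> cube_hom m k \<Longrightarrow>
      act (loops n) m k f u = act X (n + m) (n + k) (cube_tensor n m (id_map n) f) u"
    and L: "\<And>k u. u \<in> cells (loops n) k \<longleftrightarrow> u \<in> cells X (n + k) \<and>
      (\<forall>p i \<epsilon>. n + k = Suc p \<longrightarrow> 1 \<le> i \<longrightarrow> i \<le> n \<longrightarrow> cface X p i \<epsilon> u = const_cell X x p)"
    by blast+
  have S: "loops (Suc n) = loop_obj (loops n) (const_cell X x n)"
    "snd (iter_loop (Suc n) X x) = loop_point (loops n) (const_cell X x n)"
    using y by (simp_all add: case_prod_beta)
  have cst: "const_cell (loops n) (const_cell X x n) k = const_cell X x (n + k)" for k
  proof -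
    have "cube_tensor n k (id_map n) (terminal_map k) \<in> cube_hom (n + k) n"
      using cube_tensor_hom[OF cube_hom_id[of n] terminal_map_hom[of k]] by simp
    from act_const[OF this] show ?thesis
      unfolding const_cell_def[of "loops n"] A[OF terminal_map_hom] by simp
  qed
  have d1: "degeneracy 0 1 \<in> cube_hom 1 0" using degeneracy_hom[of 1 0] by simp
  have "loop_point (loops n) (const_cell X x n) = const_cell X x (Suc n)"
    using cst[of 1] terminal_map_unique[OF d1] by (simp add: loop_point_def const_cell_def[of "loops n"])
  moreover have "act (loops (Suc n)) m k f u = act X (Suc n + m) (Suc n + k) (cube_tensor (Suc n) m (id_map (Suc n)) f) u"
    if f: "f \<in> cube_hom m k" for m k f u
  proof -
    have "cube_tensor 1 m (id_map 1) f \<in> cube_hom (Suc m) (Suc k)"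
      using cube_tensor_hom[OF cube_hom_id[of 1] f] by simp
    from A[OF this, of u] show ?thesis
      unfolding S(1) by (simp add: loop_obj_def path_obj_def tensor_id_assoc)
  qed
  moreover have cell: "u \<in> cells (loops (Suc n)) k \<longleftrightarrow> u \<in> cells X (Suc n + k) \<and>
      (\<forall>p i \<epsilon>. Suc n + k = Suc p \<longrightarrow> 1 \<le> i \<longrightarrow> i \<le> Suc n \<longrightarrow> cface X p i \<epsilon> u = const_cell X x p)" for k u
  proof -
    have "face k 1 \<epsilon> \<in> cube_hom k (Suc k)" for \<epsilon> by (intro face_hom) auto
    from A[OF this] have "act (loops n) k (Suc k) (face k 1 \<epsilon>) u = cface X (n + k) (Suc n) \<epsilon> u" for \<epsilon>
      by (simp add: id_tensor_face cface_def)
    then have "u \<in> cells (loops (Suc n)) k \<longleftrightarrow> u \<in> cells (loops n) (Suc k) \<and>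
        (\<forall>\<epsilon>. cface X (n + k) (Suc n) \<epsilon> u = const_cell X x (n + k))"
      unfolding S(1) by (simp add: loop_obj_def path_obj_def cst)
    also have "\<dots> \<longleftrightarrow> u \<in> cells X (Suc n + k) \<and>
      (\<forall>p i \<epsilon>. Suc n + k = Suc p \<longrightarrow> 1 \<le> i \<longrightarrow> i \<le> Suc n \<longrightarrow> cface X p i \<epsilon> u = const_cell X x p)"
      by (auto simp: L elim!: le_SucE)
    finally show ?thesis .
  qed
  moreover have "const_cell X x (Suc n) \<in> cells (loops (Suc n)) 0"
    unfolding cell using const_in[of "Suc n"] by (auto simp: cface_const)
  moreover have "cubical_set (loops (Suc n))" unfolding S(1) by (rule cubical_set_loop_obj[OF C y0])
  ultimately show ?case using S(2) by simp
qed

lemma cubical_set_loops: "cubical_set (loops n)"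
  using iter_loop_props[of n] by blast

lemma loops_0_iff: "u \<in> cells (loops n) 0 \<longleftrightarrow> spherical n u"
  using iter_loop_props[of n] by (simp add: spherical_def)

lemma loops_1_iff: "p \<in> cells (loops n) 1 \<longleftrightarrow> (\<exists>w w'. rel_path n w w' p)"
  using iter_loop_props[of n] by (simp add: rel_path_def)

lemma act_loops_vertex: "act (loops n) 0 1 (face 0 1 \<epsilon>) p = cface X n (Suc n) \<epsilon> p"
proof -
  have "face 0 1 \<epsilon> \<in> cube_hom 0 1" using face_hom[of 1 0 \<epsilon>] by simp
  then show ?thesis using iter_loop_props[of n] by (simp add: id_tensor_face cface_def)
qed

text \<open>In the colimit a 1-cube is identified with both of its vertices.\<close>

lemma rel_path_homotopy_class:
  assumes "rel_path n w w' p"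
  shows "homotopy_class n X x w = homotopy_class n X x w'"
proof -
  have p: "p \<in> cells (loops n) 1" using assms loops_1_iff by blast
  have e: "face 0 1 \<epsilon> \<in> cube_hom 0 1" for \<epsilon> using face_hom[of 1 0 \<epsilon>] by simp
  have "pi0_equiv (loops n) `` {(1, p)} = pi0_equiv (loops n) `` {(0, cface X n (Suc n) \<epsilon> p)}" for \<epsilon>
    unfolding pi0_equiv_def act_loops_vertex[symmetric]
    by (rule gen_equiv_generator) (use e p cubical_set_act[OF cubical_set_loops e p] in auto)
  then show ?thesis using assms by (metis homotopy_class_def rel_path_def)
qed

text \<open>In the colimit a cell is identified with its vertex 0, so the 0-cubes represent all
  classes.\<close>

lemma homotopy_group_eq: "homotopy_group n X x = homotopy_class n X x ` {w. spherical n w}"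
proof -
  have "pi0_equiv (loops n) `` {(m, v)} = homotopy_class n X x (act (loops n) 0 m (zero_vertex m) v)"
    "spherical n (act (loops n) 0 m (zero_vertex m) v)"
    if v: "v \<in> cells (loops n) m" for m v
  proof -
    have a: "act (loops n) 0 m (zero_vertex m) v \<in> cells (loops n) 0"
      by (rule cubical_set_act[OF cubical_set_loops zero_vertex_hom v])
    then show "spherical n (act (loops n) 0 m (zero_vertex m) v)" by (simp add: loops_0_iff)
    show "pi0_equiv (loops n) `` {(m, v)} = homotopy_class n X x (act (loops n) 0 m (zero_vertex m) v)"
      unfolding pi0_equiv_def homotopy_class_def
      by (rule gen_equiv_generator) (use v a zero_vertex_hom in auto)
  qed
  then show ?thesis
    unfolding homotopy_group_def pi0_def
    by (auto simp: homotopy_class_def loops_0_iff elim!: quotientE intro!: quotientI)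
qed

section \<open>Pointed maps on the boundary as pointed families\<close>

abbreviation bmaps :: "nat \<Rightarrow> (nat \<Rightarrow> cube_map \<Rightarrow> 'a) set" where
  "bmaps n \<equiv> pointed_maps (bdry_cube (Suc n)) (zero_vertex (Suc n)) X x"

abbreviation bequiv :: "nat \<Rightarrow> ((nat \<Rightarrow> cube_map \<Rightarrow> 'a) \<times> (nat \<Rightarrow> cube_map \<Rightarrow> 'a)) set" where
  "bequiv n \<equiv> pointed_equiv (bdry_cube (Suc n)) (zero_vertex (Suc n)) X x"

lemma bmaps_zero:
  assumes "F \<in> cubical_maps (bdry_cube (Suc n)) X"
  shows "F 0 (zero_vertex (Suc n)) = act X 0 n (zero_vertex n) (F n (face n 1 False))"
  unfolding zero_vertex_Suc
  by (rule face_union_map_face[OF assms[unfolded bdry_cube_def] _ _ _ zero_vertex_hom]) auto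

lemma bmaps_family: "F \<in> bmaps n \<Longrightarrow> pointed_family n (\<lambda>i \<epsilon>. F n (face n i \<epsilon>))"
  using face_union_map_family[OF cub, of F n UNIV] bmaps_zero[of F n]
  unfolding pointed_family_def by (simp add: pointed_maps_def bdry_cube_def)

lemma bmaps_eqI:
  "F \<in> bmaps n \<Longrightarrow> G \<in> bmaps n \<Longrightarrow>
    (\<And>i \<epsilon>. 1 \<le> i \<Longrightarrow> i \<le> Suc n \<Longrightarrow> F n (face n i \<epsilon>) = G n (face n i \<epsilon>)) \<Longrightarrow> F = G"
  by (rule face_union_maps_eqI[of F n UNIV X G]) (auto simp: pointed_maps_def bdry_cube_def)

text \<open>By \<open>bmaps_eqI\<close> at most one map satisfies the description; one exists for
  every pointed family.\<close>

definition bmap :: "nat \<Rightarrow> (nat \<Rightarrow> bool \<Rightarrow> 'a) \<Rightarrow> nat \<Rightarrow> cube_map \<Rightarrow> 'a" where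
  "bmap n a = (SOME F. F \<in> bmaps n \<and> (\<forall>i \<epsilon>. 1 \<le> i \<longrightarrow> i \<le> Suc n \<longrightarrow> F n (face n i \<epsilon>) = a i \<epsilon>))"

lemma bmap:
  assumes a: "pointed_family n a"
  shows "bmap n a \<in> bmaps n" "\<And>i \<epsilon>. 1 \<le> i \<Longrightarrow> i \<le> Suc n \<Longrightarrow> bmap n a n (face n i \<epsilon>) = a i \<epsilon>"
proof -
  have af: "face_family X n UNIV a" and a0: "act X 0 n (zero_vertex n) (a 1 False) = x"
    using a by (auto simp: pointed_family_def)
  obtain F where F: "F \<in> cubical_maps (bdry_cube (Suc n)) X"
    "\<And>i \<epsilon> m g. 1 \<le> i \<Longrightarrow> i \<le> Suc n \<Longrightarrow> (i, \<epsilon>) \<in> UNIV \<Longrightarrow> g \<in> cube_hom m n \<Longrightarrow>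
      F m (compose (verts m) (face n i \<epsilon>) g) = act X m n g (a i \<epsilon>)"
    using face_family_extends[OF cub af] unfolding bdry_cube_def by blast
  have Ff: "F n (face n i \<epsilon>) = a i \<epsilon>" if "1 \<le> i" "i \<le> Suc n" for i \<epsilon>
    using F(2)[OF that UNIV_I cube_hom_id[of n]] comp_id_right[OF face_hom[OF that]]
      cubical_set_id[OF cub face_family_cell[OF af that UNIV_I]] by simp
  have "F \<in> bmaps n" using F(1) bmaps_zero[OF F(1)] Ff[of 1 False] a0 by (simp add: pointed_maps_def)
  then have "\<exists>F. F \<in> bmaps n \<and> (\<forall>i \<epsilon>. 1 \<le> i \<longrightarrow> i \<le> Suc n \<longrightarrow> F n (face n i \<epsilon>) = a i \<epsilon>)"
    using Ff by blast
  from someI_ex[OF this] show "bmap n a \<in> bmaps n"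
    "\<And>i \<epsilon>. 1 \<le> i \<Longrightarrow> i \<le> Suc n \<Longrightarrow> bmap n a n (face n i \<epsilon>) = a i \<epsilon>"
    unfolding bmap_def by blast+
qed

lemma bdry_homotopy_cong:
  assumes "bdry_homotopy X x n a b h"
    and "\<And>i \<epsilon>. 1 \<le> i \<Longrightarrow> i \<le> Suc n \<Longrightarrow> a i \<epsilon> = a' i \<epsilon>" "\<And>i \<epsilon>. 1 \<le> i \<Longrightarrow> i \<le> Suc n \<Longrightarrow> b i \<epsilon> = b' i \<epsilon>"
  shows "bdry_homotopy X x n a' b' h"
  using assms by (simp add: bdry_homotopy_def)

lemma bmap_equiv:
  assumes "pointed_family n a" "pointed_family n b" "bdry_homotopy X x n a b h"
  shows "(bmap n a, bmap n b) \<in> bequiv n"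
proof -
  have "bdry_homotopy X x n (\<lambda>i \<epsilon>. bmap n a n (face n i \<epsilon>)) (\<lambda>i \<epsilon>. bmap n b n (face n i \<epsilon>)) h"
    by (rule bdry_homotopy_cong[OF assms(3)]) (simp_all add: bmap assms)
  then have "pointed_homotopic (bdry_cube (Suc n)) (zero_vertex (Suc n)) X x (bmap n a) (bmap n b)"
    using bmap(1)[OF assms(1)] bmap(1)[OF assms(2)]
    by (intro pointed_homotopicI[OF cub point]) (auto simp: pointed_maps_def)
  then show ?thesis
    using bmap(1)[OF assms(1)] bmap(1)[OF assms(2)] by (auto simp: pointed_equiv_def gen_equiv_def)
qed

definition reduces :: "nat \<Rightarrow> (nat \<Rightarrow> cube_map \<Rightarrow> 'a) \<Rightarrow> 'a \<Rightarrow> bool" where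
  "reduces n F w \<longleftrightarrow> (\<exists>g h M. chain n (\<lambda>i \<epsilon>. F n (face n i \<epsilon>)) g h M \<and> h 0 = w)"

lemma bequiv_equiv: "equiv (bmaps n) (bequiv n)"
  unfolding pointed_equiv_def by (rule equiv_gen_equiv)

lemma reduces_total:
  assumes "F \<in> bmaps n"
  obtains w where "reduces n F w"
proof -
  obtain g h M where "chain n (\<lambda>i \<epsilon>. F n (face n i \<epsilon>)) g h M"
    by (rule chain_exists[OF bmaps_family[OF assms]])
  then show ?thesis using that by (auto simp: reduces_def)
qed

lemma reduces_spherical: "F \<in> bmaps n \<Longrightarrow> reduces n F w \<Longrightarrow> spherical n w"
  using chain_spherical[OF bmaps_family] unfolding reduces_def by blast

text \<open>The homotopies of \<open>chain_family_homotopy\<close> join the stages of the chain,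
  from the cap at stage 0 to \<open>F\<close> at stage \<open>n + 1\<close>. They are concatenated
  only by transitivity of the generated relation.\<close>

lemma reduces_equiv:
  assumes F: "F \<in> bmaps n" and w: "reduces n F w"
  shows "(bmap n (cap_family n w), F) \<in> bequiv n"
proof -
  obtain g h M where c: "chain n (\<lambda>i \<epsilon>. F n (face n i \<epsilon>)) g h M" and h0: "h 0 = w"
    using w by (auto simp: reduces_def)
  note a = bmaps_family[OF F]
  have g: "g \<in> cells X (Suc n)" using c by (simp add: chain_def)
  have p: "pointed_family n (chain_family n g h j)" if "j \<le> Suc n" for j
    by (rule chain_family_pointed[OF a c that])
  have "(bmap n (chain_family n g h 0), bmap n (chain_family n g h j)) \<in> bequiv n" if "j \<le> Suc n" for j
    using that
  proof (induction j)
    case 0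
    then show ?case using bequiv_equiv[of n] bmap(1)[OF p[of 0]] by (simp add: equiv_def refl_on_def)
  next
    case (Suc j)
    have "(bmap n (chain_family n g h j), bmap n (chain_family n g h (Suc j))) \<in> bequiv n"
      using chain_family_homotopy[OF a c, of "Suc j"] p Suc.prems by (intro bmap_equiv) auto
    with Suc show ?case using bequiv_equiv[of n] by (meson Suc_leD equivE transD)
  qed
  from this[of "Suc n"] have "(bmap n (chain_family n g h 0), bmap n (chain_family n g h (Suc n))) \<in> bequiv n"
    by simp
  moreover have "bmap n (chain_family n g h (Suc n)) = F"
  proof (rule bmaps_eqI[OF bmap(1)[OF p] F])
    fix i \<epsilon> assume "1 \<le> i" "i \<le> Suc n"
    then show "bmap n (chain_family n g h (Suc n)) n (face n i \<epsilon>) = F n (face n i \<epsilon>)"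
      using c by (auto simp: bmap(2)[OF p] chain_family_def trunc_self cubical_set_id[OF cub g] chain_def)
  qed simp
  moreover have "bmap n (chain_family n g h 0) = bmap n (cap_family n w)"
  proof (rule bmaps_eqI)
    have cp: "pointed_family n (cap_family n w)"
      using cap_family_pointed reduces_spherical[OF F w] by blast
    show "bmap n (chain_family n g h 0) \<in> bmaps n" "bmap n (cap_family n w) \<in> bmaps n"
      by (auto intro: bmap p cp)
    fix i \<epsilon> assume "1 \<le> i" "i \<le> Suc n"
    then show "bmap n (chain_family n g h 0) n (face n i \<epsilon>) = bmap n (cap_family n w) n (face n i \<epsilon>)"
      using trunc_0_const[OF g chain_zero[OF a c]]
      by (auto simp: bmap(2)[OF p] bmap(2)[OF cp] chain_family_def cap_family_def h0 cface_const)
  qed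
  ultimately show ?thesis by simp
qed

lemma reduces_homotopic:
  assumes "F \<in> bmaps n" "G \<in> bmaps n" "reduces n F w" "reduces n G w'"
    and "pointed_homotopic (bdry_cube (Suc n)) (zero_vertex (Suc n)) X x F G"
  shows "homotopy_class n X x w = homotopy_class n X x w'"
proof -
  obtain H where H: "bdry_homotopy X x n (\<lambda>i \<epsilon>. F n (face n i \<epsilon>)) (\<lambda>i \<epsilon>. G n (face n i \<epsilon>)) H"
    using pointed_homotopicE[OF cub point assms(5)] by blast
  obtain g h M where c: "chain n (\<lambda>i \<epsilon>. F n (face n i \<epsilon>)) g h M" "h 0 = w"
    using assms(3) by (auto simp: reduces_def)
  obtain g' h' M' where c': "chain n (\<lambda>i \<epsilon>. G n (face n i \<epsilon>)) g' h' M'" "h' 0 = w'"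
    using assms(4) by (auto simp: reduces_def)
  obtain p where "rel_path n (h 0) (h' 0) p"
    using chain_homotopy[OF bmaps_family[OF assms(1)] c(1) bmaps_family[OF assms(2)] c'(1) H] by blast
  then show ?thesis using rel_path_homotopy_class c(2) c'(2) by simp
qed

text \<open>To obtain a function of \<open>F\<close> without choosing a reduction, the classes of
  all its reductions are collected in \<open>r F\<close>. This set is invariant under single
  homotopies, hence under the generated relation; the constant homotopy of \<open>F\<close> shows
  that it has only one element.\<close>

lemma reduces_equiv_class:
  assumes FG: "(F, G) \<in> bequiv n" and w: "reduces n F w" and w': "reduces n G w'"
  shows "homotopy_class n X x w = homotopy_class n X x w'"
proof -
  define r where "r F = {homotopy_class n X x w | w. reduces n F w}" for F
  have inv: "r F = r G" if F: "F \<in> bmaps n" and G: "G \<in> bmaps n"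
    and FG: "pointed_homotopic (bdry_cube (Suc n)) (zero_vertex (Suc n)) X x F G" for F G
  proof -
    \<comment> \<open>Both sets are nonempty, and every element of one equals every element of the
      other.\<close>
    obtain w where w: "reduces n F w" by (rule reduces_total[OF F])
    obtain w' where w': "reduces n G w'" by (rule reduces_total[OF G])
    have "homotopy_class n X x v = homotopy_class n X x v'" if "reduces n F v" "reduces n G v'" for v v'
      by (rule reduces_homotopic[OF F G that FG])
    then show ?thesis unfolding r_def using w w' by blast
  qed
  have "r F = r G"
    by (rule gen_equiv_invariant[where h = r, OF FG[unfolded pointed_equiv_def]]) (use inv in blast)
  moreover have "homotopy_class n X x w' \<in> r G" unfolding r_def using w' by blast
  ultimately have "homotopy_class n X x w' \<in> r F" by simp
  then obtain w'' where w'': "reduces n F w''" "homotopy_class n X x w'' = homotopy_class n X x w'"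
    unfolding r_def by auto
  have F: "F \<in> bmaps n" using FG by (simp add: pointed_equiv_def gen_equiv_def)
  have "pointed_homotopic (bdry_cube (Suc n)) (zero_vertex (Suc n)) X x F F"
    using F homotopy_refl[OF bmaps_family[OF F]]
    by (intro pointed_homotopicI[OF cub point]) (auto simp: pointed_maps_def)
  from reduces_homotopic[OF F F w w''(1) this] show ?thesis by (simp add: w''(2))
qed

section \<open>Caps of homotopic cubes\<close>

lemma chain_cong:
  assumes "chain n a g h M" "\<And>i \<epsilon>. 1 \<le> i \<Longrightarrow> i \<le> Suc n \<Longrightarrow> a i \<epsilon> = b i \<epsilon>"
  shows "chain n b g h M"
  using assms by (auto simp: chain_def)

lemma reduces_cap: "spherical n w \<Longrightarrow> reduces n (bmap n (cap_family n w)) w"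
  unfolding reduces_def
  by (intro exI conjI, rule chain_cong[OF chain_cap])
     (auto simp: bmap(2)[OF cap_family_pointed])

text \<open>By \<open>natural_map_class\<close> this is the value of the natural map at the class of
  \<open>w\<close>.\<close>

abbreviation bclass :: "nat \<Rightarrow> 'a \<Rightarrow> (nat \<Rightarrow> cube_map \<Rightarrow> 'a) set" where
  "bclass n w \<equiv> pointed_class (bdry_cube (Suc n)) (zero_vertex (Suc n)) X x (bmap n (cap_family n w))"

text \<open>Both ends are vertices of a 1-cube of the loop space, hence 0-cubes of the loop
  space.\<close>

lemma rel_path_spherical:
  assumes "rel_path n w w' p"
  shows "spherical n w" "spherical n w'"
proof -
  have p: "p \<in> cells (loops n) 1" using assms loops_1_iff by blast
  have e: "face 0 1 \<epsilon> \<in> cube_hom 0 1" for \<epsilon> using face_hom[of 1 0 \<epsilon>] by simp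
  have "spherical n (cface X n (Suc n) \<epsilon> p)" for \<epsilon>
    using cubical_set_act[OF cubical_set_loops e p, of \<epsilon>] by (simp add: act_loops_vertex loops_0_iff)
  then show "spherical n w" "spherical n w'" using assms unfolding rel_path_def by metis+
qed

lemma rel_path_bclass:
  assumes "rel_path n w w' p"
  shows "bclass n w = bclass n w'"
  unfolding pointed_class_def
  by (rule equiv_class_eq[OF bequiv_equiv bmap_equiv[OF _ _ rel_path_homotopy[OF assms]]])
     (use rel_path_spherical[OF assms] cap_family_pointed in auto)

text \<open>The colimit defining \<open>pi0\<close> ranges over cubes of all dimensions, so
  invariance along 1-cubes has to be extended to all vertices of a cube of the loop space. A vertex
  is moved, by induction, to the vertex 0 of the face in direction 1 that contains it, and from
  there along one edge.\<close>

lemma bclass_vertex: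
  "v \<in> cells (loops n) m \<Longrightarrow> q \<in> cube_hom 0 m \<Longrightarrow>
    bclass n (act (loops n) 0 m q v) = bclass n (act (loops n) 0 m (zero_vertex m) v)"
proof (induction m arbitrary: v q)
  case 0
  then show ?case using terminal_map_unique[of q 0] terminal_map_unique[OF zero_vertex_hom[of 0]] by simp
next
  case (Suc m)
  note C = cubical_set_loops[of n]
  have f: "face m 1 b \<in> cube_hom m (Suc m)" for b by (intro face_hom) auto
  define q' where "q' = compose (verts 0) (degeneracy m 1) q"
  have q': "q' \<in> cube_hom 0 m"
    unfolding q'_def by (rule cube_hom_comp[OF Suc.prems(2) degeneracy_hom]) auto
  \<comment> \<open>The first coordinate of the vertex \<open>q\<close> decides in which of two
    opposite faces it lies.\<close>
  have q: "q = compose (verts 0) (face m 1 (hd (q []))) q'"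
  proof (rule cube_hom_eqI[OF Suc.prems(2) cube_hom_comp[OF q' f]])
    fix v :: "bool list" assume "length v = 0"
    moreover have "length (q []) = Suc m" by (rule cube_hom_length[OF Suc.prems(2)]) simp
    ultimately show "q v = compose (verts 0) (face m 1 (hd (q []))) q' v"
      by (cases "q []") (auto simp: q'_def app_simps take_Cons' drop_Cons')
  qed
  \<comment> \<open>The edge in direction 1 that joins the vertices 0 of these two faces.\<close>
  define e where "e = cube_tensor 1 0 (id_map 1) (zero_vertex m)"
  have e: "e \<in> cube_hom 1 (Suc m)"
    using cube_tensor_hom[OF cube_hom_id[of 1] zero_vertex_hom[of m]] by (simp add: e_def)
  have v01: "face 0 1 b \<in> cube_hom 0 1" for b using face_hom[of 1 0 b] by simp
  have ev: "compose (verts 0) (face m 1 b) (zero_vertex m) = compose (verts 0) e (face 0 1 b)" for b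
    by (rule cube_hom_eqI[OF cube_hom_comp[OF zero_vertex_hom f] cube_hom_comp[OF v01 e]])
       (simp add: app_simps e_def take_Cons' drop_Cons')
  define p where "p = act (loops n) 1 (Suc m) e v"
  have p: "p \<in> cells (loops n) 1" unfolding p_def by (rule cubical_set_act[OF C e Suc.prems(1)])
  have step: "bclass n (act (loops n) 0 (Suc m) (compose (verts 0) (face m 1 b) r) v) =
      bclass n (cface X n (Suc n) b p)" if r: "r \<in> cube_hom 0 m" for b r
  proof -
    have "bclass n (act (loops n) 0 (Suc m) (compose (verts 0) (face m 1 b) r) v) =
        bclass n (act (loops n) 0 m r (act (loops n) m (Suc m) (face m 1 b) v))"
      by (simp add: cubical_set_comp[OF C r f Suc.prems(1)])
    also have "\<dots> = bclass n (act (loops n) 0 m (zero_vertex m) (act (loops n) m (Suc m) (face m 1 b) v))"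
      by (rule Suc.IH[OF cubical_set_act[OF C f Suc.prems(1)] r])
    also have "\<dots> = bclass n (act (loops n) 0 1 (face 0 1 b) p)"
      by (simp add: p_def cubical_set_comp[OF C zero_vertex_hom f Suc.prems(1)]
          cubical_set_comp[OF C v01 e Suc.prems(1)] ev)
    finally show ?thesis by (simp add: act_loops_vertex)
  qed
  obtain w w' where w: "rel_path n w w' p" using p loops_1_iff by blast
  then have "bclass n (cface X n (Suc n) b p) = bclass n w" for b
    using rel_path_bclass[OF w] by (cases b) (simp_all add: rel_path_def)
  then show ?case
    using step[OF q', of "hd (q [])"] step[OF zero_vertex_hom, of False] q zero_vertex_Suc[of m] by simp
qed

text \<open>The function \<open>k\<close> sends a cell to the class of the cap of its vertex 0. It
  respects the generators of the colimit because an operator replaces the vertex 0 by some vertex of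
  the same cell, which \<open>bclass_vertex\<close> allows.\<close>

lemma homotopy_class_bclass:
  assumes w: "spherical n w" and w': "spherical n w'" and eq: "homotopy_class n X x w = homotopy_class n X x w'"
  shows "bclass n w = bclass n w'"
proof -
  note C = cubical_set_loops[of n]
  define k where "k = (\<lambda>(m, v). bclass n (act (loops n) 0 m (zero_vertex m) v))"
  have k: "k (0, u) = bclass n u" if "spherical n u" for u
  proof -
    have "zero_vertex 0 = id_map 0" by (auto simp: zero_vertex_def id_map_def verts_def)
    then show ?thesis using cubical_set_id[OF C, of u 0] that by (simp add: k_def loops_0_iff)
  qed
  have "equiv (Sigma UNIV (cells (loops n))) (pi0_equiv (loops n))"
    unfolding pi0_equiv_def by (rule equiv_gen_equiv)
  then have "((0, w), (0, w')) \<in> pi0_equiv (loops n)"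
    using eq w' by (intro eq_equiv_class) (auto simp: homotopy_class_def loops_0_iff)
  then have "k (0, w) = k (0, w')"
    unfolding pi0_equiv_def
  proof (rule gen_equiv_invariant)
    fix a b assume "(a, b) \<in> {((l, u), (m, act (loops n) m l f u)) | m l f u. f \<in> cube_hom m l \<and> u \<in> cells (loops n) l}"
    then obtain m l f u where a: "a = (l, u)" and b: "b = (m, act (loops n) m l f u)"
      and f: "f \<in> cube_hom m l" and u: "u \<in> cells (loops n) l" by blast
    show "k a = k b"
      using bclass_vertex[OF u cube_hom_comp[OF zero_vertex_hom f]]
      by (simp add: a b k_def cubical_set_comp[OF C zero_vertex_hom f u])
  qed
  then show ?thesis by (simp add: k w w')
qed

section \<open>Maps out of the sphere and computation of the natural map\<close>

lemma sphere_map_base: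
  assumes "F \<in> pointed_maps (sphere n) (sphere_base n 0) X x"
  shows "F m (sphere_base n m) = const_cell X x m"
  using cubical_maps_act[of F "sphere n" X "terminal_map m" m 0 "sphere_base n 0"] assms
    sphere_act_base[OF terminal_map_hom[of m], of n] sphere_base_in[of n 0] terminal_map_hom[of m]
  by (simp add: pointed_maps_def const_cell_def)

text \<open>Faces of the cube become the base point in the quotient, which makes the cube of
  \<open>F\<close> spherical. The second part compares two boundary maps on their faces, where
  \<open>collapse\<close> is the quotient map once and the base point otherwise.\<close>

lemma sphere_map_collapse:
  assumes F: "F \<in> pointed_maps (sphere n) (sphere_base n 0) X x"
  shows "spherical n (F n (sphere_quot n n (id_map n)))"
    and "map_comp (bdry_cube (Suc n)) F (collapse n) = bmap n (cap_family n (F n (sphere_quot n n (id_map n))))"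
proof -
  let ?u = "F n (sphere_quot n n (id_map n))"
  have Fm: "F \<in> cubical_maps (sphere n) X" using F by (simp add: pointed_maps_def)
  have "cface X p i \<epsilon> ?u = const_cell X x p" if n: "n = Suc p" and i: "1 \<le> i" "i \<le> n" for p i \<epsilon>
  proof -
    have f: "face p i \<epsilon> \<in> cube_hom p (Suc p)" using i n by (intro face_hom) auto
    have "cface X p i \<epsilon> ?u = F p (act (sphere n) p n (face p i \<epsilon>) (sphere_quot n n (id_map n)))"
      using cubical_maps_act[OF Fm _ sphere_quot_in[OF cube_hom_id], of "face p i \<epsilon>" p] f
      by (simp add: cface_def n)
    also have "\<dots> = F p (sphere_quot n p (face p i \<epsilon>))"
      using f by (simp add: sphere_act_quot cube_hom_id n comp_id_left[OF f])
    also have "sphere_quot n p (face p i \<epsilon>) = sphere_base n p"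
      using face_in_face_union[of i p \<epsilon> UNIV] i n by (intro sphere_quot_bdry) (simp add: bdry_cube_def)
    finally show ?thesis by (simp add: sphere_map_base[OF F])
  qed
  moreover have "?u \<in> cells X n" by (rule cubical_maps_cell[OF Fm sphere_quot_in[OF cube_hom_id]])
  ultimately show s: "spherical n ?u" by (simp add: spherical_def)
  have Q: "collapse n \<in> cubical_maps (bdry_cube (Suc n)) (sphere n)"
    "collapse n 0 (zero_vertex (Suc n)) = sphere_base n 0"
    using collapse_pointed[of n] by (simp_all add: pointed_maps_def)
  have Z: "cubical_set (bdry_cube (Suc n))" unfolding bdry_cube_def by (rule cubical_set_face_union)
  have faceZ: "face n i \<epsilon> \<in> cells (bdry_cube (Suc n)) n" if "1 \<le> i" "i \<le> Suc n" for i \<epsilon>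
    unfolding bdry_cube_def using that by (intro face_in_face_union) auto
  have zZ: "zero_vertex (Suc n) \<in> cells (bdry_cube (Suc n)) 0"
    unfolding zero_vertex_Suc bdry_cube_def face_union_cell_iff using zero_vertex_hom by fastforce
  let ?G = "map_comp (bdry_cube (Suc n)) F (collapse n)"
  have G: "?G \<in> bmaps n"
    using map_comp_maps[OF Q(1) Fm Z] Q(2) F zZ by (simp add: pointed_maps_def map_comp_def compose_eq)
  have cf: "collapse n n (face n i \<epsilon>) =
      (if i = Suc n \<and> \<epsilon> = id_end n then sphere_quot n n (id_map n) else sphere_base n n)"
    if i: "1 \<le> i" "i \<le> Suc n" for i \<epsilon>
    using collapse_face[OF cube_hom_id[of n]] collapse_other_face[OF i(1) _ cube_hom_id[of n], of \<epsilon>] i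
      comp_id_right[OF face_hom[OF i]]
    by auto
  have "pointed_family n (cap_family n ?u)" by (rule cap_family_pointed[OF s])
  then show "?G = bmap n (cap_family n ?u)"
    using cf faceZ sphere_map_base[OF F]
    by (intro bmaps_eqI[OF G bmap(1)]) (auto simp: bmap map_comp_def compose_eq cap_family_def)
qed

text \<open>The universal property of the pushout. It shows that \<open>sphere_class\<close> of the
  class of \<open>w\<close> is nonempty, without which the union in \<open>precomp_class\<close>
  would be empty.\<close>

lemma sphere_map_exists:
  assumes w: "spherical n w"
  obtains F where "F \<in> pointed_maps (sphere n) (sphere_base n 0) X x" "F n (sphere_quot n n (id_map n)) = w"
proof -
  have wn: "w \<in> cells X n" using w by (simp add: spherical_def)
  define val where "val m = case_sum (\<lambda>g. act X m n g w) (\<lambda>_ :: cube_map. const_cell X x m)" for m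
  define F where "F m = (\<lambda>C\<in>cells (sphere n) m. the_elem (val m ` C))" for m
  have inv: "val m s = val m t" if "(s, t) \<in> sphere_equiv n m" for m s t
    using that unfolding sphere_equiv_def pushout_equiv_def
  proof (rule gen_equiv_invariant)
    fix a b :: "cube_map + cube_map"
    assume "(a, b) \<in> {(Inl ((\<lambda>u\<in>cells (bdry_cube n) m. u) c),
      Inr ((\<lambda>u\<in>cells (bdry_cube n) m. terminal_map m) c)) | c. c \<in> cells (bdry_cube n) m}"
    then obtain c where c: "c \<in> cells (bdry_cube n) m" and a: "a = Inl c" and b: "b = Inr (terminal_map m)"
      by auto
    obtain i \<epsilon> g where i: "1 \<le> i" "i \<le> n" and g: "g \<in> cube_hom m (n - 1)"
      and cg: "c = compose (verts m) (face (n - 1) i \<epsilon>) g"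
      using c by (auto simp: bdry_cube_def face_union_def)
    obtain p where n: "n = Suc p" using i by (cases n) auto
    have "act X m n c w = act X m p g (cface X p i \<epsilon> w)"
      using act_cface[OF cub i(1), of p g m w \<epsilon>] i g wn by (simp add: cg n)
    also have "\<dots> = const_cell X x m"
      using w i g act_const[of g m p] by (simp add: spherical_def n)
    finally show "val m a = val m b" by (simp add: a b val_def)
  qed
  have F: "F m (sphere_equiv n m `` {s}) = val m s" if "s \<in> cells (std_cube n) m <+> cells (std_cube 0) m" for m s
  proof -
    have "s \<in> sphere_equiv n m `` {s}" by (rule equiv_class_self[OF sphere_equiv_equiv that])
    moreover have "val m t = val m s" if "t \<in> sphere_equiv n m `` {s}" for t
      using inv[of s t m] that by simp
    ultimately have "val m ` (sphere_equiv n m `` {s}) = {val m s}" by blast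
    moreover have "sphere_equiv n m `` {s} \<in> cells (sphere n) m"
      using that unfolding sphere_def pushout_def sphere_equiv_def by (simp add: quotientI)
    ultimately show ?thesis by (simp add: F_def)
  qed
  have Fq: "F m (sphere_quot n m g) = act X m n g w" if "g \<in> cube_hom m n" for m g
    unfolding sphere_quot_def by (subst F) (use that in \<open>auto simp: std_cube_def val_def\<close>)
  have Fb: "F m (sphere_base n m) = const_cell X x m" for m
    unfolding sphere_base_def by (subst F) (use terminal_map_hom[of m] in \<open>auto simp: std_cube_def val_def\<close>)
  have "F \<in> cubical_maps (sphere n) X"
    unfolding cubical_maps_def
  proof (intro CollectI conjI allI ballI)
    fix m
    show "F m \<in> cells (sphere n) m \<rightarrow>\<^sub>E cells X m"
    proof (rule PiE_I)
      fix C assume "C \<in> cells (sphere n) m"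
      then show "F m C \<in> cells X m"
        by (cases rule: sphere_cell_cases) (auto simp: Fq Fb const_in cubical_set_act[OF cub _ wn])
    qed (simp add: F_def)
  next
    fix k m f C assume f: "f \<in> cube_hom k m" and "C \<in> cells (sphere n) m"
    from this(2) show "F k (act (sphere n) k m f C) = act X k m f (F m C)"
      by (cases rule: sphere_cell_cases)
         (simp_all add: sphere_act_quot[OF f] sphere_act_base[OF f] Fq Fb act_const[OF f]
           cube_hom_comp[OF f] cubical_set_comp[OF cub f _ wn])
  qed
  moreover have "F 0 (sphere_base n 0) = x" by (simp add: Fb const_cell_0[OF cub point])
  moreover have "F n (sphere_quot n n (id_map n)) = w" by (simp add: Fq cube_hom_id cubical_set_id[OF cub wn])
  ultimately show ?thesis using that by (simp add: pointed_maps_def)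
qed

text \<open>The union in \<open>precomp_class\<close> is a single class: there is at least one
  representative, and by \<open>homotopy_class_bclass\<close> all representatives contribute the
  same class.\<close>

lemma natural_map_class:
  assumes w: "spherical n w"
  shows "natural_map n X x (homotopy_class n X x w) = bclass n w"
proof -
  let ?K = "sphere_class n X x (homotopy_class n X x w)"
  have eq: "equiv (Sigma UNIV (cells (loops n))) (pi0_equiv (loops n))"
    unfolding pi0_equiv_def by (rule equiv_gen_equiv)
  have "pointed_class (bdry_cube (Suc n)) (zero_vertex (Suc n)) X x
      (map_comp (bdry_cube (Suc n)) F (collapse n)) = bclass n w" if F: "F \<in> ?K" for F
  proof -
    have Fp: "F \<in> pointed_maps (sphere n) (sphere_base n 0) X x"
      and "(0, F n (sphere_quot n n (id_map n))) \<in> homotopy_class n X x w"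
      using F by (auto simp: sphere_class_def)
    then have "homotopy_class n X x w = homotopy_class n X x (F n (sphere_quot n n (id_map n)))"
      unfolding homotopy_class_def by (intro equiv_class_eq[OF eq]) simp
    from homotopy_class_bclass[OF w sphere_map_collapse(1)[OF Fp] this] show ?thesis
      by (simp add: sphere_map_collapse(2)[OF Fp])
  qed
  moreover have "?K \<noteq> {}"
  proof -
    obtain F where F: "F \<in> pointed_maps (sphere n) (sphere_base n 0) X x" "F n (sphere_quot n n (id_map n)) = w"
      by (rule sphere_map_exists[OF w])
    have "(0, w) \<in> homotopy_class n X x w"
      unfolding homotopy_class_def by (rule equiv_class_self[OF eq]) (simp add: loops_0_iff w)
    with F have "F \<in> ?K" by (simp add: sphere_class_def)
    then show ?thesis by blast
  qed
  ultimately show ?thesis by (auto simp: natural_map_def precomp_class_def)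
qed

text \<open>By the Yoneda correspondence a map out of the standard cube is its value at the
  identity, and agreement on the boundary is agreement on each face.\<close>

lemma has_filler_iff:
  assumes F: "F \<in> bmaps n"
  shows "has_filler (Suc n) X F \<longleftrightarrow>
    (\<exists>c\<in>cells X (Suc n). \<forall>i \<epsilon>. 1 \<le> i \<longrightarrow> i \<le> Suc n \<longrightarrow> cface X n i \<epsilon> c = F n (face n i \<epsilon>))"
proof
  have faceZ: "face n i \<epsilon> \<in> cells (bdry_cube (Suc n)) n" if "1 \<le> i" "i \<le> Suc n" for i \<epsilon>
    unfolding bdry_cube_def using that by (intro face_in_face_union) auto
  have idc: "id_map (Suc n) \<in> cells (std_cube (Suc n)) (Suc n)" by (simp add: std_cube_def cube_hom_id)
  assume "has_filler (Suc n) X F"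
  then obtain G where G: "G \<in> cubical_maps (std_cube (Suc n)) X"
    "\<And>m u. u \<in> cells (bdry_cube (Suc n)) m \<Longrightarrow> G m u = F m u"
    by (auto simp: has_filler_def)
  have "cface X n i \<epsilon> (G (Suc n) (id_map (Suc n))) = F n (face n i \<epsilon>)" if i: "1 \<le> i" "i \<le> Suc n" for i \<epsilon>
    unfolding cface_def cubical_maps_act[OF G(1) face_hom[OF i] idc, symmetric]
    by (simp add: std_cube_def comp_id_left[OF face_hom[OF i]] G(2)[OF faceZ[OF i]])
  then show "\<exists>c\<in>cells X (Suc n). \<forall>i \<epsilon>. 1 \<le> i \<longrightarrow> i \<le> Suc n \<longrightarrow> cface X n i \<epsilon> c = F n (face n i \<epsilon>)"
    using cubical_maps_cell[OF G(1) idc] by blast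
next
  assume "\<exists>c\<in>cells X (Suc n). \<forall>i \<epsilon>. 1 \<le> i \<longrightarrow> i \<le> Suc n \<longrightarrow> cface X n i \<epsilon> c = F n (face n i \<epsilon>)"
  then obtain c where c: "c \<in> cells X (Suc n)"
    and cf: "\<And>i \<epsilon>. 1 \<le> i \<Longrightarrow> i \<le> Suc n \<Longrightarrow> cface X n i \<epsilon> c = F n (face n i \<epsilon>)" by blast
  have Fm: "F \<in> cubical_maps (face_union (Suc n) UNIV) X"
    using F by (simp add: pointed_maps_def bdry_cube_def)
  have "act X m (Suc n) u c = F m u" if "u \<in> cells (bdry_cube (Suc n)) m" for m u
  proof -
    obtain i \<epsilon> g where i: "1 \<le> i" "i \<le> Suc n" and g: "g \<in> cube_hom m n" and u: "u = compose (verts m) (face n i \<epsilon>) g"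
      using \<open>u \<in> _\<close> unfolding bdry_cube_def face_union_cell_iff by blast
    have "act X m (Suc n) u c = act X m n g (cface X n i \<epsilon> c)"
      unfolding u by (rule act_cface[symmetric, OF cub i g c])
    also have "\<dots> = F m u"
      unfolding u cf[OF i] by (rule face_union_map_face[symmetric, OF Fm i UNIV_I g])
    finally show ?thesis .
  qed
  moreover have "u \<in> cube_hom m (Suc n)" if "u \<in> cells (bdry_cube (Suc n)) m" for m u
    using that unfolding bdry_cube_def by (rule face_union_cell_hom)
  ultimately show "has_filler (Suc n) X F"
    unfolding has_filler_def by (intro bexI[OF _ std_cube_map[OF cub c]]) simp
qed

text \<open>Having a filler passes along a single homotopy in both directions, by the two values of
  \<delta> in \<open>homotopy_filler\<close>, and hence along the generated relation.\<close>

lemma has_filler_equiv: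
  assumes "(F, G) \<in> bequiv n"
  shows "has_filler (Suc n) X F \<longleftrightarrow> has_filler (Suc n) X G"
  using assms unfolding pointed_equiv_def
proof (rule gen_equiv_invariant)
  fix F G
  assume "(F, G) \<in> {(F, G). F \<in> bmaps n \<and> G \<in> bmaps n \<and>
    pointed_homotopic (bdry_cube (Suc n)) (zero_vertex (Suc n)) X x F G}"
  then have F: "F \<in> bmaps n" and G: "G \<in> bmaps n"
    and FG: "pointed_homotopic (bdry_cube (Suc n)) (zero_vertex (Suc n)) X x F G" by auto
  obtain H where H: "bdry_homotopy X x n (\<lambda>i \<epsilon>. F n (face n i \<epsilon>)) (\<lambda>i \<epsilon>. G n (face n i \<epsilon>)) H"
    using pointed_homotopicE[OF cub point FG] by blast
  show "has_filler (Suc n) X F = has_filler (Suc n) X G"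
    unfolding has_filler_iff[OF F] has_filler_iff[OF G]
    using homotopy_filler[OF H, where \<delta> = True] homotopy_filler[OF H, where \<delta> = False] by auto
qed

section \<open>Bijectivity and the criterion for fillers\<close>

lemma const_spherical: "spherical n (const_cell X x n)"
  using const_in by (auto simp: spherical_def cface_const)

lemma pointed_class_reduces:
  assumes "F \<in> bmaps n" "reduces n F w"
  shows "bclass n w = pointed_class (bdry_cube (Suc n)) (zero_vertex (Suc n)) X x F"
  unfolding pointed_class_def by (rule equiv_class_eq[OF bequiv_equiv reduces_equiv[OF assms]])

text \<open>The class of \<open>w\<close> is recovered from the class of its cap, because the cap
  reduces to \<open>w\<close>.\<close>

lemma inj_natural_map: "inj_on (natural_map n X x) (homotopy_group n X x)"
proof (rule inj_onI)
  fix c d assume cd: "c \<in> homotopy_group n X x" "d \<in> homotopy_group n X x"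
    and eq: "natural_map n X x c = natural_map n X x d"
  obtain w w' where w: "spherical n w" "spherical n w'" and c: "c = homotopy_class n X x w"
    and d: "d = homotopy_class n X x w'" using cd by (auto simp: homotopy_group_eq)
  have "bclass n w = bclass n w'" using eq w by (simp add: c d natural_map_class)
  then have "(bmap n (cap_family n w), bmap n (cap_family n w')) \<in> bequiv n"
    unfolding pointed_class_def
    by (rule eq_equiv_class[OF _ bequiv_equiv]) (rule bmap(1)[OF cap_family_pointed[OF w(2)]])
  from reduces_equiv_class[OF this reduces_cap[OF w(1)] reduces_cap[OF w(2)]] show "c = d"
    by (simp add: c d)
qed

lemma bij_natural_map:
  "bij_betw (natural_map n X x) (homotopy_group n X x)
     (pointed_classes (bdry_cube (Suc n)) (zero_vertex (Suc n)) X x)"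
proof -
  have "natural_map n X x ` homotopy_group n X x = pointed_classes (bdry_cube (Suc n)) (zero_vertex (Suc n)) X x"
  proof
    show "natural_map n X x ` homotopy_group n X x \<subseteq> pointed_classes (bdry_cube (Suc n)) (zero_vertex (Suc n)) X x"
      using bmap(1)[OF cap_family_pointed]
      by (auto simp: homotopy_group_eq natural_map_class pointed_classes_def pointed_class_def intro!: quotientI)
    show "pointed_classes (bdry_cube (Suc n)) (zero_vertex (Suc n)) X x \<subseteq> natural_map n X x ` homotopy_group n X x"
    proof
      fix C assume "C \<in> pointed_classes (bdry_cube (Suc n)) (zero_vertex (Suc n)) X x"
      then obtain F where F: "F \<in> bmaps n" and C: "C = pointed_class (bdry_cube (Suc n)) (zero_vertex (Suc n)) X x F"
        by (auto simp: pointed_classes_def pointed_class_def elim!: quotientE)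
      obtain w where w: "reduces n F w" by (rule reduces_total[OF F])
      have "natural_map n X x (homotopy_class n X x w) = C"
        using natural_map_class[OF reduces_spherical[OF F w]] pointed_class_reduces[OF F w] by (simp add: C)
      then show "C \<in> natural_map n X x ` homotopy_group n X x"
        using reduces_spherical[OF F w] by (auto simp: homotopy_group_eq)
    qed
  qed
  with inj_natural_map show ?thesis by (simp add: bij_betw_def)
qed

text \<open>The preimage is the class of any reduction \<open>w\<close> of \<open>f\<close>. If it
  is trivial, \<open>f\<close> is equivalent to the cap of the constant cube, which the constant
  cube of dimension \<open>n + 1\<close> fills. Conversely a filler yields a second reduction of
  \<open>f\<close>, to the constant cube, and all reductions of \<open>f\<close> have the same
  class.\<close>

lemma inv_natural_map_trivial_iff:
  assumes F: "f \<in> bmaps n"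
  shows "inv_into (homotopy_group n X x) (natural_map n X x)
      (pointed_class (bdry_cube (Suc n)) (zero_vertex (Suc n)) X x f)
      = homotopy_class n X x (degenerate_point X x n) \<longleftrightarrow> has_filler (Suc n) X f"
proof -
  obtain w where w: "reduces n f w" by (rule reduces_total[OF F])
  note sw = reduces_spherical[OF F w]
  have inv: "inv_into (homotopy_group n X x) (natural_map n X x)
      (pointed_class (bdry_cube (Suc n)) (zero_vertex (Suc n)) X x f) = homotopy_class n X x w"
    unfolding pointed_class_reduces[OF F w, symmetric] natural_map_class[OF sw, symmetric]
    by (rule inv_into_f_f[OF inj_natural_map]) (use sw in \<open>auto simp: homotopy_group_eq\<close>)
  have "homotopy_class n X x w = homotopy_class n X x (const_cell X x n) \<longleftrightarrow> has_filler (Suc n) X f"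
  proof
    assume "homotopy_class n X x w = homotopy_class n X x (const_cell X x n)"
    then have "bclass n (const_cell X x n) = pointed_class (bdry_cube (Suc n)) (zero_vertex (Suc n)) X x f"
      using homotopy_class_bclass[OF sw const_spherical] pointed_class_reduces[OF F w] by simp
    then have e: "(bmap n (cap_family n (const_cell X x n)), f) \<in> bequiv n"
      unfolding pointed_class_def by (rule eq_equiv_class[OF _ bequiv_equiv F])
    note p = cap_family_pointed[OF const_spherical]
    have "has_filler (Suc n) X (bmap n (cap_family n (const_cell X x n)))"
      unfolding has_filler_iff[OF bmap(1)[OF p]]
      by (intro bexI[OF _ const_in]) (auto simp: bmap(2)[OF p] cap_family_def cface_const)
    then show "has_filler (Suc n) X f" using has_filler_equiv[OF e] by simp
  next
    assume "has_filler (Suc n) X f"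
    then obtain c where c: "c \<in> cells X (Suc n)"
      "\<And>i \<epsilon>. 1 \<le> i \<Longrightarrow> i \<le> Suc n \<Longrightarrow> cface X n i \<epsilon> c = f n (face n i \<epsilon>)"
      using has_filler_iff[OF F] by blast
    obtain h M where "chain n (\<lambda>i \<epsilon>. f n (face n i \<epsilon>)) c h M" "h 0 = const_cell X x n"
      using chain_filler[OF bmaps_family[OF F] c] by blast
    then have "reduces n f (const_cell X x n)" by (auto simp: reduces_def)
    moreover have "(f, f) \<in> bequiv n" using bequiv_equiv[of n] F by (simp add: equiv_def refl_on_def)
    ultimately show "homotopy_class n X x w = homotopy_class n X x (const_cell X x n)"
      using reduces_equiv_class w by blast
  qed
  then show ?thesis
    by (simp only: inv degenerate_point_eq_const_cell[OF cub point])
qed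

end

theorem theorem3p22:
  fixes X :: "'a cubical" and x :: 'a and n :: nat
  assumes "kan_complex X" and "x \<in> cells X 0"
  shows "bij_betw (natural_map n X x) (homotopy_group n X x)
           (pointed_classes (bdry_cube (n + 1)) (zero_vertex (n + 1)) X x) \<and>
         (\<forall>f\<in>pointed_maps (bdry_cube (n + 1)) (zero_vertex (n + 1)) X x.
            inv_into (homotopy_group n X x) (natural_map n X x)
              (pointed_class (bdry_cube (n + 1)) (zero_vertex (n + 1)) X x f)
              = homotopy_class n X x (degenerate_point X x n) \<longleftrightarrow>
            has_filler (n + 1) X f)"
proof -
  interpret pointed_kan X x using assms by unfold_locales
  show ?thesis using bij_natural_map[of n] inv_natural_map_trivial_iff[of _ n] by simp
qed

end
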